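(* Let $0<b_1<b_2<1$, $n\ge1$, and let $\lambda_0,\dots,\lambda_n\in(0,1)$ with $\sum_{k=0}^n\lambda_k=1$. There is a unique probability measure on $\{0,1,\dots,n\}^{\mathbb{Z}}$ that is ergodic (translation-invariant and ergodic with respect to translations of $\mathbb{Z}$), stationary for the multi-class stochastic six-vertex process on the line with parameters $b_1,b_2$ and classes $\{0,1,\dots,n\}$, and such that a configuration $\eta_0$ with this law satisfies $\mathbb{P}(\eta_0(x)=k)=\lambda_k$ for all $x\in\mathbb{Z}$ and $k\in\{0,\dots,n\}$.
   Context: Multi-class stochastic six-vertex process on the line: each vertex $(x,t)\in\mathbb{Z}\times\mathbb{Z}_{\ge0}$ has two incoming edges (bottom, left) and two outgoing edges (top, right). Every edge carries a class in a totally ordered set (here $\{0,\dots,n\}$; smaller classes have priority; only the relative order of classes matters, and the largest class may be viewed as holes). Let $(\chi^1(x,t))$ and $(\chi^2(x,t))$, $x\in\mathbb{Z},t\in\mathbb{Z}_{\ge0}$, be independent families of i.i.d. Bernoulli$(b_1)$ and Bernoulli$(b_2)$ random variables, independent of the initial condition. At vertex $(x,t)$ with incoming classes $a$ from the bottom and $c$ from the left: if $a=c$, both outgoing edges have this class; if $a<c$, then $a$ exits through the top and $c$ through the right when $\chi^1(x,t)=1$, and $a$ exits through the right and $c$ through the top when $\chi^1(x,t)=0$; if $c<a$, then $c$ exits through the right and $a$ through the top when $\chi^2(x,t)=1$, and $c$ exits through the top and $a$ through the right when $\chi^2(x,t)=0$. Given the classes $\eta_0(x)$ of the edges entering $(x,0)$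 from below, there is almost surely a unique assignment of classes to all edges consistent with these rules (in each row there are almost surely vertices with $\chi^1=\chi^2=0$ arbitrarily far to the left, and there the bottom class always exits right and the left class always exits through the top). For $t\ge0$, $\eta_t(x)$ is the class of the edge entering $(x,t)$ from below; $(\eta_t)_{t\ge0}$ is a Markov process. A measure is stationary if, when $\eta_0$ is sampled from it, $\eta_t$ has the same law for all $t$. *)

theory Defs
  imports "HOL-Probability.Probability"
begin

definition config_space :: "nat \<Rightarrow> (int \<Rightarrow> nat) measure" where
  "config_space n = (\<Pi>\<^sub>M x\<in>UNIV. count_space {0..n})"

text \<open>
  In \<open>vertex_out \<chi>1 \<chi>2 a c\<close>, the class \<open>a\<close> enters from the bottom and \<open>c\<close> from the left;
  the result consists of the classes leaving through the top and through the right.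
  Smaller classes have priority.
\<close>
definition vertex_out :: "bool \<Rightarrow> bool \<Rightarrow> nat \<Rightarrow> nat \<Rightarrow> nat \<times> nat" where
  "vertex_out \<chi>1 \<chi>2 a c =
     (if a = c then (a, a)
      else if a < c then (if \<chi>1 then (a, c) else (c, a))
      else (if \<chi>2 then (a, c) else (c, a)))"

text \<open>
  \<open>v (x, t)\<close> is the class of the edge entering the vertex \<open>(x, t)\<close> from below and \<open>h (x, t)\<close>
  that of the edge entering it from the left. Every edge enters exactly one vertex, so
  \<open>v\<close> and \<open>h\<close> together describe all edges without redundancy.
\<close>
definition consistent ::
  "nat \<Rightarrow> (int \<times> nat \<Rightarrow> bool) \<Rightarrow> (int \<times> nat \<Rightarrow> bool) \<Rightarrow> (int \<Rightarrow> nat) \<Rightarrow>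
   (int \<times> nat \<Rightarrow> nat) \<times> (int \<times> nat \<Rightarrow> nat) \<Rightarrow> bool" where
  "consistent n \<chi>1 \<chi>2 \<eta>0 = (\<lambda>(v, h).
     (\<forall>x t. v (x, t) \<in> {0..n} \<and> h (x, t) \<in> {0..n}) \<and>
     (\<forall>x. v (x, 0) = \<eta>0 x) \<and>
     (\<forall>x t. (v (x, Suc t), h (x + 1, t)) =
        vertex_out (\<chi>1 (x, t)) (\<chi>2 (x, t)) (v (x, t)) (h (x, t))))"

text \<open>
  The configuration \<open>\<eta>\<^sub>t\<close>. There is almost surely exactly one consistent assignment; the value
  in the exceptional case is arbitrary.
\<close>
definition six_vertex ::
  "nat \<Rightarrow> (int \<Rightarrow> nat) \<times> (int \<times> nat \<Rightarrow> bool) \<times> (int \<times> nat \<Rightarrow> bool) \<Rightarrow> nat \<Rightarrow> int \<Rightarrow> nat" where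
  "six_vertex n = (\<lambda>(\<eta>0, \<chi>1, \<chi>2) t x.
     if \<exists>!e. consistent n \<chi>1 \<chi>2 \<eta>0 e
     then fst (THE e. consistent n \<chi>1 \<chi>2 \<eta>0 e) (x, t)
     else \<eta>0 x)"

definition bernoulli_family :: "real \<Rightarrow> (int \<times> nat \<Rightarrow> bool) measure" where
  "bernoulli_family b = (\<Pi>\<^sub>M z\<in>UNIV. measure_pmf (bernoulli_pmf b))"

definition six_vertex_space ::
  "real \<Rightarrow> real \<Rightarrow> (int \<Rightarrow> nat) measure \<Rightarrow>
   ((int \<Rightarrow> nat) \<times> (int \<times> nat \<Rightarrow> bool) \<times> (int \<times> nat \<Rightarrow> bool)) measure" where
  "six_vertex_space b1 b2 \<mu> = \<mu> \<Otimes>\<^sub>M (bernoulli_family b1 \<Otimes>\<^sub>M bernoulli_family b2)"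

text \<open>
  Passing to the completion does not change the probability of any event; it only makes
  the arbitrary values of \<open>six_vertex\<close> on the exceptional null set irrelevant for measurability.
\<close>
definition six_vertex_law ::
  "nat \<Rightarrow> real \<Rightarrow> real \<Rightarrow> (int \<Rightarrow> nat) measure \<Rightarrow> nat \<Rightarrow> (int \<Rightarrow> nat) measure" where
  "six_vertex_law n b1 b2 \<mu> t =
     distr (completion (six_vertex_space b1 b2 \<mu>)) (config_space n) (\<lambda>\<omega>. six_vertex n \<omega> t)"

definition six_vertex_stationary ::
  "nat \<Rightarrow> real \<Rightarrow> real \<Rightarrow> (int \<Rightarrow> nat) measure \<Rightarrow> bool" where
  "six_vertex_stationary n b1 b2 \<mu> \<longleftrightarrow> (\<forall>t. six_vertex_law n b1 b2 \<mu> t = \<mu>)"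

definition translate :: "int \<Rightarrow> (int \<Rightarrow> nat) \<Rightarrow> int \<Rightarrow> nat" where
  "translate y \<eta> = (\<lambda>x. \<eta> (x + y))"

definition translation_invariant :: "(int \<Rightarrow> nat) measure \<Rightarrow> bool" where
  "translation_invariant \<mu> \<longleftrightarrow> (\<forall>y. distr \<mu> \<mu> (translate y) = \<mu>)"

definition translation_ergodic :: "(int \<Rightarrow> nat) measure \<Rightarrow> bool" where
  "translation_ergodic \<mu> \<longleftrightarrow> translation_invariant \<mu> \<and>
     (\<forall>A\<in>sets \<mu>. (\<forall>y. translate y -` A \<inter> space \<mu> = A) \<longrightarrow>
        measure \<mu> A = 0 \<or> measure \<mu> A = 1)"

end

theory Submission
  imports Defs
begin

text \<open>
  Two copies of the process are driven by the same noise. For fixed \<open>k\<close> call the classes at most \<open>k\<close>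
  particles. A vertex conserves the signed number of discrepancies between the particle
  configurations and can only decrease their number, by annihilating a pair of opposite sign; so by
  translation invariance the density of discrepancies decreases in time by twice the annihilation
  probability. Any two opposite discrepancies in a window are annihilated in the next row with a
  probability bounded below, hence at some times windows contain opposite discrepancies only with
  small probability. Then all discrepancies in a window have the same sign and their number is the
  difference of the two particle counts, which is small by the ergodic theorem when the densities
  agree. So the density of discrepancies tends to \<open>0\<close>, which gives uniqueness.

  For existence, i.i.d. configurations are started at the times \<open>-s\<close>. The Bernoulli measures are
  stationary for the particles, so the particle counts are controlled uniformly in time and the
  discrepancy density of the processes started at \<open>-s\<close> and \<open>-s - r\<close> is at time \<open>0\<close> small
  uniformly in \<open>r\<close>. Along a subsequence the states at time \<open>0\<close> converge almost surely. The law of the limit is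
  stationary, and ergodic as a factor of an i.i.d. field.
\<close>

section \<open>The mean ergodic theorem for indicator functions\<close>

text \<open>A weak limit point of the laws of the process, or of their averages in time, need not be
  ergodic. For this reason the limit is taken almost surely, on one space that carries the noise of
  all past times, so that its law is a factor by construction. This in turn requires a decay of
  discrepancies that is uniform over the initial coupling: at time -s the two processes are already
  coupled in a way that depends on r. Accordingly the decay time is chosen from the tolerance, the
  noise parameters and a bound on the fluctuation of the particle counts. Of a coupling only
  translation invariance is asked; the product of two ergodic measures, from which uniqueness
  starts, may fail to be ergodic. Several classes reduce to particles and holes because the vertex
  rule commutes with monotone relabellings and because two different classes are separated by some
  threshold k < n. The law of the process at positive times is not explicit, but each of its
  thresholded images is Bernoulli.\<close>

definition visits :: "('a \<Rightarrow> 'a) \<Rightarrow> 'a set \<Rightarrow> nat \<Rightarrow> 'a \<Rightarrow> real" where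
  "visits T B n \<omega> = (\<Sum>i<n. indicator B ((T ^^ i) \<omega>))"

lemma visits_add: "visits T B (m + n) \<omega> = visits T B m \<omega> + visits T B n ((T ^^ m) \<omega>)"
proof (induction n)
  case (Suc n)
  have "(T ^^ (m + n)) \<omega> = (T ^^ n) ((T ^^ m) \<omega>)"
    by (metis add.commute comp_apply funpow_add)
  then show ?case using Suc by (simp add: visits_def)
qed (simp add: visits_def)

lemma visits_nonneg: "0 \<le> visits T B n \<omega>"
  by (simp add: visits_def sum_nonneg)

lemma visits_le: "visits T B n \<omega> \<le> n"
proof -
  have "visits T B n \<omega> \<le> (\<Sum>i<n. 1)"
    unfolding visits_def by (intro sum_mono) (simp add: indicator_def)
  then show ?thesis by simp
qed

lemma visits_mono: "B \<subseteq> C \<Longrightarrow> visits T B n \<omega> \<le> visits T C n \<omega>"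
  unfolding visits_def by (intro sum_mono) (auto simp: indicator_def)

lemma visits_Compl: "visits T (- B) n \<omega> = n - visits T B n \<omega>"
proof -
  have "visits T (- B) n \<omega> + visits T B n \<omega> = (\<Sum>i<n. 1)"
    unfolding visits_def sum.distrib[symmetric] by (intro sum.cong) (auto simp: indicator_def)
  then show ?thesis by simp
qed

text \<open>The two orbit segments differ only in their first and last points. After division by n
  the difference vanishes, which makes upper visit frequencies invariant under T.\<close>

lemma visits_shift_diff: "\<bar>visits T B n (T \<omega>) - visits T B n \<omega>\<bar> \<le> 1"
proof -
  have "visits T B n \<omega> + visits T B 1 ((T ^^ n) \<omega>) = visits T B 1 \<omega> + visits T B n (T \<omega>)"
    using visits_add[of T B n 1 \<omega>] visits_add[of T B 1 n \<omega>] by (simp add: add.commute)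
  moreover have "\<bar>visits T B 1 ((T ^^ n) \<omega>) - visits T B 1 \<omega>\<bar> \<le> 1"
    by (simp add: visits_def indicator_def)
  ultimately show ?thesis by linarith
qed

locale measure_preserving = prob_space M for M :: "'a measure" +
  fixes T :: "'a \<Rightarrow> 'a"
  assumes T_measurable [measurable]: "T \<in> M \<rightarrow>\<^sub>M M"
    and distr_T: "distr M M T = M"
begin

lemma funpow_measurable [measurable]: "(T ^^ i) \<in> M \<rightarrow>\<^sub>M M"
  by (rule measurable_compose_n) (rule T_measurable)

lemma distr_funpow: "distr M M (T ^^ i) = M"
proof (induction i)
  case (Suc i)
  have "distr M M (T ^^ Suc i) = distr (distr M M (T ^^ i)) M T"
    by (subst distr_distr) (auto simp: comp_def)
  then show ?case by (simp only: Suc distr_T)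
qed (simp add: distr_id2)

lemma measure_vimage_funpow: "A \<in> events \<Longrightarrow> prob ((T ^^ i) -` A \<inter> space M) = prob A"
  using measure_distr[of "T ^^ i" M M A] by (simp add: distr_funpow)

lemma visits_measurable [measurable]:
  assumes [measurable]: "B \<in> events" shows "visits T B n \<in> borel_measurable M"
  unfolding visits_def by measurable

lemma integrable_visits:
  assumes [measurable]: "B \<in> events" shows "integrable M (visits T B n)"
  by (rule integrable_const_bound[of _ "real n"])
     (auto simp: visits_le visits_nonneg)

lemma expectation_visits:
  assumes [measurable]: "B \<in> events"
  shows "expectation (visits T B n) = n * prob B"
proof -
  have "expectation (\<lambda>\<omega>. indicator B ((T ^^ i) \<omega>)) = prob B" for i
  proof -
    have "expectation (\<lambda>\<omega>. indicator B ((T ^^ i) \<omega>)) = integral\<^sup>L (distr M M (T ^^ i)) (indicator B :: _ \<Rightarrow> real)"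
      by (subst integral_distr) auto
    then show ?thesis by (simp add: distr_funpow)
  qed
  then show ?thesis
    unfolding visits_def
    by (subst Bochner_Integration.integral_sum)
       (auto intro!: integrable_const_bound[of _ 1])
qed

text \<open>
  The covering argument of Katznelson and Weiss: an orbit is cut greedily into blocks of length
  at most \<open>m\<close> with visit frequency at least \<open>d\<close>; the points from which no such block starts
  have small probability and are declared to be visits.
\<close>
lemma frequent_visits_imp_le_prob:
  assumes B [measurable]: "B \<in> events" and d: "0 \<le> d" "d \<le> 1"
    and freq: "AE \<omega> in M. \<exists>n\<ge>1. visits T B n \<omega> \<ge> n * d"
  shows "d \<le> prob B"
proof (rule field_le_epsilon)
  fix e :: real assume e: "e > 0"
  define Bad where "Bad m = {\<omega> \<in> space M. \<forall>n\<in>{1..m}. visits T B n \<omega> < n * d}" for m :: nat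
  have [measurable]: "Bad m \<in> events" for m unfolding Bad_def by measurable
  have "(\<lambda>m. prob (Bad m)) \<longlonglongrightarrow> prob (\<Inter>m. Bad m)"
    by (rule finite_Lim_measure_decseq) (auto simp: decseq_def Bad_def)
  moreover have "prob (\<Inter>m. Bad m) = 0"
  proof -
    have "AE \<omega> in M. \<omega> \<notin> (\<Inter>m. Bad m)"
      using freq
    proof eventually_elim
      case (elim \<omega>)
      then obtain n where "n \<ge> 1" "visits T B n \<omega> \<ge> n * d" by blast
      then have "\<omega> \<notin> Bad n" by (auto simp: Bad_def intro!: bexI[of _ n])
      then show ?case by blast
    qed
    then show ?thesis by (subst prob_eq_0) auto
  qed
  ultimately have "(\<lambda>m. prob (Bad m)) \<longlonglongrightarrow> 0" by simp
  then have "eventually (\<lambda>m. prob (Bad m) < e) sequentially"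
    using e by (rule order_tendstoD)
  then obtain m where m: "prob (Bad m) < e" by (auto simp: eventually_sequentially)
  define F where "F = B \<union> Bad m"
  have [measurable]: "F \<in> events" by (simp add: F_def)
  have cover: "visits T F L \<omega> \<ge> (real L - m) * d" if "\<omega> \<in> space M" for \<omega> L
    using that
  proof (induction L arbitrary: \<omega> rule: less_induct)
    case (less L)
    show ?case
    proof (cases "L \<le> m")
      case True
      \<comment> \<open>The rest of the orbit, once shorter than m, is given up; this happens once
        and costs at most m * d.\<close>
      then have "(real L - m) * d \<le> 0" using d by (simp add: mult_nonpos_nonneg)
      then show ?thesis using visits_nonneg[of T F L \<omega>] by linarith
    next
      case False
      obtain n where n: "n \<ge> 1" "n \<le> L" "visits T F n \<omega> \<ge> n * d"
      proof (cases "\<omega> \<in> Bad m")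
        case True
        \<comment> \<open>A bad point lies in F and forms a block of length 1 and frequency 1, which
          is at least d.\<close>
        then show ?thesis using that[of 1] False d by (simp add: visits_def F_def)
      next
        case False': False
        then obtain n where "n \<in> {1..m}" "visits T B n \<omega> \<ge> n * d"
          using less.prems by (auto simp: Bad_def not_less)
        moreover have "visits T B n \<omega> \<le> visits T F n \<omega>" by (rule visits_mono) (simp add: F_def)
        ultimately show ?thesis using that[of n] False by auto
      qed
      have "(T ^^ n) \<omega> \<in> space M" using measurable_space[OF funpow_measurable less.prems] .
      then have "visits T F (L - n) ((T ^^ n) \<omega>) \<ge> (real (L - n) - m) * d"
        using less.IH[of "L - n"] n by simp
      moreover have "visits T F L \<omega> = visits T F n \<omega> + visits T F (L - n) ((T ^^ n) \<omega>)"
        using visits_add[of T F n "L - n" \<omega>] n by simp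
      ultimately have "visits T F L \<omega> \<ge> n * d + (real (L - n) - m) * d" using n by linarith
      then show ?thesis using n by (simp add: of_nat_diff algebra_simps)
    qed
  qed
  have le: "(real L - m) * d \<le> L * (prob B + e)" for L
  proof -
    have "(real L - m) * d = expectation (\<lambda>_. (real L - m) * d)"
      by (simp add: prob_space)
    also have "\<dots> \<le> expectation (visits T F L)"
      using cover by (intro integral_mono_AE integrable_visits AE_I2) auto
    also have "\<dots> = L * prob F" by (simp add: expectation_visits)
    also have "prob F \<le> prob B + prob (Bad m)" unfolding F_def by (rule measure_Un_le) auto
    finally show ?thesis using m by (simp add: mult_left_mono order_trans)
  qed
  \<comment> \<open>Division by the orbit length L and L to infinity remove the loss m * d.\<close>
  have "(\<lambda>L. d - (real m * d) * inverse (real (Suc L))) \<longlonglongrightarrow> d - (real m * d) * 0"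
    by (intro tendsto_intros LIMSEQ_inverse_real_of_nat)
  then have "(\<lambda>L. d - (real m * d) * inverse (real (Suc L))) \<longlonglongrightarrow> d" by simp
  moreover have "d - (real m * d) * inverse (real (Suc L)) \<le> prob B + e" for L
    using le[of "Suc L"] by (simp add: field_simps del: of_nat_Suc)
  ultimately show "d \<le> prob B + e"
    by (intro LIMSEQ_le_const2[of _ d]) auto
qed

definition ergodic :: bool where
  "ergodic \<longleftrightarrow> (\<forall>A\<in>events. T -` A \<inter> space M = A \<longrightarrow> prob A = 0 \<or> prob A = 1)"

text \<open>The points with upper visit frequency at least d form an invariant set, null or full by
  ergodicity. If it were full, the covering argument would give B a probability strictly above its
  own.\<close>

lemma AE_eventually_visits_less:
  fixes d :: real
  assumes erg: ergodic and B [measurable]: "B \<in> events" and d: "prob B < d"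
  shows "AE \<omega> in M. eventually (\<lambda>n. visits T B n \<omega> \<le> n * d) sequentially"
proof (cases "d \<le> 1")
  case False
  have "visits T B n \<omega> \<le> n * d" for n \<omega>
    using visits_le[of T B n \<omega>] False mult_left_mono[of 1 d "real n"] by linarith
  then show ?thesis by auto
next
  case True
  \<comment> \<open>The limsup of the frequencies is at least d, written with countably many
    conditions to keep the set measurable.\<close>
  define H where "H = {\<omega> \<in> space M. \<forall>k::nat. \<forall>N. \<exists>n\<ge>N. visits T B n \<omega> / n > d - 1 / Suc k}"
  have [measurable]: "H \<in> events" unfolding H_def by measurable
  have step: "\<forall>k::nat. \<forall>N. \<exists>n\<ge>N. visits T B n \<omega>' / n > d - 1 / Suc k"
    if *: "\<forall>k::nat. \<forall>N. \<exists>n\<ge>N. visits T B n \<omega> / n > d - 1 / Suc k"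
      and close: "\<And>n. \<bar>visits T B n \<omega>' - visits T B n \<omega>\<bar> \<le> 1" for \<omega> \<omega>'
  proof (intro allI)
    fix k N :: nat
    \<comment> \<open>The tolerance 1 / (k + 1) is split in two halves 1 / (2k + 2): one for
      \<omega>, one for the error 1 / n of the change of starting point.\<close>
    obtain n where n: "n \<ge> max N (2 * Suc k)" "visits T B n \<omega> / n > d - 1 / Suc (2 * k + 1)"
      using *[rule_format, of "max N (2 * Suc k)" "2 * k + 1"] by blast
    define a where "a = 1 / real (Suc (2 * k + 1))"
    have "1 / real n \<le> a" using n(1) by (auto simp: field_simps a_def)
    moreover have "visits T B n \<omega>' / n \<ge> visits T B n \<omega> / n - 1 / n"
      using close[of n] by (simp add: diff_divide_distrib[symmetric] divide_right_mono)
    moreover have "1 / real (Suc k) = 2 * a" by (simp add: field_simps a_def)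
    moreover have "visits T B n \<omega> / n > d - a" using n(2) by (simp add: a_def)
    ultimately have "visits T B n \<omega>' / n > d - 1 / Suc k" by linarith
    then show "\<exists>n\<ge>N. visits T B n \<omega>' / n > d - 1 / Suc k" using n(1) by auto
  qed
  have inv: "T -` H \<inter> space M = H"
  proof -
    have "T \<omega> \<in> H \<longleftrightarrow> \<omega> \<in> H" if "\<omega> \<in> space M" for \<omega>
      using step[of \<omega> "T \<omega>"] step[of "T \<omega>" \<omega>] visits_shift_diff[of T B _ \<omega>] that
        measurable_space[OF T_measurable that]
      by (auto simp: H_def abs_minus_commute)
    moreover have "H \<subseteq> space M" by (auto simp: H_def)
    ultimately show ?thesis by blast
  qed
  have "prob H \<noteq> 1"
  proof
    assume "prob H = 1"
    then have AEH: "AE \<omega> in M. \<omega> \<in> H" by (subst (asm) prob_eq_1) auto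
    \<comment> \<open>The frequency d itself may only be approached, so the covering argument is
      used with a value strictly between the probability of B and d.\<close>
    define d' where "d' = (d + prob B) / 2"
    have d': "prob B < d'" "d' < d" using d by (auto simp: d'_def field_simps)
    obtain k where k: "1 / real (Suc k) < d - d'"
      using d' nat_approx_posE[of "d - d'"] by auto
    have "AE \<omega> in M. \<exists>n\<ge>1. visits T B n \<omega> \<ge> n * d'"
      using AEH
    proof eventually_elim
      case (elim \<omega>)
      then obtain n where n: "n \<ge> 1" "visits T B n \<omega> / n > d - 1 / Suc k"
        unfolding H_def by blast
      then have "visits T B n \<omega> / n > d'" using k by linarith
      then show ?case using n(1) by (intro exI[of _ n]) (simp add: field_simps)
    qed
    moreover have "0 \<le> d'" "d' \<le> 1" using d' True measure_nonneg[of M B] by linarith+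
    ultimately have "d' \<le> prob B" by (intro frequent_visits_imp_le_prob B)
    then show False using d' by simp
  qed
  moreover have "prob H = 0 \<or> prob H = 1"
    using erg inv \<open>H \<in> events\<close> unfolding ergodic_def by blast
  ultimately have "prob H = 0" by blast
  then have "AE \<omega> in M. \<omega> \<notin> H" by (subst (asm) prob_eq_0) auto
  moreover have "AE \<omega> in M. \<omega> \<in> space M" by simp
  ultimately show ?thesis
  proof eventually_elim
    case (elim \<omega>)
    then have "\<not> (\<forall>k::nat. \<forall>N. \<exists>n\<ge>N. visits T B n \<omega> / n > d - 1 / Suc k)"
      by (simp add: H_def)
    then obtain k :: nat and N where "\<not> (\<exists>n\<ge>N. visits T B n \<omega> / n > d - 1 / Suc k)"
      by blast
    then have le: "visits T B n \<omega> / n \<le> d - 1 / Suc k" if "n \<ge> N" for n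
      using that by (meson not_less)
    then have "visits T B n \<omega> \<le> n * d" if "n \<ge> max 1 N" for n
    proof -
      have "visits T B n \<omega> / n \<le> d - 1 / Suc k" using that by (intro le) simp
      then have "visits T B n \<omega> / n \<le> d" using zero_le_divide_1_iff[of "real (Suc k)"] by linarith
      then show ?thesis using that by (simp add: field_simps)
    qed
    then show ?case unfolding eventually_sequentially by blast
  qed
qed

text \<open>The upper bound for B together with the one for its complement gives almost sure
  convergence; frequencies are bounded by 1, so dominated convergence applies.\<close>

theorem mean_ergodic:
  assumes erg: ergodic and B [measurable]: "B \<in> events"
  shows "(\<lambda>n. expectation (\<lambda>\<omega>. \<bar>visits T B n \<omega> / n - prob B\<bar>)) \<longlonglongrightarrow> 0"
proof -
  have up: "AE \<omega> in M. \<forall>k. eventually (\<lambda>n. visits T C n \<omega> \<le> n * (prob C + 1 / Suc k)) sequentially"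
    if "C \<in> events" for C
    unfolding AE_all_countable using that by (intro allI AE_eventually_visits_less erg) (auto simp del: of_nat_Suc)
  define C where "C = space M - B"
  have [measurable]: "C \<in> events" by (simp add: C_def)
  have visC: "visits T C n \<omega> = n - visits T B n \<omega>" if "\<omega> \<in> space M" for n \<omega>
  proof -
    have "visits T C n \<omega> = visits T (- B) n \<omega>"
      unfolding visits_def
      using measurable_space[OF funpow_measurable that] by (intro sum.cong) (auto simp: C_def indicator_def)
    then show ?thesis by (simp add: visits_Compl)
  qed
  have pC: "prob C = 1 - prob B" by (simp add: C_def prob_compl)
  have "AE \<omega> in M. (\<lambda>n. \<bar>visits T B n \<omega> / n - prob B\<bar>) \<longlonglongrightarrow> 0"
    using up[OF B] up[OF \<open>C \<in> events\<close>] AE_space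
  proof eventually_elim
    case (elim \<omega>)
    show ?case
    proof (rule LIMSEQ_I)
      fix r :: real assume "r > 0"
      then obtain k where k: "1 / real (Suc k) < r" using nat_approx_posE by blast
      from elim(1)[rule_format, of k] elim(2)[rule_format, of k] eventually_gt_at_top[of "0::nat"]
      have "eventually (\<lambda>n. \<bar>visits T B n \<omega> / n - prob B\<bar> < r) sequentially"
      proof eventually_elim
        case (elim n)
        have "visits T B n \<omega> / n \<le> prob B + 1 / Suc k" using elim by (simp add: field_simps)
        moreover have "visits T B n \<omega> \<ge> n * (prob B - 1 / Suc k)"
          using elim(2) visC[OF \<open>\<omega> \<in> space M\<close>, of n] by (simp add: pC algebra_simps)
        then have "visits T B n \<omega> / n \<ge> prob B - 1 / Suc k"
          using elim(3) by (simp add: field_simps del: of_nat_Suc)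
        ultimately show ?case using k by linarith
      qed
      then show "\<exists>no. \<forall>n\<ge>no. norm (\<bar>visits T B n \<omega> / n - prob B\<bar> - 0) < r"
        by (auto simp: eventually_sequentially)
    qed
  qed
  moreover have "AE \<omega> in M. norm \<bar>visits T B n \<omega> / n - prob B\<bar> \<le> 1" for n
  proof (rule AE_I2)
    fix \<omega>
    have "visits T B n \<omega> / n \<le> 1" "0 \<le> visits T B n \<omega> / n"
      using visits_le[of T B n \<omega>] visits_nonneg[of T B n \<omega>] by (auto simp: divide_le_eq_1)
    then show "norm \<bar>visits T B n \<omega> / n - prob B\<bar> \<le> 1"
      using measure_nonneg[of M B] prob_le_1[of B] unfolding real_norm_def by linarith
  qed
  ultimately have "(\<lambda>n. expectation (\<lambda>\<omega>. \<bar>visits T B n \<omega> / n - prob B\<bar>)) \<longlonglongrightarrow> expectation (\<lambda>_. 0)"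
    by (intro integral_dominated_convergence[where w = "\<lambda>_. 1"]) auto
  then show ?thesis by simp
qed

end

section \<open>Mixing\<close>

context measure_preserving
begin

definition mixing :: bool where
  "mixing \<longleftrightarrow> (\<forall>A\<in>events. \<forall>B\<in>events.
     (\<lambda>m. prob (A \<inter> ((T ^^ m) -` B \<inter> space M))) \<longlonglongrightarrow> prob A * prob B)"

text \<open>An invariant set equals all its preimages, so mixing makes it independent of
  itself.\<close>

lemma mixing_imp_ergodic:
  assumes mixing shows ergodic
  unfolding ergodic_def
proof (intro ballI impI)
  fix A assume A: "A \<in> events" "T -` A \<inter> space M = A"
  have "(T ^^ m) -` A \<inter> space M = A" for m
  proof (induction m)
    case (Suc m)
    have "(T ^^ Suc m) -` A \<inter> space M = T -` ((T ^^ m) -` A \<inter> space M) \<inter> space M"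
      using measurable_space[OF T_measurable] by (auto simp: funpow_swap1)
    then show ?case using Suc A by (simp only:)
  qed (use sets.sets_into_space[OF A(1)] in auto)
  moreover have "(\<lambda>m. prob (A \<inter> ((T ^^ m) -` A \<inter> space M))) \<longlonglongrightarrow> prob A * prob A"
    using assms A(1) unfolding mixing_def by blast
  ultimately have "(\<lambda>_::nat. prob A) \<longlonglongrightarrow> prob A * prob A" by simp
  then have "prob A = prob A * prob A" by (simp add: LIMSEQ_const_iff)
  then show "prob A = 0 \<or> prob A = 1" by simp
qed

text \<open>
  Here \<open>\<nu> m\<close> is \<open>\<lambda>A. P (A \<inter> T\<^sup>-\<^sup>m B)\<close> or \<open>\<lambda>B. P (A \<inter> T\<^sup>-\<^sup>m B)\<close>.
\<close>
lemma tendsto_on_generator_imp_tendsto: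
  fixes \<nu> :: "nat \<Rightarrow> 'a set \<Rightarrow> real"
  assumes G: "Int_stable G" "G \<subseteq> Pow (space M)" "events = sigma_sets (space M) G"
    and lim: "\<And>A. A \<in> G \<Longrightarrow> (\<lambda>m. \<nu> m A) \<longlonglongrightarrow> c * prob A"
    and nonneg: "\<And>m A. A \<in> events \<Longrightarrow> 0 \<le> \<nu> m A"
    and le: "\<And>m A. A \<in> events \<Longrightarrow> \<nu> m A \<le> prob A"
    and space: "\<And>m. \<nu> m (space M) = c"
    and additive: "\<And>m A. range A \<subseteq> events \<Longrightarrow> disjoint_family A \<Longrightarrow> (\<lambda>i. \<nu> m (A i)) sums \<nu> m (\<Union>i::nat. A i)"
    and compl: "\<And>m A. A \<in> events \<Longrightarrow> \<nu> m (space M - A) = \<nu> m (space M) - \<nu> m A"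
    and A: "A \<in> events"
  shows "(\<lambda>m. \<nu> m A) \<longlonglongrightarrow> c * prob A"
proof -
  have "A \<in> sigma_sets (space M) G" using A G by simp
  from G(1,2) this show ?thesis
  proof (induction rule: sigma_sets_induct_disjoint)
    case (basic A) then show ?case by (rule lim)
  next
    case empty
    have "\<nu> m {} = 0" for m using nonneg[of "{}" m] le[of "{}" m] by simp
    then show ?case by simp
  next
    case (compl A)
    then have A: "A \<in> events" using G by simp
    have "(\<lambda>m. c - \<nu> m A) \<longlonglongrightarrow> c - c * prob A" by (intro tendsto_intros compl)
    then show ?case by (simp add: assms(9)[OF A] space prob_compl[OF A] algebra_simps)
  next
    case (union A)
    then have A: "A i \<in> events" for i using G by auto
    have P: "(\<lambda>i. prob (A i)) sums prob (\<Union>i. A i)"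
      using A union by (intro finite_measure_UNION) auto
    have eq: "(\<Sum>i. \<nu> m (A i)) = \<nu> m (\<Union>i. A i)" for m
      using additive[of A m] A union(1) by (auto simp: sums_iff)
    \<comment> \<open>The summands are dominated by the summable \<open>prob (A i)\<close> uniformly
      in m, so the limit may be exchanged with the sum.\<close>
    have "(\<lambda>m. \<Sum>i. \<nu> m (A i)) \<longlonglongrightarrow> (\<Sum>i. c * prob (A i))"
      using A nonneg le
      by (intro tannerys_theorem[where M = "\<lambda>i. prob (A i)", THEN conjunct2, THEN conjunct2])
        (use P union in \<open>auto simp: sums_iff intro!: always_eventually\<close>)
    moreover have "(\<Sum>i. c * prob (A i)) = c * prob (\<Union>i. A i)"
      using P by (auto simp: sums_iff suminf_mult)
    ultimately show ?case by (simp add: eq)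
  qed
qed

text \<open>The correlation is extended one argument at a time: \<open>first\<close> lets A range
  over all events with B in the generator, and then B is extended with A fixed.\<close>

lemma mixing_on_generator:
  assumes G: "Int_stable G" "G \<subseteq> Pow (space M)" "events = sigma_sets (space M) G"
    and lim: "\<And>A B. A \<in> G \<Longrightarrow> B \<in> G \<Longrightarrow>
       (\<lambda>m. prob (A \<inter> ((T ^^ m) -` B \<inter> space M))) \<longlonglongrightarrow> prob A * prob B"
  shows mixing
proof -
  have sets_T [measurable]: "(T ^^ m) -` B \<inter> space M \<in> events" if "B \<in> events" for B m
    using that by (rule measurable_sets[OF funpow_measurable])
  have first: "(\<lambda>m. prob (A \<inter> ((T ^^ m) -` B \<inter> space M))) \<longlonglongrightarrow> prob B * prob A"
    if A: "A \<in> events" and B: "B \<in> G" for A B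
  proof -
    have [measurable]: "B \<in> events" using B G by auto
    show ?thesis
    proof (rule tendsto_on_generator_imp_tendsto[OF G, where \<nu> = "\<lambda>m A. prob (A \<inter> ((T ^^ m) -` B \<inter> space M))"])
      fix m and A :: "nat \<Rightarrow> _" assume "range A \<subseteq> events" "disjoint_family A"
      then have "(\<lambda>i. prob (A i \<inter> ((T ^^ m) -` B \<inter> space M))) sums prob (\<Union>i. A i \<inter> ((T ^^ m) -` B \<inter> space M))"
        by (intro finite_measure_UNION) (auto simp: disjoint_family_on_def)
      then show "(\<lambda>i. prob (A i \<inter> ((T ^^ m) -` B \<inter> space M))) sums prob ((\<Union>i. A i) \<inter> ((T ^^ m) -` B \<inter> space M))"
        by simp
    next
      fix m A assume [measurable]: "A \<in> events"
      show "prob (A \<inter> ((T ^^ m) -` B \<inter> space M)) \<le> prob A"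
        by (rule finite_measure_mono) auto
      have "prob ((space M \<inter> ((T ^^ m) -` B \<inter> space M)) - (A \<inter> ((T ^^ m) -` B \<inter> space M))) =
        prob (space M \<inter> ((T ^^ m) -` B \<inter> space M)) - prob (A \<inter> ((T ^^ m) -` B \<inter> space M))"
        by (rule finite_measure_Diff) auto
      then show "prob ((space M - A) \<inter> ((T ^^ m) -` B \<inter> space M)) =
        prob (space M \<inter> ((T ^^ m) -` B \<inter> space M)) - prob (A \<inter> ((T ^^ m) -` B \<inter> space M))"
        by (simp add: Diff_Int_distrib2 set_diff_eq Int_def conj_ac cong: conj_cong)
    qed (use lim B A in \<open>auto simp: measure_vimage_funpow Int_absorb1 mult.commute[of "prob B"]\<close>)
  qed
  have "(\<lambda>m. prob (A \<inter> ((T ^^ m) -` B \<inter> space M))) \<longlonglongrightarrow> prob A * prob B"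
    if A: "A \<in> events" and B: "B \<in> events" for A B
  proof (rule tendsto_on_generator_imp_tendsto[OF G, where \<nu> = "\<lambda>m B. prob (A \<inter> ((T ^^ m) -` B \<inter> space M))"])
    note [measurable] = A
    fix m and B :: "nat \<Rightarrow> _" assume B: "range B \<subseteq> events" "disjoint_family B"
    then have "(\<lambda>i. prob (A \<inter> ((T ^^ m) -` B i \<inter> space M))) sums prob (\<Union>i. A \<inter> ((T ^^ m) -` B i \<inter> space M))"
      using A by (intro finite_measure_UNION) (auto simp: disjoint_family_on_def)
    moreover have "(\<Union>i. A \<inter> ((T ^^ m) -` B i \<inter> space M)) = A \<inter> ((T ^^ m) -` (\<Union>i. B i) \<inter> space M)"
      by auto
    ultimately show "(\<lambda>i. prob (A \<inter> ((T ^^ m) -` B i \<inter> space M))) sums prob (A \<inter> ((T ^^ m) -` (\<Union>i. B i) \<inter> space M))"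
      by simp
  next
    note [measurable] = A
    fix m B assume [measurable]: "B \<in> events"
    have "prob (A \<inter> ((T ^^ m) -` B \<inter> space M)) \<le> prob ((T ^^ m) -` B \<inter> space M)"
      by (rule finite_measure_mono) auto
    then show "prob (A \<inter> ((T ^^ m) -` B \<inter> space M)) \<le> prob B"
      by (simp add: measure_vimage_funpow)
    have "prob (A - (A \<inter> ((T ^^ m) -` B \<inter> space M))) = prob A - prob (A \<inter> ((T ^^ m) -` B \<inter> space M))"
      by (rule finite_measure_Diff) auto
    moreover have "(T ^^ m) -` space M \<inter> space M = space M"
      using measurable_space[OF funpow_measurable] by auto
    moreover have "A - (A \<inter> ((T ^^ m) -` B \<inter> space M)) = A \<inter> ((T ^^ m) -` (space M - B) \<inter> space M)"
      using sets.sets_into_space[OF A] measurable_space[OF funpow_measurable] by auto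
    ultimately show "prob (A \<inter> ((T ^^ m) -` (space M - B) \<inter> space M)) =
      prob (A \<inter> ((T ^^ m) -` space M \<inter> space M)) - prob (A \<inter> ((T ^^ m) -` B \<inter> space M))"
      using sets.sets_into_space[OF A] by (simp add: Int_absorb2)
  next
    fix m show "prob (A \<inter> ((T ^^ m) -` space M \<inter> space M)) = prob A"
    proof -
      have "(T ^^ m) -` space M \<inter> space M = space M"
        using measurable_space[OF funpow_measurable] by auto
      then show ?thesis using sets.sets_into_space[OF A] by (simp add: Int_absorb2)
    qed
  qed (use first[OF A] B in \<open>auto simp: mult.commute[of "prob A"]\<close>)
  then show ?thesis unfolding mixing_def by blast
qed

end

section \<open>Mixing of product systems\<close>

lemma measure_preserving_pair:
  assumes "measure_preserving M T" "measure_preserving N U"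
  shows "measure_preserving (M \<Otimes>\<^sub>M N) (\<lambda>(x, y). (T x, U y))"
proof -
  interpret M: measure_preserving M T by fact
  interpret N: measure_preserving N U by fact
  interpret P: pair_prob_space M N by unfold_locales
  have "distr M M T \<Otimes>\<^sub>M distr N N U = distr (M \<Otimes>\<^sub>M N) (M \<Otimes>\<^sub>M N) (\<lambda>(x, y). (T x, U y))"
    by (rule pair_measure_distr) (simp_all add: N.distr_T N.sigma_finite_measure_axioms)
  then show ?thesis
    by unfold_locales (simp_all add: M.distr_T N.distr_T)
qed

text \<open>On rectangles, an intersection-stable generator, the correlation of the product system
  is the product of the two correlations.\<close>

lemma mixing_pair:
  assumes M: "measure_preserving M T" "measure_preserving.mixing M T"
    and N: "measure_preserving N U" "measure_preserving.mixing N U"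
  shows "measure_preserving.mixing (M \<Otimes>\<^sub>M N) (\<lambda>(x, y). (T x, U y))"
proof -
  interpret M: measure_preserving M T by fact
  interpret N: measure_preserving N U by fact
  interpret P: measure_preserving "M \<Otimes>\<^sub>M N" "\<lambda>(x, y). (T x, U y)"
    using M(1) N(1) by (rule measure_preserving_pair)
  have pow: "((\<lambda>(x, y). (T x, U y)) ^^ m) = (\<lambda>(x, y). ((T ^^ m) x, (U ^^ m) y))" for m
    by (induction m) auto
  show ?thesis
  proof (rule P.mixing_on_generator)
    show "Int_stable {a \<times> b |a b. a \<in> sets M \<and> b \<in> sets N}" by (rule Int_stable_pair_measure_generator)
    show "{a \<times> b |a b. a \<in> sets M \<and> b \<in> sets N} \<subseteq> Pow (space (M \<Otimes>\<^sub>M N))"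
      using sets.sets_into_space[where M = M] sets.sets_into_space[where M = N]
      by (auto simp: space_pair_measure)
    show "sets (M \<Otimes>\<^sub>M N) = sigma_sets (space (M \<Otimes>\<^sub>M N)) {a \<times> b |a b. a \<in> sets M \<and> b \<in> sets N}"
      by (simp add: sets_pair_measure space_pair_measure)
    fix X Y assume "X \<in> {a \<times> b |a b. a \<in> sets M \<and> b \<in> sets N}" "Y \<in> {a \<times> b |a b. a \<in> sets M \<and> b \<in> sets N}"
    then obtain a b c d where [measurable]: "a \<in> sets M" "b \<in> sets N" "c \<in> sets M" "d \<in> sets N"
      and X: "X = a \<times> b" and Y: "Y = c \<times> d" by blast
    have times: "P.prob (A \<times> B) = M.prob A * N.prob B" if "A \<in> sets M" "B \<in> sets N" for A B
      using N.emeasure_pair_measure_Times[OF that] that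
      by (simp add: measure_def enn2real_mult)
    have "X \<inter> ((((\<lambda>(x, y). (T x, U y)) ^^ m) -` Y) \<inter> space (M \<Otimes>\<^sub>M N)) =
      (a \<inter> ((T ^^ m) -` c \<inter> space M)) \<times> (b \<inter> ((U ^^ m) -` d \<inter> space N))" for m
      by (auto simp: X Y pow space_pair_measure)
    then have "P.prob (X \<inter> ((((\<lambda>(x, y). (T x, U y)) ^^ m) -` Y) \<inter> space (M \<Otimes>\<^sub>M N))) =
      M.prob (a \<inter> ((T ^^ m) -` c \<inter> space M)) * N.prob (b \<inter> ((U ^^ m) -` d \<inter> space N))" for m
      by (simp add: times)
    moreover have "(\<lambda>m. M.prob (a \<inter> ((T ^^ m) -` c \<inter> space M)) * N.prob (b \<inter> ((U ^^ m) -` d \<inter> space N)))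
      \<longlonglongrightarrow> (M.prob a * M.prob c) * (N.prob b * N.prob d)"
      using M(2) N(2) unfolding M.mixing_def N.mixing_def by (intro tendsto_mult) auto
    ultimately show "(\<lambda>m. P.prob (X \<inter> ((((\<lambda>(x, y). (T x, U y)) ^^ m) -` Y) \<inter> space (M \<Otimes>\<^sub>M N))))
      \<longlonglongrightarrow> P.prob X * P.prob Y"
      by (simp add: X Y times mult_ac)
  qed
qed

lemma measure_preserving_PiM:
  fixes N :: "'i \<Rightarrow> 'b measure"
  assumes N: "\<And>i. prob_space (N i)" and \<tau>: "inj \<tau>" "\<And>i. N (\<tau> i) = N i"
  shows "measure_preserving (PiM UNIV N) (\<lambda>\<omega> i. \<omega> (\<tau> i))"
proof -
  interpret prob_space "PiM UNIV N" using N by (rule prob_space_PiM)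
  have "distr (PiM UNIV N) (\<Pi>\<^sub>M i\<in>UNIV. N (\<tau> i)) (\<lambda>\<omega>. \<lambda>i\<in>UNIV. \<omega> (\<tau> i)) = (\<Pi>\<^sub>M i\<in>UNIV. N (\<tau> i))"
    using N \<tau> by (intro distr_PiM_reindex) auto
  moreover have "(\<lambda>\<omega> i. \<omega> (\<tau> i)) \<in> PiM UNIV N \<rightarrow>\<^sub>M PiM UNIV N"
  proof (rule measurable_PiM_single')
    show "(\<lambda>\<omega>. \<omega> (\<tau> i)) \<in> PiM UNIV N \<rightarrow>\<^sub>M N i" for i
      using measurable_component_singleton[of "\<tau> i" UNIV N] \<tau>(2) by simp
    show "(\<lambda>\<omega> i. \<omega> (\<tau> i)) \<in> space (PiM UNIV N) \<rightarrow> (\<Pi>\<^sub>E i\<in>UNIV. space (N i))"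
      using \<tau>(2) by (auto simp: space_PiM PiE_iff) metis
  qed
  ultimately show ?thesis by unfold_locales (simp_all add: \<tau>(2) restrict_def)
qed

text \<open>For cylinder events the correlations are eventually equal to their limit: once the
  translated index set has left the other one, the events depend on disjoint sets of
  coordinates.\<close>

lemma mixing_PiM:
  fixes N :: "'i \<Rightarrow> 'b measure"
  assumes N: "\<And>i. prob_space (N i)" and \<tau>: "inj \<tau>" "\<And>i. N (\<tau> i) = N i"
    and esc: "\<And>J K. finite J \<Longrightarrow> finite K \<Longrightarrow> eventually (\<lambda>m. J \<inter> (\<tau> ^^ m) ` K = {}) sequentially"
  shows "measure_preserving.mixing (PiM UNIV N) (\<lambda>\<omega> i. \<omega> (\<tau> i))"
proof -
  interpret measure_preserving "PiM UNIV N" "\<lambda>\<omega> i. \<omega> (\<tau> i)"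
    using N \<tau> by (rule measure_preserving_PiM)
  have Npow: "N ((\<tau> ^^ m) i) = N i" for m i by (induction m) (auto simp: \<tau>(2))
  have pow: "((\<lambda>\<omega> i. \<omega> (\<tau> i)) ^^ m) = (\<lambda>\<omega> i. \<omega> ((\<tau> ^^ m) i))" for m
    by (induction m) (auto simp: funpow_swap1)
  have injpow: "inj (\<tau> ^^ m)" for m using \<tau>(1) by (rule inj_fn)
  interpret PP: product_prob_space N UNIV using N
    by (simp add: product_prob_space_def product_prob_space_axioms_def product_sigma_finite_def prob_space_imp_sigma_finite)
  have emb: "\<omega> \<in> prod_emb UNIV N J (Pi\<^sub>E J E) \<longleftrightarrow> \<omega> \<in> space (PiM UNIV N) \<and> (\<forall>i\<in>J. \<omega> i \<in> E i)"
    for J E \<omega>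
    unfolding prod_emb_def by (auto simp: space_PiM)
  show ?thesis
  proof (rule mixing_on_generator[OF Int_stable_prod_algebra])
    show "prod_algebra UNIV N \<subseteq> Pow (space (PiM UNIV N))"
      using prod_algebra_sets_into_space[of UNIV N] by (simp add: space_PiM)
    show "events = sigma_sets (space (PiM UNIV N)) (prod_algebra UNIV N)"
      by (simp add: sets_PiM space_PiM)
    fix A B assume "A \<in> prod_algebra UNIV N" "B \<in> prod_algebra UNIV N"
    then obtain J E K F where J: "finite J" "\<And>i. i \<in> J \<Longrightarrow> E i \<in> sets (N i)" "A = prod_emb UNIV N J (Pi\<^sub>E J E)"
      and K: "finite K" "\<And>i. i \<in> K \<Longrightarrow> F i \<in> sets (N i)" "B = prod_emb UNIV N K (Pi\<^sub>E K F)"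
      by (auto elim!: prod_algebraE)
    have "eventually (\<lambda>m. prob (A \<inter> (((\<lambda>\<omega> i. \<omega> (\<tau> i)) ^^ m) -` B \<inter> space (PiM UNIV N))) = prob A * prob B) sequentially"
      using esc[OF J(1) K(1)]
    proof eventually_elim
      case (elim m)
      \<comment> \<open>One family of sides for both cylinders: E on J and the transported F
        elsewhere; there is no conflict because J and the image of K are disjoint.\<close>
      define H where "H i = (if i \<in> J then E i else F (inv (\<tau> ^^ m) i))" for i
      have inv: "inv (\<tau> ^^ m) ((\<tau> ^^ m) i) = i" for i using injpow by simp
      have H: "H i = E i" if "i \<in> J" for i using that by (simp add: H_def)
      have H': "H ((\<tau> ^^ m) i) = F i" if "i \<in> K" for i using that elim by (auto simp: H_def inv)
      have Hs: "H i \<in> sets (N i)" if "i \<in> J \<union> (\<tau> ^^ m) ` K" for i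
        using that J(2) K(2) H H' by (auto simp: Npow)
      have fin: "finite (J \<union> (\<tau> ^^ m) ` K)" using J(1) K(1) by simp
      have "A \<inter> (((\<lambda>\<omega> i. \<omega> (\<tau> i)) ^^ m) -` B \<inter> space (PiM UNIV N)) =
        prod_emb UNIV N (J \<union> (\<tau> ^^ m) ` K) (Pi\<^sub>E (J \<union> (\<tau> ^^ m) ` K) H)"
        unfolding J(3) K(3) set_eq_iff Int_iff vimage_eq emb
        using measurable_space[OF funpow_measurable, of _ m] H H' by (auto simp: pow ball_Un)
      then have "prob (A \<inter> (((\<lambda>\<omega> i. \<omega> (\<tau> i)) ^^ m) -` B \<inter> space (PiM UNIV N))) =
        (\<Prod>i\<in>J \<union> (\<tau> ^^ m) ` K. measure (N i) (H i))"
        using fin Hs by (simp add: PP.measure_PiM_emb del: Un_iff)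
      also have "\<dots> = (\<Prod>i\<in>J. measure (N i) (H i)) * (\<Prod>i\<in>(\<tau> ^^ m) ` K. measure (N i) (H i))"
        using J(1) K(1) elim by (intro prod.union_disjoint) auto
      also have "(\<Prod>i\<in>(\<tau> ^^ m) ` K. measure (N i) (H i)) = (\<Prod>i\<in>K. measure (N i) (F i))"
        using injpow by (subst prod.reindex) (auto simp: H' Npow intro: inj_on_subset)
      also have "(\<Prod>i\<in>J. measure (N i) (H i)) = (\<Prod>i\<in>J. measure (N i) (E i))"
        by (intro prod.cong) (auto simp: H)
      finally show ?case using J K by (simp add: PP.measure_PiM_emb)
    qed
    then show "(\<lambda>m. prob (A \<inter> (((\<lambda>\<omega> i. \<omega> (\<tau> i)) ^^ m) -` B \<inter> space (PiM UNIV N)))) \<longlonglongrightarrow> prob A * prob B"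
      by (rule tendsto_eventually)
  qed
qed

section \<open>One row of the six-vertex process\<close>

text \<open>A coordinate is independent of every event that ignores it. Stability of the event under
  \<open>fun_upd\<close> expresses this without a sub-\<sigma>-algebra, and is easy to check for
  events given by formulas.\<close>

lemma PiM_measure_Int_component:
  fixes N :: "'i \<Rightarrow> 'b measure"
  assumes N: "\<And>i. prob_space (N i)" and A [measurable]: "A \<in> sets (PiM UNIV N)"
    and B [measurable]: "B \<in> sets (N k)"
    and upd: "\<And>\<omega> v. \<omega> \<in> space (PiM UNIV N) \<Longrightarrow> v \<in> space (N k) \<Longrightarrow> (fun_upd \<omega> k v \<in> A) = (\<omega> \<in> A)"
  shows "measure (PiM UNIV N) (A \<inter> {\<omega> \<in> space (PiM UNIV N). \<omega> k \<in> B}) =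
    measure (PiM UNIV N) A * measure (N k) B"
proof -
  define P where "P = PiM (UNIV - {k}) N"
  define f where "f = (\<lambda>(x, X :: 'i \<Rightarrow> 'b). fun_upd X k x)"
  interpret P: prob_space P unfolding P_def using N by (rule prob_space_PiM)
  interpret Nk: prob_space "N k" by (rule N)
  \<comment> \<open>An arbitrary value for the coordinate k, used to describe the section of A in
    the remaining coordinates.\<close>
  obtain v where v: "v \<in> space (N k)" using Nk.not_empty by blast
  have "distr (N k \<Otimes>\<^sub>M P) (PiM (insert k (UNIV - {k})) N) f = PiM (insert k (UNIV - {k})) N"
    unfolding P_def f_def using N by (intro distr_pair_PiM_eq_PiM)
  then have D: "distr (N k \<Otimes>\<^sub>M P) (PiM UNIV N) f = PiM UNIV N" by (simp add: insert_absorb)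
  have f [measurable]: "f \<in> N k \<Otimes>\<^sub>M P \<rightarrow>\<^sub>M PiM UNIV N"
    using measurable_fun_upd[where J="UNIV - {k}" and I=UNIV and i=k and M=N and N="N k \<Otimes>\<^sub>M P" and f=snd and h=fst]
    unfolding f_def P_def by (simp add: case_prod_beta' insert_absorb)
  have [measurable]: "(\<lambda>X. fun_upd X k v) \<in> P \<rightarrow>\<^sub>M PiM UNIV N"
    unfolding P_def using v
    by (intro measurable_fun_upd[where J="UNIV - {k}"]) auto
  define A' where "A' = (\<lambda>X. fun_upd X k v) -` A \<inter> space P"
  have [measurable]: "A' \<in> sets P" unfolding A'_def by measurable
  have key: "measure (PiM UNIV N) (A \<inter> {\<omega> \<in> space (PiM UNIV N). \<omega> k \<in> C}) = measure (N k) C * measure P A'"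
    if [measurable]: "C \<in> sets (N k)" for C
  proof -
    have "f -` (A \<inter> {\<omega> \<in> space (PiM UNIV N). \<omega> k \<in> C}) \<inter> space (N k \<Otimes>\<^sub>M P) = C \<times> A'"
    proof -
      have "fun_upd X k x \<in> A \<longleftrightarrow> fun_upd X k v \<in> A" "fun_upd X k x \<in> space (PiM UNIV N)"
        if "x \<in> space (N k)" "X \<in> space P" for x X
      proof -
        show *: "fun_upd X k x \<in> space (PiM UNIV N)"
          using measurable_space[OF f, of "(x, X)"] that by (simp add: f_def space_pair_measure)
        show "fun_upd X k x \<in> A \<longleftrightarrow> fun_upd X k v \<in> A" using upd[OF * v] by simp
      qed
      then show ?thesis
        using sets.sets_into_space[OF that]
        by (auto simp: f_def A'_def space_pair_measure)
    qed
    then have "measure (distr (N k \<Otimes>\<^sub>M P) (PiM UNIV N) f) (A \<inter> {\<omega> \<in> space (PiM UNIV N). \<omega> k \<in> C})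
      = measure (N k \<Otimes>\<^sub>M P) (C \<times> A')"
      by (subst measure_distr) auto
    also have "\<dots> = measure (N k) C * measure P A'"
      by (simp add: measure_def P.emeasure_pair_measure_Times enn2real_mult)
    finally show ?thesis by (simp add: D)
  qed
  have "A \<inter> {\<omega> \<in> space (PiM UNIV N). \<omega> k \<in> space (N k)} = A"
    using sets.sets_into_space[OF A] by (auto simp: space_PiM)
  then have "measure (PiM UNIV N) A = measure P A'"
    using key[of "space (N k)"] by (simp add: Nk.prob_space)
  then show ?thesis using key[OF B] by simp
qed

text \<open>
  The noise of a row is indexed by \<open>int \<times> bool\<close>: the index \<open>(x, True)\<close> stands for \<open>\<chi>\<^sup>1\<close> and
  \<open>(x, False)\<close> for \<open>\<chi>\<^sup>2\<close> at the vertex \<open>x\<close>.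
\<close>
definition reset :: "(int \<times> bool \<Rightarrow> bool) \<Rightarrow> int \<Rightarrow> bool" where
  "reset w x \<longleftrightarrow> \<not> w (x, True) \<and> \<not> w (x, False)"

definition vertex :: "(int \<times> bool \<Rightarrow> bool) \<Rightarrow> int \<Rightarrow> nat \<Rightarrow> nat \<Rightarrow> nat \<times> nat" where
  "vertex w x = vertex_out (w (x, True)) (w (x, False))"

text \<open>The class on the edge leaving \<open>y + m\<close> to the right, provided that the
  vertex y is a reset.\<close>

primrec run_from :: "(int \<times> bool \<Rightarrow> bool) \<Rightarrow> (int \<Rightarrow> nat) \<Rightarrow> int \<Rightarrow> nat \<Rightarrow> nat" where
  "run_from w \<eta> y 0 = \<eta> y"
| "run_from w \<eta> y (Suc m) = snd (vertex w (y + 1 + int m) (\<eta> (y + 1 + int m)) (run_from w \<eta> y m))"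

text \<open>
  The class entering \<open>x\<close> from the left. At a reset the bottom class exits to the right whatever
  comes from the left, so the row can be computed from the last reset before \<open>x\<close>; the value \<open>0\<close>
  is used when there is none.
\<close>
definition horiz :: "(int \<times> bool \<Rightarrow> bool) \<Rightarrow> (int \<Rightarrow> nat) \<Rightarrow> int \<Rightarrow> nat" where
  "horiz w \<eta> x = (if \<exists>m. reset w (x - 1 - int m)
     then run_from w \<eta> (x - 1 - int (LEAST m. reset w (x - 1 - int m))) (LEAST m. reset w (x - 1 - int m))
     else 0)"

definition row :: "(int \<times> bool \<Rightarrow> bool) \<Rightarrow> (int \<Rightarrow> nat) \<Rightarrow> int \<Rightarrow> nat" where
  "row w \<eta> x = fst (vertex w x (\<eta> x) (horiz w \<eta> x))"

definition good_row :: "(int \<times> bool \<Rightarrow> bool) \<Rightarrow> bool" where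
  "good_row w \<longleftrightarrow> (\<forall>x. \<exists>m. reset w (x - 1 - int m))"

lemma snd_vertex_reset: "reset w x \<Longrightarrow> snd (vertex w x a c) = a"
  by (simp add: reset_def vertex_def vertex_out_def)

text \<open>Either x is itself a reset, and the run starts there, or the last reset before
  \<open>x + 1\<close> is the last one before x and its distance grows by one.\<close>

lemma horiz_step:
  assumes "good_row w"
  shows "horiz w \<eta> (x + 1) = snd (vertex w x (\<eta> x) (horiz w \<eta> x))"
proof -
  obtain m where m: "reset w (x - 1 - int m)" using assms by (auto simp: good_row_def)
  show ?thesis
  proof (cases "reset w x")
    case True
    then have "(LEAST m. reset w (x + 1 - 1 - int m)) = 0" by (intro Least_eq_0) simp
    moreover have "\<exists>m. reset w (x + 1 - 1 - int m)" using True by (intro exI[of _ 0]) simp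
    ultimately have "horiz w \<eta> (x + 1) = \<eta> x" by (simp add: horiz_def)
    then show ?thesis using True by (simp add: snd_vertex_reset)
  next
    case False
    define k where "k = (LEAST m. reset w (x - 1 - int m))"
    have "(LEAST m. reset w (x + 1 - 1 - int m)) = Suc (LEAST m. reset w (x + 1 - 1 - int (Suc m)))"
      using False m by (intro Least_Suc[where n = "Suc m"]) (auto simp: algebra_simps)
    also have "\<dots> = Suc k" by (simp add: k_def algebra_simps)
    finally have L: "(LEAST m. reset w (x + 1 - 1 - int m)) = Suc k" .
    have "\<exists>m. reset w (x + 1 - 1 - int m)" using m by (intro exI[of _ "Suc m"]) (simp add: algebra_simps)
    then have "horiz w \<eta> (x + 1) = run_from w \<eta> (x - 1 - int k) (Suc k)"
      unfolding horiz_def L by (simp add: algebra_simps del: run_from.simps)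
    also have "\<dots> = snd (vertex w x (\<eta> x) (run_from w \<eta> (x - 1 - int k) k))" by simp
    also have "run_from w \<eta> (x - 1 - int k) k = horiz w \<eta> x"
      using m unfolding horiz_def k_def by auto
    finally show ?thesis .
  qed
qed

lemma vertex_row_horiz:
  "good_row w \<Longrightarrow> vertex w x (\<eta> x) (horiz w \<eta> x) = (row w \<eta> x, horiz w \<eta> (x + 1))"
  by (simp add: horiz_step row_def)

text \<open>A reset erases what comes from the left. Any two solutions therefore agree immediately
  to its right, and from there on by the recursion; every x has a reset to its left.\<close>

lemma horiz_unique:
  assumes good: "good_row w" and h: "\<And>x. h (x + 1) = snd (vertex w x (\<eta> x) (h x))"
  shows "h x = horiz w \<eta> x"
proof -
  obtain m where m: "reset w (x - 1 - int m)" using good by (auto simp: good_row_def)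
  define y where "y = x - 1 - int m"
  have "h (y + 1 + int j) = horiz w \<eta> (y + 1 + int j)" for j
  proof (induction j)
    case 0 then show ?case
      using h[of y] horiz_step[OF good, of \<eta> y] m by (simp add: snd_vertex_reset y_def)
  next
    case (Suc j)
    then show ?case
      using h[of "y + 1 + int j"] horiz_step[OF good, of \<eta> "y + 1 + int j"] by (simp add: ac_simps)
  qed
  from this[of m] show ?thesis by (simp add: y_def)
qed

section \<open>Translation, relabelling and locality of a row\<close>

definition shift_row :: "(int \<times> bool \<Rightarrow> bool) \<Rightarrow> int \<times> bool \<Rightarrow> bool" where
  "shift_row w z = w (fst z + 1, snd z)"

lemma horiz_shift: "horiz (shift_row w) (translate 1 \<eta>) x = horiz w \<eta> (x + 1)"
proof -
  have r: "reset (shift_row w) y = reset w (y + 1)" for y by (simp add: reset_def shift_row_def)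
  have "run_from (shift_row w) (translate 1 \<eta>) y m = run_from w \<eta> (y + 1) m" for y m
    by (induction m) (auto simp: translate_def vertex_def shift_row_def ac_simps)
  then show ?thesis by (simp add: horiz_def r algebra_simps)
qed

lemma row_shift: "row (shift_row w) (translate 1 \<eta>) = translate 1 (row w \<eta>)"
  by (rule ext) (simp add: row_def horiz_shift, simp add: row_def translate_def vertex_def shift_row_def)

text \<open>The rule only compares classes. If f identifies the two incoming classes, both outgoing
  edges carry their common image whichever way they leave, so f may be constant on blocks. This is
  what allows classes to be merged.\<close>

lemma vertex_map:
  assumes "mono f"
  shows "vertex w x (f a) (f c) = map_prod f f (vertex w x a c)"
  using monoD[OF assms, of a c] monoD[OF assms, of c a]
  by (auto simp: vertex_def vertex_out_def)

text \<open>The condition \<open>f 0 = 0\<close> takes care of the default value 0 of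
  \<open>horiz\<close> in rows without a reset to the left.\<close>

lemma horiz_map:
  assumes "mono f" "f 0 = 0"
  shows "horiz w (\<lambda>x. f (\<eta> x)) x = f (horiz w \<eta> x)"
proof -
  have "run_from w (\<lambda>x. f (\<eta> x)) y m = f (run_from w \<eta> y m)" for y m
    by (induction m) (auto simp: vertex_map[OF assms(1)])
  then show ?thesis by (simp add: horiz_def assms(2))
qed

lemma row_map:
  assumes "mono f" "f 0 = 0"
  shows "row w (\<lambda>x. f (\<eta> x)) = (\<lambda>x. f (row w \<eta> x))"
  by (rule ext) (simp add: row_def horiz_map[OF assms] vertex_map[OF assms(1)])

lemma vertex_le: "a \<le> n \<Longrightarrow> c \<le> n \<Longrightarrow> fst (vertex w x a c) \<le> n \<and> snd (vertex w x a c) \<le> n"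
  by (auto simp: vertex_def vertex_out_def)

lemma horiz_le:
  assumes "\<And>x. \<eta> x \<le> n" shows "horiz w \<eta> x \<le> n"
proof -
  have "run_from w \<eta> y m \<le> n" for y m
    by (induction m) (auto simp: assms vertex_le)
  then show ?thesis by (simp add: horiz_def)
qed

lemma row_le: "(\<And>x. \<eta> x \<le> n) \<Longrightarrow> row w \<eta> x \<le> n"
  by (simp add: row_def vertex_le horiz_le)

lemma run_from_cong:
  "(\<And>y. y < z + int m + 1 \<Longrightarrow> \<eta> y = \<eta>' y) \<Longrightarrow> (\<And>y i. y < z + int m + 1 \<Longrightarrow> w (y, i) = w' (y, i)) \<Longrightarrow>
    run_from w \<eta> z m = run_from w' \<eta>' z m"
  by (induction m) (simp_all add: vertex_def)

text \<open>The inequalities are strict: the left edge of x ignores the bottom class and the noise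
  at x. The independence in the stationarity proof for Bernoulli measures rests on this.\<close>

lemma horiz_cong:
  assumes "\<And>y. y < x \<Longrightarrow> \<eta> y = \<eta>' y" "\<And>y i. y < x \<Longrightarrow> w (y, i) = w' (y, i)"
  shows "horiz w \<eta> x = horiz w' \<eta>' x"
proof -
  have "reset w (x - 1 - int m) = reset w' (x - 1 - int m)" for m
    using assms(2) by (simp add: reset_def)
  moreover have "run_from w \<eta> (x - 1 - int m) m = run_from w' \<eta>' (x - 1 - int m) m" for m
    using assms by (intro run_from_cong) auto
  ultimately show ?thesis by (simp add: horiz_def)
qed

lemma row_cong:
  assumes "\<And>y. y \<le> x \<Longrightarrow> \<eta> y = \<eta>' y" "\<And>y i. y \<le> x \<Longrightarrow> w (y, i) = w' (y, i)"
  shows "row w \<eta> x = row w' \<eta>' x"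
  using assms horiz_cong[of x \<eta> \<eta>' w w'] by (simp add: row_def vertex_def)

subsection \<open>Measurability\<close>

lemma measurable_config_component:
  assumes "f \<in> M \<rightarrow>\<^sub>M config_space n" shows "(\<lambda>\<omega>. f \<omega> x) \<in> M \<rightarrow>\<^sub>M count_space UNIV"
proof -
  have "(\<lambda>\<omega>. f \<omega> x) \<in> M \<rightarrow>\<^sub>M count_space {0..n}"
    using assms unfolding config_space_def by (rule measurable_compose) (simp add: measurable_component_singleton)
  then show ?thesis by (rule measurable_compose) simp
qed

lemma measurable_config_spaceI:
  assumes "\<And>x. (\<lambda>\<omega>. f \<omega> x) \<in> M \<rightarrow>\<^sub>M count_space UNIV" "\<And>\<omega> x. \<omega> \<in> space M \<Longrightarrow> f \<omega> x \<le> n"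
  shows "f \<in> M \<rightarrow>\<^sub>M config_space n"
  unfolding config_space_def
proof (rule measurable_PiM_single')
  fix x
  show "(\<lambda>\<omega>. f \<omega> x) \<in> M \<rightarrow>\<^sub>M count_space {0..n}"
  proof (rule measurableI)
    fix A assume "A \<in> sets (count_space {0..n})"
    show "(\<lambda>\<omega>. f \<omega> x) -` A \<inter> space M \<in> sets M" using assms(1)[of x] by (rule measurable_sets) simp
  qed (use assms(2) in auto)
qed (use assms(2) in \<open>auto simp: PiE_iff\<close>)

lemma space_config_space: "space (config_space n) = {\<eta>. \<forall>x. \<eta> x \<le> n}"
  by (auto simp: config_space_def space_PiM PiE_iff)

definition bern :: "real \<Rightarrow> real \<Rightarrow> bool \<Rightarrow> bool measure" where
  "bern b1 b2 i = measure_pmf (bernoulli_pmf (if i then b1 else b2))"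

definition row_noise :: "real \<Rightarrow> real \<Rightarrow> (int \<times> bool \<Rightarrow> bool) measure" where
  "row_noise b1 b2 = PiM UNIV (\<lambda>z. bern b1 b2 (snd z))"

lemma prob_space_bern: "prob_space (bern b1 b2 i)"
  by (simp add: bern_def prob_space_measure_pmf)

lemma sets_bern [measurable_cong, simp]: "sets (bern b1 b2 i) = sets (count_space UNIV)"
  by (simp add: bern_def)

lemma space_bern [simp]: "space (bern b1 b2 i) = UNIV"
  by (simp add: bern_def)

lemma space_row_noise [simp]: "space (row_noise b1 b2) = UNIV"
  by (auto simp: row_noise_def space_PiM)

lemma prob_space_row_noise: "prob_space (row_noise b1 b2)"
  unfolding row_noise_def by (rule prob_space_PiM) (rule prob_space_bern)

lemma measurable_row_noise_component:
  assumes "g \<in> M \<rightarrow>\<^sub>M row_noise b1 b2" shows "(\<lambda>\<omega>. g \<omega> z) \<in> M \<rightarrow>\<^sub>M count_space UNIV"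
proof -
  have "(\<lambda>w. w z) \<in> row_noise b1 b2 \<rightarrow>\<^sub>M bern b1 b2 (snd z)"
    unfolding row_noise_def by (rule measurable_component_singleton) simp
  then have "(\<lambda>w. w z) \<in> row_noise b1 b2 \<rightarrow>\<^sub>M count_space UNIV"
    using measurable_cong_sets[OF refl sets_bern] by blast
  with assms show ?thesis by (rule measurable_compose)
qed

lemma measurable_vertex:
  assumes [measurable]: "p \<in> M \<rightarrow>\<^sub>M count_space UNIV" "q \<in> M \<rightarrow>\<^sub>M count_space UNIV"
    "a \<in> M \<rightarrow>\<^sub>M count_space UNIV" "c \<in> M \<rightarrow>\<^sub>M count_space UNIV"
  shows "(\<lambda>\<omega>. vertex_out (p \<omega>) (q \<omega>) (a \<omega>) (c \<omega>)) \<in> M \<rightarrow>\<^sub>M count_space UNIV"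
proof -
  have "(\<lambda>\<omega>. (p \<omega>, q \<omega>, a \<omega>, c \<omega>)) \<in> M \<rightarrow>\<^sub>M count_space UNIV"
    by measurable
  then show ?thesis
    using measurable_compose[of _ M "count_space UNIV" "\<lambda>(p, q, a, c). vertex_out p q a c"] by simp
qed

lemma measurable_reset [measurable (raw)]:
  assumes [measurable]: "g \<in> M \<rightarrow>\<^sub>M row_noise b1 b2"
  shows "Measurable.pred M (\<lambda>\<omega>. reset (g \<omega>) x)"
proof -
  note [measurable] = measurable_row_noise_component[OF assms]
  show ?thesis unfolding reset_def by measurable
qed

lemma measurable_good_row [measurable (raw)]:
  "g \<in> M \<rightarrow>\<^sub>M row_noise b1 b2 \<Longrightarrow> Measurable.pred M (\<lambda>\<omega>. good_row (g \<omega>))"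
  using measurable_reset unfolding good_row_def by measurable

context
  fixes f g M n b1 b2
  assumes f: "f \<in> M \<rightarrow>\<^sub>M config_space n" and g: "g \<in> M \<rightarrow>\<^sub>M row_noise b1 b2"
begin

lemma measurable_run_from [measurable]: "(\<lambda>\<omega>. run_from (g \<omega>) (f \<omega>) y m) \<in> M \<rightarrow>\<^sub>M count_space UNIV"
proof (induction m)
  case 0 then show ?case using measurable_config_component[OF f] by simp
next
  case (Suc m)
  note [measurable] = measurable_row_noise_component[OF g] measurable_config_component[OF f] Suc
  show ?case unfolding run_from.simps vertex_def
    by (rule measurable_compose[OF measurable_vertex]) measurable
qed

text \<open>The distance to the last reset takes countably many values, and for each of them the run
  is measurable.\<close>

lemma measurable_horiz [measurable]: "(\<lambda>\<omega>. horiz (g \<omega>) (f \<omega>) x) \<in> M \<rightarrow>\<^sub>M count_space UNIV"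
proof -
  note [measurable] = measurable_reset[OF g]
  have [measurable]: "(\<lambda>\<omega>. LEAST m. reset (g \<omega>) (x - 1 - int m)) \<in> M \<rightarrow>\<^sub>M count_space UNIV"
    by measurable
  have [measurable]: "(\<lambda>\<omega>. run_from (g \<omega>) (f \<omega>) (x - 1 - int (LEAST m. reset (g \<omega>) (x - 1 - int m)))
    (LEAST m. reset (g \<omega>) (x - 1 - int m))) \<in> M \<rightarrow>\<^sub>M count_space UNIV"
    by (rule measurable_compose_countable[where g = "\<lambda>\<omega>. LEAST m. reset (g \<omega>) (x - 1 - int m)"]) measurable
  show ?thesis unfolding horiz_def by measurable
qed

lemma measurable_row: "(\<lambda>\<omega>. row (g \<omega>) (f \<omega>)) \<in> M \<rightarrow>\<^sub>M config_space n"
proof (rule measurable_config_spaceI)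
  note [measurable] = measurable_row_noise_component[OF g] measurable_config_component[OF f]
  show "(\<lambda>\<omega>. row (g \<omega>) (f \<omega>) x) \<in> M \<rightarrow>\<^sub>M count_space UNIV" for x
    unfolding row_def vertex_def by (rule measurable_compose[OF measurable_vertex]) measurable
  show "row (g \<omega>) (f \<omega>) x \<le> n" if "\<omega> \<in> space M" for \<omega> x
    using measurable_space[OF f that] by (intro row_le) (simp add: space_config_space)
qed

end

declare measurable_config_component [measurable (raw)] measurable_row_noise_component [measurable (raw)]
declare measurable_row [measurable (raw)] measurable_horiz [measurable (raw)]

lemma measure_row_noise_Int:
  assumes b: "0 \<le> b1" "b1 \<le> 1" "0 \<le> b2" "b2 \<le> 1"
    and A [measurable]: "A \<in> sets (row_noise b1 b2)"
    and upd: "\<And>w v i. fun_upd w (x, i) v \<in> A \<longleftrightarrow> w \<in> A"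
  shows "measure (row_noise b1 b2) (A \<inter> {w. w (x, True) = p \<and> w (x, False) = q}) =
    measure (row_noise b1 b2) A * (if p then b1 else 1 - b1) * (if q then b2 else 1 - b2)"
proof -
  have m: "measure (bern b1 b2 i) {v} = (if v then (if i then b1 else b2) else 1 - (if i then b1 else b2))" for i v
    using b by (cases v) (auto simp: bern_def measure_pmf_single)
  have m1: "measure (row_noise b1 b2) (A \<inter> {w. w (x, True) = p}) = measure (row_noise b1 b2) A * (if p then b1 else 1 - b1)"
    using PiM_measure_Int_component[of "\<lambda>z. bern b1 b2 (snd z)" A "{p}" "(x, True)"] A upd prob_space_bern
    by (simp add: row_noise_def[symmetric] m)
  have [measurable]: "A \<inter> {w. w (x, True) = p} \<in> sets (row_noise b1 b2)"
  proof -
    have "{w \<in> space (row_noise b1 b2). w (x, True) = p} \<in> sets (row_noise b1 b2)" by measurable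
    then show ?thesis by simp
  qed
  have "measure (row_noise b1 b2) ((A \<inter> {w. w (x, True) = p}) \<inter> {w. w (x, False) = q}) =
    measure (row_noise b1 b2) (A \<inter> {w. w (x, True) = p}) * (if q then b2 else 1 - b2)"
    using PiM_measure_Int_component[of "\<lambda>z. bern b1 b2 (snd z)" "A \<inter> {w. w (x, True) = p}" "{q}" "(x, False)"] upd prob_space_bern
    by (simp add: row_noise_def[symmetric] m)
  moreover have "A \<inter> {w. w (x, True) = p \<and> w (x, False) = q} = (A \<inter> {w. w (x, True) = p}) \<inter> {w. w (x, False) = q}"
    by auto
  ultimately show ?thesis by (simp add: m1)
qed

text \<open>Vertices are resets independently with probability r = (1 - b1) (1 - b2) > 0, so k
  consecutive vertices contain none with probability (1 - r) ^ k.\<close>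

lemma AE_good_row:
  assumes b: "0 \<le> b1" "b1 < 1" "0 \<le> b2" "b2 < 1"
  shows "AE w in row_noise b1 b2. good_row w"
proof -
  interpret prob_space "row_noise b1 b2" by (rule prob_space_row_noise)
  have "AE w in row_noise b1 b2. \<exists>m. reset w (x - 1 - int m)" for x
  proof -
    define A where "A k = {w \<in> space (row_noise b1 b2). \<forall>m<k. \<not> reset w (x - 1 - int m)}" for k :: nat
    have [measurable]: "Measurable.pred (row_noise b1 b2) (\<lambda>w. reset w y)" for y
      by (rule measurable_reset) (rule measurable_ident_sets[OF refl])
    have mA [measurable]: "A k \<in> events" for k unfolding A_def by measurable
    define r where "r = (1 - b1) * (1 - b2)"
    have "prob (A k) = (1 - r) ^ k" for k
    proof (induction k)
      case 0 then show ?case using prob_space by (simp add: A_def)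
    next
      case (Suc k)
      define y where "y = x - 1 - int k"
      have "prob (A k \<inter> {w. w (y, True) = False \<and> w (y, False) = False}) = prob (A k) * (1 - b1) * (1 - b2)"
      proof -
        have "fun_upd w (y, i) v \<in> A k \<longleftrightarrow> w \<in> A k" for w v i
        proof -
          have "reset (fun_upd w (y, i) v) (x - 1 - int m) = reset w (x - 1 - int m)" if "m < k" for m
            using that by (simp add: reset_def y_def)
          then show ?thesis by (simp add: A_def)
        qed
        then show ?thesis using b by (subst measure_row_noise_Int) simp_all
      qed
      moreover have "A (Suc k) = A k - (A k \<inter> {w. w (y, True) = False \<and> w (y, False) = False})"
        by (auto simp: A_def y_def reset_def less_Suc_eq)
      moreover have "A k \<inter> {w. w (y, True) = False \<and> w (y, False) = False} \<in> events"
      proof -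
        have "{w \<in> space (row_noise b1 b2). w (y, True) = False \<and> w (y, False) = False} \<in> events" by measurable
        then show ?thesis by (intro sets.Int mA) simp
      qed
      ultimately have "prob (A (Suc k)) = prob (A k) - prob (A k) * (1 - b1) * (1 - b2)"
        by (simp add: finite_measure_Diff)
      then show ?case by (simp add: Suc r_def algebra_simps)
    qed
    moreover have "(\<lambda>k. (1 - r) ^ k) \<longlonglongrightarrow> 0"
    proof (rule LIMSEQ_power_zero)
      have "0 < r" "r \<le> 1" using b by (auto simp: r_def mult_le_one)
      then show "norm (1 - r) < 1" by simp
    qed
    moreover have "(\<lambda>k. prob (A k)) \<longlonglongrightarrow> prob (\<Inter>k. A k)"
      by (rule finite_Lim_measure_decseq) (use mA in \<open>auto simp: decseq_def\<close>, simp add: A_def)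
    ultimately have "prob (\<Inter>k. A k) = 0" using LIMSEQ_unique by fastforce
    then have "AE w in row_noise b1 b2. w \<notin> (\<Inter>k. A k)" by (subst (asm) prob_eq_0) auto
    then show ?thesis by eventually_elim (auto simp: A_def)
  qed
  then show ?thesis unfolding good_row_def AE_all_countable by blast
qed

section \<open>The basic coupling\<close>

lemma measure_preserving_shift_row: "measure_preserving (row_noise b1 b2) shift_row"
proof -
  have "measure_preserving (PiM UNIV (\<lambda>z :: int \<times> bool. bern b1 b2 (snd z))) (\<lambda>w z. w (map_prod (\<lambda>x. x + 1) id z))"
    by (rule measure_preserving_PiM) (auto simp: prob_space_bern intro: prod.inj_map)
  moreover have "(\<lambda>w z. w (map_prod (\<lambda>x. x + 1) id z)) = (shift_row :: (int \<times> bool \<Rightarrow> bool) \<Rightarrow> _)"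
    by (intro ext) (simp add: shift_row_def map_prod_def split: prod.splits)
  ultimately show ?thesis by (simp add: row_noise_def)
qed

lemma measurable_translate [measurable (raw)]:
  "f \<in> M \<rightarrow>\<^sub>M config_space n \<Longrightarrow> (\<lambda>\<omega>. translate y (f \<omega>)) \<in> M \<rightarrow>\<^sub>M config_space n"
  by (rule measurable_config_spaceI)
    (auto simp: translate_def space_config_space dest: measurable_space intro: measurable_config_component)

definition pair_space :: "nat \<Rightarrow> ((int \<Rightarrow> nat) \<times> (int \<Rightarrow> nat)) measure" where
  "pair_space n = config_space n \<Otimes>\<^sub>M config_space n"

definition shift_pair :: "(int \<Rightarrow> nat) \<times> (int \<Rightarrow> nat) \<Rightarrow> (int \<Rightarrow> nat) \<times> (int \<Rightarrow> nat)" where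
  "shift_pair p = (translate 1 (fst p), translate 1 (snd p))"

definition row_pair :: "(int \<times> bool \<Rightarrow> bool) \<Rightarrow> (int \<Rightarrow> nat) \<times> (int \<Rightarrow> nat) \<Rightarrow> (int \<Rightarrow> nat) \<times> (int \<Rightarrow> nat)" where
  "row_pair w p = (row w (fst p), row w (snd p))"

definition step :: "nat \<Rightarrow> real \<Rightarrow> real \<Rightarrow> (int \<Rightarrow> nat) measure \<Rightarrow> (int \<Rightarrow> nat) measure" where
  "step n b1 b2 \<mu> = distr (\<mu> \<Otimes>\<^sub>M row_noise b1 b2) (config_space n) (\<lambda>(\<eta>, w). row w \<eta>)"

definition step_pair :: "nat \<Rightarrow> real \<Rightarrow> real \<Rightarrow> ((int \<Rightarrow> nat) \<times> (int \<Rightarrow> nat)) measure \<Rightarrow> ((int \<Rightarrow> nat) \<times> (int \<Rightarrow> nat)) measure" where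
  "step_pair n b1 b2 Q = distr (Q \<Otimes>\<^sub>M row_noise b1 b2) (pair_space n) (\<lambda>(p, w). row_pair w p)"

lemma measurable_pair_space_fst [measurable (raw)]:
  "f \<in> M \<rightarrow>\<^sub>M pair_space n \<Longrightarrow> (\<lambda>\<omega>. fst (f \<omega>)) \<in> M \<rightarrow>\<^sub>M config_space n"
  unfolding pair_space_def by measurable

lemma measurable_pair_space_snd [measurable (raw)]:
  "f \<in> M \<rightarrow>\<^sub>M pair_space n \<Longrightarrow> (\<lambda>\<omega>. snd (f \<omega>)) \<in> M \<rightarrow>\<^sub>M config_space n"
  unfolding pair_space_def by measurable

lemma measurable_row_pair [measurable (raw)]:
  assumes [measurable]: "f \<in> M \<rightarrow>\<^sub>M pair_space n" "g \<in> M \<rightarrow>\<^sub>M row_noise b1 b2"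
  shows "(\<lambda>\<omega>. row_pair (g \<omega>) (f \<omega>)) \<in> M \<rightarrow>\<^sub>M pair_space n"
  unfolding row_pair_def pair_space_def by measurable

lemma measurable_shift_pair [measurable (raw)]:
  assumes [measurable]: "f \<in> M \<rightarrow>\<^sub>M pair_space n"
  shows "(\<lambda>\<omega>. shift_pair (f \<omega>)) \<in> M \<rightarrow>\<^sub>M pair_space n"
  unfolding shift_pair_def pair_space_def by measurable

lemma sets_step [measurable_cong, simp]: "sets (step n b1 b2 \<mu>) = sets (config_space n)"
  by (simp add: step_def)

lemma sets_step_pair [measurable_cong, simp]: "sets (step_pair n b1 b2 Q) = sets (pair_space n)"
  by (simp add: step_pair_def)

lemma prob_space_distr_pair:
  assumes "prob_space M" "f \<in> M \<Otimes>\<^sub>M row_noise b1 b2 \<rightarrow>\<^sub>M N"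
  shows "prob_space (distr (M \<Otimes>\<^sub>M row_noise b1 b2) N f)"
proof -
  interpret M: prob_space M by fact
  interpret R: prob_space "row_noise b1 b2" by (rule prob_space_row_noise)
  interpret pair_prob_space M "row_noise b1 b2" ..
  show ?thesis by (rule prob_space_distr) fact
qed

lemma distr_pair_map_fst:
  assumes N: "prob_space N" and f: "f \<in> M \<rightarrow>\<^sub>M K"
  shows "distr M K f \<Otimes>\<^sub>M N = distr (M \<Otimes>\<^sub>M N) (K \<Otimes>\<^sub>M N) (\<lambda>(x, y). (f x, y))"
proof -
  interpret prob_space N by fact
  have "distr M K f \<Otimes>\<^sub>M distr N N (\<lambda>y. y) = distr (M \<Otimes>\<^sub>M N) (K \<Otimes>\<^sub>M N) (\<lambda>(x, y). (f x, y))"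
    using f by (intro pair_measure_distr) (simp_all add: distr_id sigma_finite_measure_axioms)
  then show ?thesis by (simp add: distr_id)
qed

lemma step_distr:
  assumes f [measurable]: "f \<in> M \<rightarrow>\<^sub>M config_space n"
  shows "step n b1 b2 (distr M (config_space n) f) =
    distr (M \<Otimes>\<^sub>M row_noise b1 b2) (config_space n) (\<lambda>(\<omega>, w). row w (f \<omega>))"
  unfolding step_def distr_pair_map_fst[OF prob_space_row_noise f]
  by (subst distr_distr) (auto simp: comp_def case_prod_beta')

lemma step_pair_distr:
  assumes f [measurable]: "f \<in> M \<rightarrow>\<^sub>M pair_space n"
  shows "step_pair n b1 b2 (distr M (pair_space n) f) =
    distr (M \<Otimes>\<^sub>M row_noise b1 b2) (pair_space n) (\<lambda>(\<omega>, w). row_pair w (f \<omega>))"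
  unfolding step_pair_def distr_pair_map_fst[OF prob_space_row_noise f]
  by (subst distr_distr) (auto simp: comp_def case_prod_beta')

lemma prob_space_step:
  assumes "prob_space \<mu>" and [measurable_cong]: "sets \<mu> = sets (config_space n)"
  shows "prob_space (step n b1 b2 \<mu>)"
  unfolding step_def by (rule prob_space_distr_pair[OF assms(1)]) measurable

lemma prob_space_step_pair:
  assumes "prob_space Q" and [measurable_cong]: "sets Q = sets (pair_space n)"
  shows "prob_space (step_pair n b1 b2 Q)"
  unfolding step_pair_def by (rule prob_space_distr_pair[OF assms(1)]) measurable

lemma distr_step_pair:
  assumes Q: "prob_space Q" and [measurable_cong]: "sets Q = sets (pair_space n)"
    and f: "f = fst \<or> f = snd"
  shows "distr (step_pair n b1 b2 Q) (config_space n) f = step n b1 b2 (distr Q (config_space n) f)"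
proof -
  have [measurable]: "f \<in> pair_space n \<rightarrow>\<^sub>M config_space n" using f by auto
  have "f (row_pair w p) = row w (f p)" for w p using f by (auto simp: row_pair_def)
  moreover have "distr (step_pair n b1 b2 Q) (config_space n) f =
    distr (Q \<Otimes>\<^sub>M row_noise b1 b2) (config_space n) (\<lambda>(p, w). f (row_pair w p))"
    unfolding step_pair_def by (subst distr_distr) (auto simp: comp_def case_prod_beta')
  moreover have "f \<in> Q \<rightarrow>\<^sub>M config_space n" by measurable
  ultimately show ?thesis by (simp add: step_distr)
qed

lemma distr_step_pair_pow:
  assumes Q: "prob_space Q" and Qs: "sets Q = sets (pair_space n)" and f: "f = fst \<or> f = snd"
  shows "distr ((step_pair n b1 b2 ^^ t) Q) (config_space n) f = (step n b1 b2 ^^ t) (distr Q (config_space n) f)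
    \<and> prob_space ((step_pair n b1 b2 ^^ t) Q) \<and> sets ((step_pair n b1 b2 ^^ t) Q) = sets (pair_space n)"
proof (induction t)
  case (Suc t)
  then show ?case using distr_step_pair[OF _ _ f] prob_space_step_pair by auto
qed (simp add: Q Qs)

text \<open>Particles, the classes at most \<open>k\<close>, become \<open>0\<close>; the other classes become \<open>1\<close>.\<close>
definition thr :: "nat \<Rightarrow> nat \<Rightarrow> nat" where
  "thr k a = (if a \<le> k then 0 else 1)"

lemma mono_thr: "mono (thr k)"
  by (auto simp: mono_def thr_def)

lemma thr_0 [simp]: "thr k 0 = 0"
  by (simp add: thr_def)

definition disc :: "nat \<Rightarrow> nat \<Rightarrow> nat \<Rightarrow> bool" where
  "disc k a a' \<longleftrightarrow> (a \<le> k) \<noteq> (a' \<le> k)"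

text \<open>After thresholding the identity is a finite check. Each copy conserves particles, so the
  signed number of discrepancies is conserved and only an opposite pair can disappear; equal inputs
  give equal outputs because both copies read the same bits, so no pair is created.\<close>

lemma vertex_disc:
  assumes "vertex w x a c = (b, d)" "vertex w x a' c' = (b', d')"
  shows "of_bool (disc k b b') + of_bool (disc k d d') =
    (of_bool (disc k a a') + of_bool (disc k c c') :: real)
      - 2 * of_bool (disc k a a' \<and> disc k c c' \<and> \<not> disc k b b' \<and> \<not> disc k d d')"
proof -
  have *: "vertex w x (thr k a) (thr k c) = (thr k b, thr k d)"
    "vertex w x (thr k a') (thr k c') = (thr k b', thr k d')"
    using assms by (simp_all add: vertex_map[OF mono_thr])
  have d: "disc k u v \<longleftrightarrow> thr k u \<noteq> thr k v" for u v by (simp add: disc_def thr_def)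
  have "thr k u = 0 \<or> thr k u = 1" for u by (simp add: thr_def)
  then show ?thesis
    using * unfolding d vertex_def vertex_out_def
    by (smt (verit, best) Pair_inject of_bool_eq(1) of_bool_eq(2))
qed

text \<open>One time step of a coupling Q that is invariant under simultaneous translation of both
  copies, with particles the classes at most k.\<close>

locale coupled_row = measure_preserving Q shift_pair
  for Q :: "((int \<Rightarrow> nat) \<times> (int \<Rightarrow> nat)) measure" +
  fixes n :: nat and b1 b2 :: real and k :: nat
  assumes b: "0 < b1" "b1 < 1" "0 < b2" "b2 < 1"
    and sets_Q [measurable_cong]: "sets Q = sets (pair_space n)"
begin

sublocale R: measure_preserving "row_noise b1 b2" shift_row
  by (rule measure_preserving_shift_row)

abbreviation joint where "joint \<equiv> Q \<Otimes>\<^sub>M row_noise b1 b2"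

sublocale J: measure_preserving joint "\<lambda>(p, w). (shift_pair p, shift_row w)"
  by (rule measure_preserving_pair) unfold_locales

definition bot where "bot x pw = disc k (fst (fst pw) x) (snd (fst pw) x)"
definition top where "top x pw = disc k (row (snd pw) (fst (fst pw)) x) (row (snd pw) (snd (fst pw)) x)"
definition left where "left x pw = disc k (horiz (snd pw) (fst (fst pw)) x) (horiz (snd pw) (snd (fst pw)) x)"
definition ann where "ann x pw \<longleftrightarrow> bot x pw \<and> left x pw \<and> \<not> top x pw \<and> \<not> left (x + 1) pw"

lemma measurable_bot [measurable]: "Measurable.pred joint (bot x)"
  unfolding bot_def disc_def by measurable

lemma measurable_top [measurable]: "Measurable.pred joint (top x)"
  unfolding top_def disc_def by measurable

lemma measurable_left [measurable]: "Measurable.pred joint (left x)"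
  unfolding left_def disc_def by measurable

lemma measurable_ann [measurable]: "Measurable.pred joint (ann x)"
  unfolding ann_def by measurable

lemma shift_events:
  "bot x (shift_pair p, shift_row w) = bot (x + 1) (p, w)"
  "top x (shift_pair p, shift_row w) = top (x + 1) (p, w)"
  "left x (shift_pair p, shift_row w) = left (x + 1) (p, w)"
  "ann x (shift_pair p, shift_row w) = ann (x + 1) (p, w)"
  by (simp_all add: bot_def top_def left_def ann_def shift_pair_def row_shift horiz_shift)
    (simp_all add: translate_def)

lemma prob_shift:
  assumes [measurable]: "\<And>x :: int. Measurable.pred joint (P x)"
    and P: "\<And>x p w. P x (shift_pair p, shift_row w) = P (x + 1) (p, w)"
  shows "\<P>(\<omega> in joint. P x \<omega>) = \<P>(\<omega> in joint. P 0 \<omega>)"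
proof -
  have 1: "\<P>(\<omega> in joint. P (x + 1) \<omega>) = \<P>(\<omega> in joint. P x \<omega>)" for x
  proof -
    have "{\<omega> \<in> space joint. P (x + 1) \<omega>} = (\<lambda>(p, w). (shift_pair p, shift_row w)) -` {\<omega> \<in> space joint. P x \<omega>} \<inter> space joint"
      using measurable_space[OF J.T_measurable] by (auto simp: P)
    then show ?thesis using J.measure_vimage_funpow[of "{\<omega> \<in> space joint. P x \<omega>}" 1] by simp
  qed
  show ?thesis
  proof (induction x rule: int_induct[where k = 0])
    case (step2 i) then show ?case using 1[of "i - 1"] by simp
  qed (simp_all add: 1)
qed

lemma AE_good: "AE pw in joint. good_row (snd pw)"
proof -
  interpret pair_prob_space Q "row_noise b1 b2" ..
  have "AE w in row_noise b1 b2. good_row w" using b by (intro AE_good_row) auto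
  then show ?thesis
    by (intro AE_pair_measure) auto
qed

text \<open>Expectation of the balance at one vertex. The discrepancies on the left and on the right
  edge have equal probability by translation invariance and cancel, so only annihilation changes the
  density.\<close>

lemma prob_top: "\<P>(\<omega> in joint. top 0 \<omega>) =
  \<P>(\<omega> in joint. bot 0 \<omega>) - 2 * \<P>(\<omega> in joint. ann 0 \<omega>)"
proof -
  have eq: "AE \<omega> in joint. of_bool (top 0 \<omega>) + of_bool (left 1 \<omega>) =
      (of_bool (bot 0 \<omega>) + of_bool (left 0 \<omega>) :: real) - 2 * of_bool (ann 0 \<omega>)"
    using AE_good
  proof eventually_elim
    case (elim \<omega>)
    from vertex_disc[OF vertex_row_horiz[OF elim, of 0 "fst (fst \<omega>)"] vertex_row_horiz[OF elim, of 0 "snd (fst \<omega>)"], of k]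
    show ?case by (simp add: ann_def top_def left_def bot_def)
  qed
  have E: "J.expectation (\<lambda>\<omega>. of_bool (P \<omega>)) = \<P>(\<omega> in joint. P \<omega>)"
    "integrable joint (\<lambda>\<omega>. of_bool (P \<omega>) :: real)"
    if [measurable]: "Measurable.pred joint P" for P
  proof -
    have "J.expectation (\<lambda>\<omega>. of_bool (P \<omega>)) = J.expectation (indicator {\<omega> \<in> space joint. P \<omega>} :: _ \<Rightarrow> real)"
      by (intro Bochner_Integration.integral_cong) (auto simp: indicator_def)
    then show "J.expectation (\<lambda>\<omega>. of_bool (P \<omega>)) = \<P>(\<omega> in joint. P \<omega>)"
      by (simp add: Int_absorb2)
    show "integrable joint (\<lambda>\<omega>. of_bool (P \<omega>) :: real)"
      by (rule J.integrable_const_bound[of _ 1]) auto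
  qed
  have "J.expectation (\<lambda>\<omega>. of_bool (top 0 \<omega>) + of_bool (left 1 \<omega>)) =
    J.expectation (\<lambda>\<omega>. (of_bool (bot 0 \<omega>) + of_bool (left 0 \<omega>) :: real) - 2 * of_bool (ann 0 \<omega>))"
    using eq by (intro integral_cong_AE) auto
  then have "\<P>(\<omega> in joint. top 0 \<omega>) + \<P>(\<omega> in joint. left 1 \<omega>) =
    \<P>(\<omega> in joint. bot 0 \<omega>) + \<P>(\<omega> in joint. left 0 \<omega>) - 2 * \<P>(\<omega> in joint. ann 0 \<omega>)"
    by (simp add: E)
  then show ?thesis using prob_shift[of left 1] by (simp add: shift_events)
qed

end

text \<open>
  With this noise the class entering \<open>i\<close> from below runs straight to \<open>j\<close>, and at \<open>j\<close> the smaller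
  class always leaves through the top, so that opposite discrepancies at \<open>i\<close> and \<open>j\<close> annihilate.
\<close>
definition pattern :: "int \<Rightarrow> int \<Rightarrow> (int \<times> bool \<Rightarrow> bool) \<Rightarrow> bool" where
  "pattern i j w \<longleftrightarrow> reset w i \<and> (\<forall>y. i < y \<and> y < j \<longrightarrow> w (y, True) \<and> w (y, False)) \<and> w (j, True) \<and> \<not> w (j, False)"

lemma prob_pattern_pos:
  assumes b: "0 < b1" "b1 < 1" "0 < b2" "b2 < 1" and ij: "i < j"
  shows "0 < measure (row_noise b1 b2) {w. pattern i j w}"
proof -
  \<comment> \<open>The values prescribed to the bits of column y: both false at i, both true
    strictly between, and at j the bit is its own label c, that is, \<chi>1 true and \<chi>2
    false.\<close>
  define X where "X = (\<lambda>(y, c). if y = i then {False} else if y = j then {c} else {True})"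
  interpret PP: product_prob_space "\<lambda>z :: int \<times> bool. bern b1 b2 (snd z)" UNIV
    by (simp add: product_prob_space_def product_prob_space_axioms_def product_sigma_finite_def
        prob_space_bern prob_space_imp_sigma_finite)
  have "{w. pattern i j w} = PP.emb UNIV ({i..j} \<times> UNIV) (Pi\<^sub>E ({i..j} \<times> UNIV) X)"
  proof -
    have "pattern i j w \<longleftrightarrow> (\<forall>z\<in>{i..j} \<times> UNIV. w z \<in> X z)" for w
    proof
      assume "pattern i j w"
      then show "\<forall>z\<in>{i..j} \<times> UNIV. w z \<in> X z"
        using ij by (auto simp: pattern_def X_def reset_def) (metis (full_types) linorder_le_less_linear order_le_less)+
    next
      assume *: "\<forall>z\<in>{i..j} \<times> UNIV. w z \<in> X z"
      have "w (y, True) \<and> w (y, False)" if "i < y" "y < j" for y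
        using that *[rule_format, of "(y, True)"] *[rule_format, of "(y, False)"] by (auto simp: X_def)
      then show "pattern i j w"
        using ij *[rule_format, of "(i, True)"] *[rule_format, of "(i, False)"]
          *[rule_format, of "(j, True)"] *[rule_format, of "(j, False)"]
        by (auto simp: pattern_def X_def reset_def)
    qed
    then show ?thesis by (auto simp: prod_emb_def PiE_iff)
  qed
  then have "measure (row_noise b1 b2) {w. pattern i j w} =
    (\<Prod>z\<in>{i..j} \<times> UNIV. measure (bern b1 b2 (snd z)) (X z))"
    unfolding row_noise_def by (simp add: PP.measure_PiM_emb)
  also have "\<dots> > 0"
  proof (rule prod_pos)
    fix z :: "int \<times> bool"
    obtain v where "X z = {v}" unfolding X_def case_prod_beta by metis
    then show "0 < measure (bern b1 b2 (snd z)) (X z)"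
      using b by (cases v) (auto simp: bern_def measure_pmf_single)
  qed
  finally show ?thesis .
qed

lemma horiz_pattern:
  assumes good: "good_row w" and pat: "pattern i j w" and y: "i < y" "y \<le> j"
  shows "horiz w \<eta> y = \<eta> i"
proof -
  have "i + 1 + int m \<le> j \<longrightarrow> horiz w \<eta> (i + 1 + int m) = \<eta> i" for m
  proof (induction m)
    case 0 then show ?case
      using horiz_step[OF good, of \<eta> i] pat by (simp add: pattern_def snd_vertex_reset)
  next
    case (Suc m)
    show ?case
    proof
      assume *: "i + 1 + int (Suc m) \<le> j"
      then have w: "w (i + 1 + int m, True)" "w (i + 1 + int m, False)"
        using pat by (auto simp: pattern_def)
      have "horiz w \<eta> (i + 1 + int m + 1) = \<eta> i"
        using Suc * w horiz_step[OF good, of \<eta> "i + 1 + int m"] by (simp add: vertex_def vertex_out_def)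
      then show "horiz w \<eta> (i + 1 + int (Suc m)) = \<eta> i" by (simp add: ac_simps)
    qed
  qed
  from this[of "nat (y - i - 1)"] y show ?thesis by simp
qed

text \<open>Given discrepancies at i and j, their signs differ exactly if one of the two sites holds
  a particle of the first copy and the other does not.\<close>

definition opposite :: "nat \<Rightarrow> int \<Rightarrow> int \<Rightarrow> (int \<Rightarrow> nat) \<times> (int \<Rightarrow> nat) \<Rightarrow> bool" where
  "opposite k i j p \<longleftrightarrow> disc k (fst p i) (snd p i) \<and> disc k (fst p j) (snd p j) \<and> disc k (fst p i) (fst p j)"

text \<open>In each copy one incoming edge holds a particle and the other does not. With these bits
  the particle leaves through the top in both copies.\<close>

lemma vertex_annihilates:
  assumes w: "w (x, True)" "\<not> w (x, False)"
    and d: "disc k a a'" "disc k c c'" "disc k a c"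
    and v: "vertex w x a c = (b, d)" "vertex w x a' c' = (b', d')"
  shows "\<not> disc k b b' \<and> \<not> disc k d d'"
  using assms by (auto simp: vertex_def vertex_out_def disc_def split: if_splits)

context coupled_row
begin

lemma opposite_imp_ann:
  assumes good: "good_row w" and pat: "pattern i j w" and ij: "i < j" and opp: "opposite k i j p"
  shows "ann j (p, w)"
proof -
  have h: "horiz w \<eta> j = \<eta> i" for \<eta> using horiz_pattern[OF good pat ij] by simp
  have "\<not> disc k (row w (fst p) j) (row w (snd p) j) \<and> \<not> disc k (horiz w (fst p) (j + 1)) (horiz w (snd p) (j + 1))"
  proof (rule vertex_annihilates[where x = j and w = w])
    show "vertex w j (fst p j) (fst p i) = (row w (fst p) j, horiz w (fst p) (j + 1))"
      "vertex w j (snd p j) (snd p i) = (row w (snd p) j, horiz w (snd p) (j + 1))"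
      using vertex_row_horiz[OF good, of j "fst p"] vertex_row_horiz[OF good, of j "snd p"] by (simp_all add: h)
  qed (use opp pat in \<open>auto simp: opposite_def pattern_def disc_def\<close>)
  then show ?thesis using opp h by (simp add: ann_def bot_def left_def top_def opposite_def)
qed

lemma measurable_opposite [measurable]: "Measurable.pred Q (opposite k i j)"
  unfolding opposite_def disc_def by measurable

lemma measurable_pattern [measurable]: "Measurable.pred (row_noise b1 b2) (pattern i j)"
  unfolding pattern_def by measurable

text \<open>The pattern depends on the fresh noise alone and is independent of the configurations;
  together with opposite discrepancies it forces an annihilation at j, which is as likely as one at
  0.\<close>

lemma prob_opposite_le:
  assumes ij: "i < j"
  shows "\<P>(p in Q. opposite k i j p) \<le>
    \<P>(\<omega> in joint. ann 0 \<omega>) / measure (row_noise b1 b2) {w. pattern i j w}"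
proof -
  have pat [measurable]: "{w. pattern i j w} \<in> R.events"
    using measurable_pattern[of i j] by (simp add: pred_def)
  have opp [measurable]: "{p \<in> space Q. opposite k i j p} \<in> events" by measurable
  have "\<P>(p in Q. opposite k i j p) * R.prob {w. pattern i j w} =
    J.prob ({p \<in> space Q. opposite k i j p} \<times> {w. pattern i j w})"
    using R.emeasure_pair_measure_Times[OF opp pat] by (simp add: measure_def enn2real_mult)
  also have "\<dots> \<le> \<P>(\<omega> in joint. ann j \<omega>)"
  proof (rule J.finite_measure_mono_AE)
    show "AE \<omega> in joint. \<omega> \<in> {p \<in> space Q. opposite k i j p} \<times> {w. pattern i j w} \<longrightarrow> \<omega> \<in> {\<omega> \<in> space joint. ann j \<omega>}"
      using AE_good
    proof eventually_elim
      case (elim \<omega>)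
      then show ?case using opposite_imp_ann[of "snd \<omega>" i j "fst \<omega>"] ij by (auto simp: space_pair_measure)
    qed
  qed measurable
  also have "\<dots> = \<P>(\<omega> in joint. ann 0 \<omega>)"
    by (rule prob_shift) (simp_all add: shift_events)
  finally show ?thesis
    using prob_pattern_pos[OF b ij] by (simp add: field_simps)
qed

lemma prob_disc_shift:
  "\<P>(p in Q. disc k (fst p x) (snd p x)) = \<P>(p in Q. disc k (fst p 0) (snd p 0))"
  and prob_bot: "\<P>(\<omega> in joint. bot x \<omega>) = \<P>(p in Q. disc k (fst p x) (snd p x))"
proof -
  show *: "\<P>(\<omega> in joint. bot x \<omega>) = \<P>(p in Q. disc k (fst p x) (snd p x))" for x
  proof -
    have [measurable]: "{p \<in> space Q. disc k (fst p x) (snd p x)} \<in> events"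
      unfolding disc_def by measurable
    have "{\<omega> \<in> space joint. bot x \<omega>} = {p \<in> space Q. disc k (fst p x) (snd p x)} \<times> space (row_noise b1 b2)"
      by (auto simp: bot_def space_pair_measure)
    then show ?thesis
      by (simp add: measure_def R.emeasure_pair_measure_Times enn2real_mult R.emeasure_space_1 del: space_row_noise)
  qed
  show "\<P>(p in Q. disc k (fst p x) (snd p x)) = \<P>(p in Q. disc k (fst p 0) (snd p 0))"
    using prob_shift[of bot x] by (simp add: shift_events *)
qed

end

section \<open>Discrepancies and particle counts in a window\<close>

definition count_upto :: "nat \<Rightarrow> nat \<Rightarrow> (int \<Rightarrow> nat) \<Rightarrow> real" where
  "count_upto k L \<eta> = (\<Sum>x<L. of_bool (\<eta> (int x) \<le> k))"

text \<open>The error in the mean ergodic theorem. It involves a single configuration, hence only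
  the marginals of a coupling.\<close>

definition deviation :: "nat \<Rightarrow> real \<Rightarrow> nat \<Rightarrow> (int \<Rightarrow> nat) measure \<Rightarrow> real" where
  "deviation k \<rho> L \<mu> = integral\<^sup>L \<mu> (\<lambda>\<eta>. \<bar>count_upto k L \<eta> / L - \<rho>\<bar>)"

lemma count_upto_bounds: "0 \<le> count_upto k L \<eta>" "count_upto k L \<eta> \<le> L"
proof -
  have "count_upto k L \<eta> \<le> (\<Sum>x<L. 1)" unfolding count_upto_def by (intro sum_mono) simp
  then show "count_upto k L \<eta> \<le> L" by simp
qed (simp add: count_upto_def sum_nonneg)

lemma measurable_count_upto [measurable (raw)]:
  assumes [measurable]: "f \<in> M \<rightarrow>\<^sub>M config_space n"
  shows "(\<lambda>\<omega>. count_upto k L (f \<omega>)) \<in> borel_measurable M"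
  unfolding count_upto_def of_bool_def by measurable

lemma integrable_deviation:
  assumes "prob_space M" and [measurable]: "f \<in> M \<rightarrow>\<^sub>M config_space n"
  shows "integrable M (\<lambda>\<omega>. \<bar>count_upto k L (f \<omega>) / L - \<rho>\<bar>)"
proof -
  interpret prob_space M by fact
  have "\<bar>count_upto k L \<eta> / L\<bar> \<le> 1" for \<eta>
    using count_upto_bounds[of k L \<eta>] by (cases "L = 0") (simp_all add: divide_le_eq_1)
  then have "norm \<bar>count_upto k L \<eta> / L - \<rho>\<bar> \<le> 1 + \<bar>\<rho>\<bar>" for \<eta>
    using abs_triangle_ineq4[of "count_upto k L \<eta> / L" \<rho>] unfolding real_norm_def abs_abs by (meson add_right_mono order_trans)
  then show ?thesis by (intro integrable_const_bound[of _ "1 + \<bar>\<rho>\<bar>"]) auto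
qed

definition pairs_below :: "nat \<Rightarrow> (nat \<times> nat) set" where
  "pairs_below L = {(i, j). i < j \<and> j < L}"

lemma finite_pairs_below: "finite (pairs_below L)"
  by (rule finite_subset[of _ "{..<L} \<times> {..<L}"]) (auto simp: pairs_below_def)

text \<open>
  If there are no opposite discrepancies in the window then all discrepancies have the same sign,
  and their number is the difference of the particle counts.
\<close>
lemma count_disc_le:
  "(\<Sum>x<L. of_bool (disc k (\<eta> (int x)) (\<xi> (int x)))) \<le> \<bar>count_upto k L \<eta> - count_upto k L \<xi>\<bar>
    + real L * (\<Sum>(i, j)\<in>pairs_below L. of_bool (opposite k (int i) (int j) (\<eta>, \<xi>)))"
proof (cases "\<exists>(i, j)\<in>pairs_below L. opposite k (int i) (int j) (\<eta>, \<xi>)")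
  case True
  then obtain i j where ij: "(i, j) \<in> pairs_below L" "opposite k (int i) (int j) (\<eta>, \<xi>)" by blast
  \<comment> \<open>A window with an opposite pair is charged the trivial bound L.\<close>
  have "(\<Sum>x<L. of_bool (disc k (\<eta> (int x)) (\<xi> (int x)))) \<le> (\<Sum>x<L. 1 :: real)"
    by (intro sum_mono) simp
  also have "\<dots> = real L * 1" by simp
  also have "1 \<le> (\<Sum>(i, j)\<in>pairs_below L. of_bool (opposite k (int i) (int j) (\<eta>, \<xi>)) :: real)"
    using ij member_le_sum[of "(i, j)" "pairs_below L" "\<lambda>(i, j). of_bool (opposite k (int i) (int j) (\<eta>, \<xi>)) :: real"]
    by (auto simp: finite_pairs_below)
  finally show ?thesis by (simp add: mult_left_mono add_increasing)
next
  case False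
  have sym: "disc k (\<eta> (int x)) (\<xi> (int x)) \<and> disc k (\<eta> (int y)) (\<xi> (int y)) \<longrightarrow> (\<eta> (int x) \<le> k) = (\<eta> (int y) \<le> k)"
    if "x < L" "y < L" for x y
  proof -
    have "x < y \<or> y < x \<or> x = y" by arith
    then show ?thesis using False that by (auto simp: pairs_below_def opposite_def disc_def)
  qed
  have "(\<Sum>x<L. of_bool (disc k (\<eta> (int x)) (\<xi> (int x)))) \<le> \<bar>count_upto k L \<eta> - count_upto k L \<xi>\<bar>"
  proof (cases "\<exists>x<L. disc k (\<eta> (int x)) (\<xi> (int x)) \<and> \<eta> (int x) \<le> k")
    case True
    then have "of_bool (disc k (\<eta> (int x)) (\<xi> (int x))) = (of_bool (\<eta> (int x) \<le> k) - of_bool (\<xi> (int x) \<le> k) :: real)"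
      if "x < L" for x
      using sym that by (auto simp: disc_def)
    then have "(\<Sum>x<L. of_bool (disc k (\<eta> (int x)) (\<xi> (int x)))) = count_upto k L \<eta> - count_upto k L \<xi>"
      by (simp add: count_upto_def sum_subtractf)
    then show ?thesis by simp
  next
    case F: False
    then have "of_bool (disc k (\<eta> (int x)) (\<xi> (int x))) = (of_bool (\<xi> (int x) \<le> k) - of_bool (\<eta> (int x) \<le> k) :: real)"
      if "x < L" for x
      using that by (auto simp: disc_def)
    then have "(\<Sum>x<L. of_bool (disc k (\<eta> (int x)) (\<xi> (int x)))) = count_upto k L \<xi> - count_upto k L \<eta>"
      by (simp add: count_upto_def sum_subtractf)
    then show ?thesis by simp
  qed
  then show ?thesis by (simp add: sum_nonneg add_increasing2 case_prod_beta')
qed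

text \<open>The factor between the annihilation probability and the expected number of opposite
  pairs in a window. It depends on the noise and on L but not on the coupling, which is the source
  of uniformity.\<close>

definition window_const :: "real \<Rightarrow> real \<Rightarrow> nat \<Rightarrow> real" where
  "window_const b1 b2 L = (\<Sum>(i, j)\<in>pairs_below L. 1 / measure (row_noise b1 b2) {w. pattern (int i) (int j) w})"

context coupled_row
begin

text \<open>By translation invariance the density of discrepancies is their mean frequency in the
  window. \<open>count_disc_le\<close> is divided by L, and the two particle frequencies are
  compared through \<rho>.\<close>

lemma prob_disc_le:
  assumes L: "L > 0"
  shows "\<P>(p in Q. disc k (fst p 0) (snd p 0)) \<le>
    deviation k \<rho> L (distr Q (config_space n) fst) + deviation k \<rho> L (distr Q (config_space n) snd)
    + window_const b1 b2 L * \<P>(\<omega> in joint. ann 0 \<omega>)"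
proof -
  let ?A = "\<P>(\<omega> in joint. ann 0 \<omega>)"
  have E: "expectation (\<lambda>\<omega>. of_bool (P \<omega>)) = prob {\<omega> \<in> space Q. P \<omega>}"
    "integrable Q (\<lambda>\<omega>. of_bool (P \<omega>) :: real)"
    if [measurable]: "Measurable.pred Q P" for P
  proof -
    have "expectation (\<lambda>\<omega>. of_bool (P \<omega>)) = expectation (indicator {\<omega> \<in> space Q. P \<omega>} :: _ \<Rightarrow> real)"
      by (intro Bochner_Integration.integral_cong) (auto simp: indicator_def)
    then show "expectation (\<lambda>\<omega>. of_bool (P \<omega>)) = prob {\<omega> \<in> space Q. P \<omega>}"
      by (simp add: Int_absorb2)
    show "integrable Q (\<lambda>\<omega>. of_bool (P \<omega>) :: real)"
      by (rule integrable_const_bound[of _ 1]) auto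
  qed
  have [measurable]: "Measurable.pred Q (\<lambda>p. disc k (fst p x) (snd p x))" for x
    unfolding disc_def by measurable
  have int: "integrable Q (\<lambda>p. \<bar>count_upto k L (fst p) / L - \<rho>\<bar>)" "integrable Q (\<lambda>p. \<bar>count_upto k L (snd p) / L - \<rho>\<bar>)"
    by (intro integrable_deviation[OF prob_space_axioms]; measurable)+
  have dev: "expectation (\<lambda>p. \<bar>count_upto k L (fst p) / L - \<rho>\<bar>) = deviation k \<rho> L (distr Q (config_space n) fst)"
    "expectation (\<lambda>p. \<bar>count_upto k L (snd p) / L - \<rho>\<bar>) = deviation k \<rho> L (distr Q (config_space n) snd)"
    unfolding deviation_def by (subst integral_distr; simp)+
  have pw: "(\<Sum>x<L. of_bool (disc k (fst p (int x)) (snd p (int x)))) / L \<le>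
    \<bar>count_upto k L (fst p) / L - \<rho>\<bar> + \<bar>count_upto k L (snd p) / L - \<rho>\<bar>
    + (\<Sum>(i, j)\<in>pairs_below L. of_bool (opposite k (int i) (int j) p))" for p
  proof -
    have "(\<Sum>x<L. of_bool (disc k (fst p (int x)) (snd p (int x)))) / L \<le>
      (\<bar>count_upto k L (fst p) - count_upto k L (snd p)\<bar> + real L * (\<Sum>(i, j)\<in>pairs_below L. of_bool (opposite k (int i) (int j) p))) / L"
      using count_disc_le[where L = L and k = k and \<eta> = "fst p" and \<xi> = "snd p"] by (intro divide_right_mono) simp_all
    also have "\<dots> = \<bar>count_upto k L (fst p) / L - count_upto k L (snd p) / L\<bar> + (\<Sum>(i, j)\<in>pairs_below L. of_bool (opposite k (int i) (int j) p))"
      using L by (simp add: add_divide_distrib diff_divide_distrib[symmetric])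
    finally show ?thesis by linarith
  qed
  have "\<P>(p in Q. disc k (fst p 0) (snd p 0)) =
    expectation (\<lambda>p. (\<Sum>x<L. of_bool (disc k (fst p (int x)) (snd p (int x)))) / L)"
  proof -
    have "expectation (\<lambda>p. (\<Sum>x<L. of_bool (disc k (fst p (int x)) (snd p (int x)))) / L) =
      (\<Sum>x<L. \<P>(p in Q. disc k (fst p (int x)) (snd p (int x)))) / L"
      by (simp add: E del: sum_of_bool_eq)
    also have "\<dots> = (\<Sum>x<L. \<P>(p in Q. disc k (fst p 0) (snd p 0))) / L"
      by (intro arg_cong2[where f = "(/)"] sum.cong refl prob_disc_shift)
    finally show ?thesis using L by simp
  qed
  also have "\<dots> \<le> expectation (\<lambda>p. \<bar>count_upto k L (fst p) / L - \<rho>\<bar> + \<bar>count_upto k L (snd p) / L - \<rho>\<bar>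
    + (\<Sum>(i, j)\<in>pairs_below L. of_bool (opposite k (int i) (int j) p)))"
    using pw int
    by (intro integral_mono) (auto simp: E case_prod_beta' simp del: sum_of_bool_eq intro!: Bochner_Integration.integrable_add Bochner_Integration.integrable_sum)
  also have "\<dots> = deviation k \<rho> L (distr Q (config_space n) fst) + deviation k \<rho> L (distr Q (config_space n) snd)
    + (\<Sum>(i, j)\<in>pairs_below L. \<P>(p in Q. opposite k (int i) (int j) p))"
    using int by (simp add: E case_prod_beta' dev)
  also have "(\<Sum>(i, j)\<in>pairs_below L. \<P>(p in Q. opposite k (int i) (int j) p)) \<le>
    (\<Sum>(i, j)\<in>pairs_below L. ?A / measure (row_noise b1 b2) {w. pattern (int i) (int j) w})"
    by (intro sum_mono) (auto simp: pairs_below_def intro!: prob_opposite_le)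
  also have "\<dots> = window_const b1 b2 L * ?A"
    by (simp add: window_const_def sum_distrib_right case_prod_beta')
  finally show ?thesis by simp
qed

end

subsection \<open>Discrepancies die out\<close>

lemma (in measure_preserving) measure_preserving_distr:
  assumes [measurable]: "f \<in> M \<rightarrow>\<^sub>M N" "S \<in> N \<rightarrow>\<^sub>M N"
    and eq: "\<And>\<omega>. \<omega> \<in> space M \<Longrightarrow> S (f \<omega>) = f (T \<omega>)"
  shows "measure_preserving (distr M N f) S"
proof -
  interpret D: prob_space "distr M N f" by (rule prob_space_distr) measurable
  have "distr (distr M N f) (distr M N f) S = distr (distr M N f) N S" by (intro distr_cong) auto
  also have "\<dots> = distr M N (\<lambda>\<omega>. S (f \<omega>))" by (subst distr_distr) (auto simp: comp_def)
  also have "\<dots> = distr M N (\<lambda>\<omega>. f (T \<omega>))" by (intro distr_cong) (auto simp: eq)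
  also have "\<dots> = distr (distr M M T) N f" by (subst distr_distr) (auto simp: comp_def)
  finally show ?thesis by unfold_locales (auto simp: distr_T)
qed

lemma (in measure_preserving) ergodic_distr:
  assumes erg: ergodic and [measurable]: "f \<in> M \<rightarrow>\<^sub>M N" "S \<in> N \<rightarrow>\<^sub>M N"
    and eq: "\<And>\<omega>. \<omega> \<in> space M \<Longrightarrow> S (f \<omega>) = f (T \<omega>)"
  shows "measure_preserving.ergodic (distr M N f) S"
proof -
  interpret D: measure_preserving "distr M N f" S
    by (rule measure_preserving_distr) (use eq in auto)
  show ?thesis unfolding D.ergodic_def
  proof (intro ballI impI)
    fix A assume "A \<in> D.events" and inv: "S -` A \<inter> space (distr M N f) = A"
    then have [measurable]: "A \<in> sets N" by simp
    have "T -` (f -` A \<inter> space M) \<inter> space M = f -` A \<inter> space M"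
    proof -
      have "f (T \<omega>) \<in> A \<longleftrightarrow> f \<omega> \<in> A" "T \<omega> \<in> space M" if "\<omega> \<in> space M" for \<omega>
        using inv measurable_space[of f M N \<omega>] measurable_space[OF T_measurable that] that
        by (auto simp: eq[symmetric])
      then show ?thesis by auto
    qed
    then have "prob (f -` A \<inter> space M) = 0 \<or> prob (f -` A \<inter> space M) = 1"
      using erg unfolding ergodic_def by (metis \<open>A \<in> sets N\<close> assms(2) measurable_sets)
    then show "D.prob A = 0 \<or> D.prob A = 1" by (simp add: measure_distr)
  qed
qed

lemma (in coupled_row) coupled_row_step: "coupled_row (step_pair n b1 b2 Q) n b1 b2"
proof -
  have "measure_preserving (step_pair n b1 b2 Q) shift_pair"
    unfolding step_pair_def
    by (rule J.measure_preserving_distr)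
      (measurable, auto simp: shift_pair_def row_pair_def row_shift)
  then show ?thesis using b by (simp add: coupled_row_def coupled_row_axioms_def)
qed

lemma (in coupled_row) prob_step_disc:
  "measure (step_pair n b1 b2 Q) {p \<in> space (step_pair n b1 b2 Q). disc k (fst p 0) (snd p 0)} =
   \<P>(p in Q. disc k (fst p 0) (snd p 0)) - 2 * \<P>(\<omega> in joint. ann 0 \<omega>)"
proof -
  have [measurable]: "Measurable.pred (pair_space n) (\<lambda>p. disc k (fst p 0) (snd p 0))"
    unfolding disc_def by measurable
  have [measurable]: "(\<lambda>(p, w). row_pair w p) \<in> joint \<rightarrow>\<^sub>M pair_space n" by measurable
  have sp: "row_pair w p \<in> space (pair_space n)" if "(p, w) \<in> space joint" for p w
    using measurable_space[of "\<lambda>(p, w). row_pair w p" joint "pair_space n" "(p, w)"] that by simp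
  have "(\<lambda>(p, w). row_pair w p) -` {p \<in> space (pair_space n). disc k (fst p 0) (snd p 0)} \<inter> space joint
    = {\<omega> \<in> space joint. top 0 \<omega>}"
    using sp by (auto simp: top_def row_pair_def)
  then show ?thesis
    unfolding step_pair_def using prob_top by (simp add: measure_distr prob_bot)
qed

definition prob_disc :: "nat \<Rightarrow> ((int \<Rightarrow> nat) \<times> (int \<Rightarrow> nat)) measure \<Rightarrow> real" where
  "prob_disc k Q = measure Q {p \<in> space Q. disc k (fst p 0) (snd p 0)}"

text \<open>While D exceeds \<epsilon>, the bound gives C * A t at least \<epsilon> / 2, so C * D
  drops by at least \<epsilon> in each step. Since D starts at most at 1, this cannot last for T
  steps when T * \<epsilon> > C. Multiplying by C instead of dividing includes C = 0.\<close>

lemma decreasing_bound: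
  fixes D A :: "nat \<Rightarrow> real"
  assumes D: "\<And>t. D (Suc t) = D t - 2 * A t" "\<And>t. 0 \<le> D t" "D 0 \<le> 1" and A: "\<And>t. 0 \<le> A t"
    and le: "\<And>t. D t \<le> \<epsilon> / 2 + C * A t" and C: "0 \<le> C" and e: "0 < \<epsilon>" and T: "C < T * \<epsilon>"
  shows "D T \<le> \<epsilon>"
proof (rule ccontr)
  assume "\<not> D T \<le> \<epsilon>"
  have "D (Suc t) \<le> D t" for t using D(1)[of t] A[of t] by linarith
  then have "antimono D" by (rule decseq_SucI)
  then have "D t > \<epsilon>" if "t \<le> T" for t using antimonoD[OF \<open>antimono D\<close> that] \<open>\<not> D T \<le> \<epsilon>\<close> by linarith
  then have CA: "C * A t \<ge> \<epsilon> / 2" if "t \<le> T" for t 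
  proof -
    have "D t > \<epsilon>" using that by fact
    then show ?thesis using le[of t] by linarith
  qed
  have "D T = D 0 - 2 * (\<Sum>t<T. A t)" by (induction T) (auto simp: D(1) algebra_simps)
  then have "2 * (\<Sum>t<T. A t) \<le> 1" using D(2)[of T] D(3) by linarith
  then have "C * (2 * (\<Sum>t<T. A t)) \<le> C * 1" using C by (rule mult_left_mono)
  moreover have "C * (2 * (\<Sum>t<T. A t)) = 2 * (\<Sum>t<T. C * A t)" by (simp add: sum_distrib_left mult_ac)
  moreover have "(\<Sum>t<T. C * A t) \<ge> (\<Sum>t<T. \<epsilon> / 2)" using CA by (intro sum_mono) simp
  ultimately show False using T by simp
qed

text \<open>The order of the quantifiers matters: e and \<epsilon> determine the window length L, L
  determines the constant C, and T0 exceeds C / \<epsilon>. All this precedes the choice of Q, so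
  one T0 serves all couplings whose marginals satisfy the bound e at all times.\<close>

theorem coupling_decay:
  assumes b: "0 < b1" "b1 < 1" "0 < b2" "b2 < 1" and e: "e \<longlonglongrightarrow> 0" and \<epsilon>: "0 < \<epsilon>"
  shows "\<exists>T0. \<forall>T\<ge>T0. \<forall>Q. measure_preserving Q shift_pair \<longrightarrow> sets Q = sets (pair_space n) \<longrightarrow>
    (\<forall>t L. deviation k \<rho> L ((step n b1 b2 ^^ t) (distr Q (config_space n) fst)) \<le> e L \<and>
       deviation k \<rho> L ((step n b1 b2 ^^ t) (distr Q (config_space n) snd)) \<le> e L) \<longrightarrow>
    prob_disc k ((step_pair n b1 b2 ^^ T) Q) \<le> \<epsilon>"
proof -
  \<comment> \<open>A quarter for each of the two marginals leaves the \<epsilon> / 2 of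
    \<open>decreasing_bound\<close>.\<close>
  have "eventually (\<lambda>L. e L < \<epsilon> / 4 \<and> L > 0) sequentially"
    using order_tendstoD(2)[OF e, of "\<epsilon> / 4"] \<epsilon> by (intro eventually_conj eventually_gt_at_top) auto
  then obtain L where L: "e L < \<epsilon> / 4" "L > 0" by (auto simp: eventually_sequentially)
  define C where "C = window_const b1 b2 L"
  have C: "0 \<le> C" unfolding C_def window_const_def by (auto intro!: sum_nonneg)
  obtain T0 :: nat where T0: "C / \<epsilon> < T0" using reals_Archimedean2 by blast
  show ?thesis
  proof (intro exI[of _ T0] allI impI)
    fix T Q assume T: "T0 \<le> T" and Q: "measure_preserving Q shift_pair" "sets Q = sets (pair_space n)"
      and dev: "\<forall>t L. deviation k \<rho> L ((step n b1 b2 ^^ t) (distr Q (config_space n) fst)) \<le> e L \<and>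
       deviation k \<rho> L ((step n b1 b2 ^^ t) (distr Q (config_space n) snd)) \<le> e L"
    define Qt where "Qt t = (step_pair n b1 b2 ^^ t) Q" for t
    have coup: "coupled_row (Qt t) n b1 b2" for t
    proof (induction t)
      case 0 then show ?case using Q b by (simp add: Qt_def coupled_row_def coupled_row_axioms_def)
    next
      case (Suc t) then show ?case by (simp add: Qt_def coupled_row.coupled_row_step)
    qed
    define A where "A t = measure (Qt t \<Otimes>\<^sub>M row_noise b1 b2)
      {\<omega> \<in> space (Qt t \<Otimes>\<^sub>M row_noise b1 b2). coupled_row.ann k 0 \<omega>}" for t
    have pQ: "prob_space Q" using Q(1) by (simp add: measure_preserving_def)
    have "prob_disc k (Qt T) \<le> \<epsilon>"
    proof (rule decreasing_bound[where A = A and C = C])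
      show "prob_disc k (Qt (Suc t)) = prob_disc k (Qt t) - 2 * A t" for t
        using coupled_row.prob_step_disc[OF coup, of t k] by (simp add: prob_disc_def A_def Qt_def)
      interpret Q: prob_space Q by fact
      show "prob_disc k (Qt 0) \<le> 1" by (simp add: prob_disc_def Qt_def)
      show "prob_disc k (Qt t) \<le> \<epsilon> / 2 + C * A t" for t
      proof -
        have "distr (Qt t) (config_space n) fst = (step n b1 b2 ^^ t) (distr Q (config_space n) fst)"
          "distr (Qt t) (config_space n) snd = (step n b1 b2 ^^ t) (distr Q (config_space n) snd)"
          using distr_step_pair_pow[OF pQ Q(2), of fst] distr_step_pair_pow[OF pQ Q(2), of snd] by (auto simp: Qt_def)
        then have "deviation k \<rho> L (distr (Qt t) (config_space n) fst) \<le> e L"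
          "deviation k \<rho> L (distr (Qt t) (config_space n) snd) \<le> e L"
          using dev by auto
        then show ?thesis
          using coupled_row.prob_disc_le[OF coup L(2), of t k \<rho>] L(1)
          by (simp add: prob_disc_def C_def A_def)
      qed
      have "C < T0 * \<epsilon>" using T0 \<epsilon> by (simp add: field_simps)
      also have "\<dots> \<le> T * \<epsilon>" using T \<epsilon> by (intro mult_right_mono) auto
      finally show "C < T * \<epsilon>" .
    qed (use C \<epsilon> in \<open>auto simp: prob_disc_def A_def\<close>)
    then show "prob_disc k ((step_pair n b1 b2 ^^ T) Q) \<le> \<epsilon>" by (simp add: Qt_def)
  qed
qed

subsection \<open>Comparison of laws through couplings\<close>

definition cylinder :: "nat \<Rightarrow> int set \<Rightarrow> (int \<Rightarrow> nat set) \<Rightarrow> (int \<Rightarrow> nat) set" where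
  "cylinder n J X = {\<eta> \<in> space (config_space n). \<forall>x\<in>J. \<eta> x \<in> X x}"

lemma measurable_cylinder [measurable]: "finite J \<Longrightarrow> cylinder n J X \<in> sets (config_space n)"
proof -
  assume "finite J"
  have [measurable]: "(\<lambda>\<eta>. \<eta> x) \<in> config_space n \<rightarrow>\<^sub>M count_space UNIV" for x
    by (rule measurable_config_component[OF measurable_ident_sets[OF refl]])
  show ?thesis unfolding cylinder_def using \<open>finite J\<close> by measurable
qed

lemma config_measure_eqI:
  assumes "prob_space \<mu>" "prob_space \<nu>" and sets: "sets \<mu> = sets (config_space n)" "sets \<nu> = sets (config_space n)"
    and eq: "\<And>J X. finite J \<Longrightarrow> measure \<mu> (cylinder n J X) = measure \<nu> (cylinder n J X)"
  shows "\<mu> = \<nu>"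
proof (rule measure_eqI_PiM_infinite[where I = UNIV and M = "\<lambda>_. count_space {0..n}"])
  interpret \<mu>: prob_space \<mu> by fact
  interpret \<nu>: prob_space \<nu> by fact
  show "finite_measure \<mu>" by unfold_locales
  fix A :: "int \<Rightarrow> nat set" and J assume J: "finite J" "\<And>i. i \<in> J \<Longrightarrow> A i \<in> sets (count_space {0..n})"
  have "prod_emb UNIV (\<lambda>_. count_space {0..n}) J (Pi\<^sub>E J A) = cylinder n J A"
    using J by (auto simp: prod_emb_def cylinder_def config_space_def space_PiM PiE_iff)
  then show "emeasure \<mu> (prod_emb UNIV (\<lambda>_. count_space {0..n}) J (Pi\<^sub>E J A)) =
    emeasure \<nu> (prod_emb UNIV (\<lambda>_. count_space {0..n}) J (Pi\<^sub>E J A))"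
    using eq[OF J(1)] by (simp add: \<mu>.emeasure_eq_measure \<nu>.emeasure_eq_measure)
qed (use sets in \<open>auto simp: config_space_def\<close>)

text \<open>The coupling inequality: the two events can differ only where the configurations differ
  at some site of J.\<close>

lemma (in prob_space) coupling_cylinder:
  assumes f [measurable]: "f \<in> M \<rightarrow>\<^sub>M config_space n" and g [measurable]: "g \<in> M \<rightarrow>\<^sub>M config_space n" and J: "finite J"
  shows "\<bar>measure (distr M (config_space n) f) (cylinder n J X) - measure (distr M (config_space n) g) (cylinder n J X)\<bar>
    \<le> (\<Sum>x\<in>J. prob {\<omega> \<in> space M. f \<omega> x \<noteq> g \<omega> x})"
proof -
  have [measurable]: "{\<omega> \<in> space M. f \<omega> x \<noteq> g \<omega> x} \<in> events" for x by measurable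
  define E where "E = (\<Union>x\<in>J. {\<omega> \<in> space M. f \<omega> x \<noteq> g \<omega> x})"
  have [measurable]: "E \<in> events" using J unfolding E_def by measurable
  have E: "prob E \<le> (\<Sum>x\<in>J. prob {\<omega> \<in> space M. f \<omega> x \<noteq> g \<omega> x})"
    unfolding E_def using J by (intro measure_UNION_le) auto
  have le: "measure (distr M (config_space n) u) (cylinder n J X) \<le> measure (distr M (config_space n) v) (cylinder n J X) + prob E"
    if uv: "u = f \<and> v = g \<or> u = g \<and> v = f" for u v
  proof -
    have [measurable]: "u \<in> M \<rightarrow>\<^sub>M config_space n" "v \<in> M \<rightarrow>\<^sub>M config_space n" using uv by auto
    note [measurable] = measurable_cylinder[OF J]
    have "prob (u -` cylinder n J X \<inter> space M) \<le> prob ((v -` cylinder n J X \<inter> space M) \<union> E)"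
      using uv measurable_space[OF f] measurable_space[OF g]
      by (intro finite_measure_mono) (auto simp: E_def cylinder_def)
    also have "\<dots> \<le> prob (v -` cylinder n J X \<inter> space M) + prob E"
      by (rule measure_Un_le) measurable
    finally show ?thesis using J by (simp add: measure_distr)
  qed
  from le[of f g] le[of g f] E show ?thesis by (simp add: abs_le_iff)
qed

lemma neq_imp_disc: "a \<le> n \<Longrightarrow> a' \<le> n \<Longrightarrow> a \<noteq> a' \<Longrightarrow> \<exists>k<n. disc k a a'"
  by (rule exI[of _ "min a a'"]) (auto simp: disc_def min_def)

text \<open>Different classes at a site are a discrepancy for at least one of the n thresholds, and
  each of these has the same probability at all sites.\<close>

lemma prob_neq_le:
  assumes Q: "measure_preserving Q shift_pair" and [measurable_cong]: "sets Q = sets (pair_space n)"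
  shows "measure Q {p \<in> space Q. fst p x \<noteq> snd p x} \<le> (\<Sum>k<n. prob_disc k Q)"
proof -
  interpret measure_preserving Q shift_pair by fact
  have [measurable]: "{p \<in> space Q. disc k (fst p x) (snd p x)} \<in> events" for k x
    unfolding disc_def by measurable
  have shift: "\<P>(p in Q. disc k (fst p x) (snd p x)) = prob_disc k Q" for k
  proof -
    have 1: "\<P>(p in Q. disc k (fst p (x + 1)) (snd p (x + 1))) = \<P>(p in Q. disc k (fst p x) (snd p x))" for x
    proof -
      have "{p \<in> space Q. disc k (fst p (x + 1)) (snd p (x + 1))} = shift_pair -` {p \<in> space Q. disc k (fst p x) (snd p x)} \<inter> space Q"
        using measurable_space[OF T_measurable] by (auto simp: shift_pair_def translate_def)
      then show ?thesis using measure_vimage_funpow[of "{p \<in> space Q. disc k (fst p x) (snd p x)}" 1] by simp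
    qed
    show ?thesis
    proof (induction x rule: int_induct[where k = 0])
      case (step2 i) then show ?case using 1[of "i - 1"] by simp
    qed (simp_all add: 1 prob_disc_def)
  qed
  have "space Q = space (pair_space n)" by (rule sets_eq_imp_space_eq) fact
  then have "{p \<in> space Q. fst p x \<noteq> snd p x} \<subseteq> (\<Union>k<n. {p \<in> space Q. disc k (fst p x) (snd p x)})"
    using neq_imp_disc by (fastforce simp: pair_space_def space_pair_measure space_config_space)
  then have "\<P>(p in Q. fst p x \<noteq> snd p x) \<le> prob (\<Union>k<n. {p \<in> space Q. disc k (fst p x) (snd p x)})"
    by (intro finite_measure_mono) auto
  also have "\<dots> \<le> (\<Sum>k<n. \<P>(p in Q. disc k (fst p x) (snd p x)))"
    by (intro measure_UNION_le) auto
  finally show ?thesis by (simp add: shift)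
qed

subsection \<open>Uniqueness\<close>

lemma count_upto_visits: "count_upto k L \<eta> = visits (translate 1) {\<eta>. \<eta> 0 \<le> k} L \<eta>"
proof -
  have "(translate 1 ^^ i) \<eta> = translate (int i) \<eta>" for i
    by (induction i) (auto simp: translate_def ac_simps)
  then show ?thesis
    by (simp add: count_upto_def visits_def indicator_def translate_def of_bool_def)
qed

lemma deviation_tendsto_0:
  assumes \<mu>: "measure_preserving \<mu> (translate 1)" "measure_preserving.ergodic \<mu> (translate 1)"
    and sets [measurable_cong]: "sets \<mu> = sets (config_space n)"
  shows "(\<lambda>L. deviation k (measure \<mu> {\<eta> \<in> space \<mu>. \<eta> 0 \<le> k}) L \<mu>) \<longlonglongrightarrow> 0"
proof -
  interpret measure_preserving \<mu> "translate 1" by fact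
  have vis: "visits (translate 1) {\<eta> \<in> space \<mu>. \<eta> 0 \<le> k} L \<eta> = count_upto k L \<eta>" if "\<eta> \<in> space \<mu>" for L \<eta>
    unfolding count_upto_visits visits_def
    using measurable_space[OF funpow_measurable that] by (intro sum.cong) (auto simp: indicator_def)
  have [measurable]: "{\<eta> \<in> space \<mu>. \<eta> 0 \<le> k} \<in> events" by measurable
  from mean_ergodic[OF \<mu>(2) this] show ?thesis
    unfolding deviation_def by (simp add: vis cong: Bochner_Integration.integral_cong)
qed

text \<open>The coupling starts from the product measure. By stationarity its marginals stay \<mu>
  and \<nu> for ever, so the fluctuation bound holds at all times and the discrepancies die out
  between two fixed laws.\<close>

theorem stationary_unique:
  assumes b: "0 < b1" "b1 < 1" "0 < b2" "b2 < 1"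
    and \<mu>: "measure_preserving \<mu> (translate 1)" "measure_preserving.ergodic \<mu> (translate 1)" "sets \<mu> = sets (config_space n)" "step n b1 b2 \<mu> = \<mu>"
    and \<nu>: "measure_preserving \<nu> (translate 1)" "measure_preserving.ergodic \<nu> (translate 1)" "sets \<nu> = sets (config_space n)" "step n b1 b2 \<nu> = \<nu>"
    and dens: "\<And>k. measure \<mu> {\<eta> \<in> space \<mu>. \<eta> 0 \<le> k} = measure \<nu> {\<eta> \<in> space \<nu>. \<eta> 0 \<le> k}"
  shows "\<mu> = \<nu>"
proof -
  interpret \<mu>: measure_preserving \<mu> "translate 1" by fact
  interpret \<nu>: measure_preserving \<nu> "translate 1" by fact
  interpret P: pair_prob_space \<mu> \<nu> ..
  define Q where "Q = \<mu> \<Otimes>\<^sub>M \<nu>"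
  have Q: "measure_preserving Q shift_pair"
    using measure_preserving_pair[OF \<mu>(1) \<nu>(1)] by (simp add: Q_def shift_pair_def[abs_def] case_prod_beta')
  have sets_Q: "sets Q = sets (pair_space n)"
    unfolding Q_def pair_space_def using \<mu>(3) \<nu>(3) by (rule sets_pair_measure_cong)
  have pQ: "prob_space Q" using Q by (simp add: measure_preserving_def)
  have fstQ: "distr Q (config_space n) fst = \<mu>"
    unfolding Q_def using \<nu>.distr_pair_fst[of \<mu>] \<mu>(3) by (metis distr_cong)
  have sndQ: "distr Q (config_space n) snd = \<nu>"
  proof (rule measure_eqI)
    fix A assume "A \<in> sets (distr Q (config_space n) snd)"
    then have A: "A \<in> sets \<nu>" by (simp add: \<nu>(3))
    have "snd \<in> Q \<rightarrow>\<^sub>M config_space n"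
      using measurable_snd[of \<mu> \<nu>] \<nu>(3) unfolding Q_def by (simp cong: measurable_cong_sets)
    then have "emeasure (distr Q (config_space n) snd) A = emeasure Q (snd -` A \<inter> space Q)"
      using A by (intro emeasure_distr) (simp_all add: \<nu>(3))
    also have "snd -` A \<inter> space Q = space \<mu> \<times> A"
      using sets.sets_into_space[OF A] by (auto simp: Q_def space_pair_measure)
    also have "emeasure Q (space \<mu> \<times> A) = emeasure \<nu> A"
      using A by (simp add: Q_def \<nu>.emeasure_pair_measure_Times \<mu>.emeasure_space_1)
    finally show "emeasure (distr Q (config_space n) snd) A = emeasure \<nu> A" .
  qed (simp add: \<nu>(3))
  have pow: "(step n b1 b2 ^^ t) \<mu> = \<mu>" "(step n b1 b2 ^^ t) \<nu> = \<nu>" for t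
    by (induction t) (simp_all add: \<mu>(4) \<nu>(4))
  define Qt where "Qt t = (step_pair n b1 b2 ^^ t) Q" for t
  have coup: "coupled_row (Qt t) n b1 b2" for t
  proof (induction t)
    case 0 then show ?case using Q sets_Q b by (simp add: Qt_def coupled_row_def coupled_row_axioms_def)
  next
    case (Suc t) then show ?case by (simp add: Qt_def coupled_row.coupled_row_step)
  qed
  have lim: "(\<lambda>t. prob_disc k (Qt t)) \<longlonglongrightarrow> 0" for k
  proof (rule LIMSEQ_I)
    fix r :: real assume "r > 0"
    define \<rho> where "\<rho> = measure \<mu> {\<eta> \<in> space \<mu>. \<eta> 0 \<le> k}"
    \<comment> \<open>Both deviations are nonnegative, so their sum bounds each of them.\<close>
    define e where "e L = deviation k \<rho> L \<mu> + deviation k \<rho> L \<nu>" for L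
    have "e \<longlonglongrightarrow> 0 + 0"
      unfolding e_def[abs_def] using deviation_tendsto_0[OF \<mu>(1-3), of k] deviation_tendsto_0[OF \<nu>(1-3), of k] dens[of k]
      by (intro tendsto_add) (simp_all add: \<rho>_def)
    then have "e \<longlonglongrightarrow> 0" by simp
    moreover have dev_nonneg: "0 \<le> deviation k \<rho> L m" for L m by (simp add: deviation_def)
    moreover have dev: "\<forall>t L. deviation k \<rho> L ((step n b1 b2 ^^ t) (distr Q (config_space n) fst)) \<le> e L \<and>
       deviation k \<rho> L ((step n b1 b2 ^^ t) (distr Q (config_space n) snd)) \<le> e L"
      by (simp add: fstQ sndQ pow e_def dev_nonneg)
    ultimately have "\<exists>T0. \<forall>T\<ge>T0. prob_disc k (Qt T) \<le> r / 2"
      using coupling_decay[OF b, of e "r / 2" n k \<rho>] \<open>r > 0\<close> Q sets_Q dev unfolding Qt_def by (meson half_gt_zero)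
    then obtain T0 where "\<forall>T\<ge>T0. prob_disc k (Qt T) \<le> r / 2" by blast
    then have "norm (prob_disc k (Qt T) - 0) < r" if "T \<ge> T0" for T
      using that \<open>r > 0\<close> by (auto simp: prob_disc_def intro: le_less_trans)
    then show "\<exists>T0. \<forall>T\<ge>T0. norm (prob_disc k (Qt T) - 0) < r" by blast
  qed
  show ?thesis
  proof (rule config_measure_eqI)
    fix J :: "int set" and X assume J: "finite J"
    have "\<bar>measure \<mu> (cylinder n J X) - measure \<nu> (cylinder n J X)\<bar> \<le> real (card J) * (\<Sum>k<n. prob_disc k (Qt t))" for t
    proof -
      interpret C: coupled_row "Qt t" n b1 b2 by (rule coup)
      have D: "distr (Qt t) (config_space n) fst = \<mu>" "distr (Qt t) (config_space n) snd = \<nu>"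
        using distr_step_pair_pow[OF pQ sets_Q, of fst] distr_step_pair_pow[OF pQ sets_Q, of snd]
        by (auto simp: Qt_def fstQ sndQ pow)
      have "\<bar>measure (distr (Qt t) (config_space n) fst) (cylinder n J X) - measure (distr (Qt t) (config_space n) snd) (cylinder n J X)\<bar>
        \<le> (\<Sum>x\<in>J. C.prob {p \<in> space (Qt t). fst p x \<noteq> snd p x})"
        using J by (intro C.coupling_cylinder) (measurable; fail)+
      also have "\<dots> \<le> (\<Sum>x\<in>J. \<Sum>k<n. prob_disc k (Qt t))"
        by (intro sum_mono prob_neq_le C.measure_preserving_axioms C.sets_Q)
      finally show ?thesis by (simp add: D)
    qed
    moreover have "(\<lambda>t. real (card J) * (\<Sum>k<n. prob_disc k (Qt t))) \<longlonglongrightarrow> real (card J) * (\<Sum>k<n. 0)"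
      by (intro tendsto_intros lim)
    ultimately have "\<bar>measure \<mu> (cylinder n J X) - measure \<nu> (cylinder n J X)\<bar> \<le> 0"
      by (intro LIMSEQ_le_const[of _ 0]) auto
    then show "measure \<mu> (cylinder n J X) = measure \<nu> (cylinder n J X)" by simp
  qed (use \<mu> \<nu> in \<open>auto simp: \<mu>.prob_space_axioms \<nu>.prob_space_axioms\<close>)
qed

section \<open>Product measures and stationarity of one-species Bernoulli measures\<close>

definition site :: "nat \<Rightarrow> (nat \<Rightarrow> real) \<Rightarrow> nat measure" where
  "site n lam = point_measure {0..n} (\<lambda>k. ennreal (lam k))"

definition iid :: "nat \<Rightarrow> (nat \<Rightarrow> real) \<Rightarrow> (int \<Rightarrow> nat) measure" where
  "iid n lam = PiM UNIV (\<lambda>_. site n lam)"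

definition prob_weights :: "nat \<Rightarrow> (nat \<Rightarrow> real) \<Rightarrow> bool" where
  "prob_weights n lam \<longleftrightarrow> (\<forall>k\<le>n. 0 \<le> lam k) \<and> (\<Sum>k\<le>n. lam k) = 1"

lemma sets_site [measurable_cong, simp]: "sets (site n lam) = sets (count_space {0..n})"
  by (simp add: site_def sets_point_measure)

lemma space_site [simp]: "space (site n lam) = {0..n}"
  by (simp add: site_def space_point_measure)

lemma sets_iid [measurable_cong]: "sets (iid n lam) = sets (config_space n)"
  unfolding iid_def config_space_def by (rule sets_PiM_cong) auto

lemma emeasure_site:
  assumes "prob_weights n lam"
  shows "emeasure (site n lam) (A \<inter> {0..n}) = ennreal (\<Sum>k\<in>A \<inter> {0..n}. lam k)"
proof -
  have "emeasure (site n lam) (A \<inter> {0..n}) = (\<Sum>k\<in>A \<inter> {0..n}. ennreal (lam k))"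
    unfolding site_def by (rule emeasure_point_measure_finite) auto
  also have "\<dots> = ennreal (\<Sum>k\<in>A \<inter> {0..n}. lam k)"
    using assms by (intro sum_ennreal) (auto simp: prob_weights_def)
  finally show ?thesis .
qed

lemma measure_site:
  assumes "prob_weights n lam"
  shows "measure (site n lam) (A \<inter> {0..n}) = (\<Sum>k\<in>A \<inter> {0..n}. lam k)"
  using assms by (auto simp: measure_def emeasure_site prob_weights_def intro!: enn2real_ennreal sum_nonneg)

lemma prob_space_site: "prob_weights n lam \<Longrightarrow> prob_space (site n lam)"
  using emeasure_site[of n lam UNIV]
  by (intro prob_spaceI) (simp add: prob_weights_def atMost_atLeast0)

lemma prob_space_iid: "prob_weights n lam \<Longrightarrow> prob_space (iid n lam)"
  unfolding iid_def by (intro prob_space_PiM prob_space_site)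

lemma measure_iid_cylinder:
  assumes lam: "prob_weights n lam" and J: "finite J"
  shows "measure (iid n lam) (cylinder n J X) = (\<Prod>x\<in>J. \<Sum>k\<in>X x \<inter> {0..n}. lam k)"
proof -
  interpret PP: product_prob_space "\<lambda>_ :: int. site n lam" UNIV
    using prob_space_site[OF lam]
    by (simp add: product_prob_space_def product_prob_space_axioms_def product_sigma_finite_def prob_space_imp_sigma_finite)
  have "cylinder n J X = PP.emb UNIV J (\<Pi>\<^sub>E x\<in>J. X x \<inter> {0..n})"
    by (auto simp: cylinder_def space_config_space prod_emb_def PiE_iff)
  then show ?thesis
    using J by (simp add: iid_def PP.measure_PiM_emb measure_site[OF lam])
qed

lemma measure_preserving_iid: "prob_weights n lam \<Longrightarrow> measure_preserving (iid n lam) (translate 1)"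
  and mixing_iid: "prob_weights n lam \<Longrightarrow> measure_preserving.mixing (iid n lam) (translate 1)"
proof -
  assume lam: "prob_weights n lam"
  have tr: "translate 1 = (\<lambda>\<eta> x. \<eta> (x + 1))" by (simp add: translate_def fun_eq_iff)
  have pow: "((\<lambda>x::int. x + 1) ^^ m) x = x + int m" for m x by (induction m) auto
  show "measure_preserving (iid n lam) (translate 1)"
    unfolding iid_def tr using prob_space_site[OF lam] by (intro measure_preserving_PiM) auto
  show "measure_preserving.mixing (iid n lam) (translate 1)"
    unfolding iid_def tr
  proof (rule mixing_PiM)
    fix J K :: "int set" assume "finite J" "finite K"
    then obtain a b where ab: "\<forall>x\<in>J. x \<le> a" "\<forall>x\<in>K. b \<le> x"
      by (meson bdd_above.unfold bdd_above_finite bdd_below.unfold bdd_below_finite)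
    have "J \<inter> ((\<lambda>x. x + 1) ^^ m) ` K = {}" if "m \<ge> nat (a - b + 1)" for m
      using ab that by (force simp: pow)
    then show "\<forall>\<^sub>F m in sequentially. J \<inter> ((\<lambda>x. x + 1) ^^ m) ` K = {}"
      by (auto simp: eventually_sequentially)
  qed (use prob_space_site[OF lam] in auto)
qed

text \<open>Intervals suit the left-to-right computation of a row: the sites of an output cylinder
  can be added one after another.\<close>

lemma config_measure_eqI_intervals:
  assumes "prob_space \<mu>" "prob_space \<nu>" "sets \<mu> = sets (config_space n)" "sets \<nu> = sets (config_space n)"
    and eq: "\<And>y m X. measure \<mu> (cylinder n ((\<lambda>i. y + int i) ` {..<m}) X) = measure \<nu> (cylinder n ((\<lambda>i. y + int i) ` {..<m}) X)"
  shows "\<mu> = \<nu>"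
proof (rule config_measure_eqI[OF assms(1-4)])
  fix J :: "int set" and X :: "int \<Rightarrow> nat set" assume "finite J"
  then obtain a b where ab: "\<forall>x\<in>J. a \<le> x" "\<forall>x\<in>J. x \<le> b"
    by (meson bdd_above.unfold bdd_above_finite bdd_below.unfold bdd_below_finite)
  \<comment> \<open>The gaps of J inside the interval receive no constraint.\<close>
  define Y where "Y x = (if x \<in> J then X x else UNIV)" for x
  define K where "K = (\<lambda>i. a + int i) ` {..<nat (b - a + 1)}"
  have "J \<subseteq> K"
  proof
    fix x assume "x \<in> J"
    then have "x = a + int (nat (x - a))" "nat (x - a) < nat (b - a + 1)"
      using bspec[OF ab(1) \<open>x \<in> J\<close>] bspec[OF ab(2) \<open>x \<in> J\<close>] by auto
    then show "x \<in> K" unfolding K_def by blast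
  qed
  then have "cylinder n J X = cylinder n K Y" by (auto simp: cylinder_def Y_def)
  then show "measure \<mu> (cylinder n J X) = measure \<nu> (cylinder n J X)"
    using eq[where y = a] by (simp add: K_def)
qed

section \<open>A Burke argument for particles and holes\<close>

definition two_weights :: "real \<Rightarrow> nat \<Rightarrow> real" where
  "two_weights \<rho> k = (if k = 0 then \<rho> else 1 - \<rho>)"

lemma prob_weights_two: "0 \<le> \<rho> \<Longrightarrow> \<rho> \<le> 1 \<Longrightarrow> prob_weights (Suc 0) (two_weights \<rho>)"
  by (auto simp: prob_weights_def two_weights_def)

text \<open>The row is read from left to right. The claim carried along is that the top classes
  already produced are independent of the current left edge and have the product law; one vertex
  maps the product law of (bottom, left) to that of (top, right). The endpoint \<rho> = 1 occurs for
  the threshold k = n.\<close>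

locale burke =
  fixes b1 b2 \<rho> :: real
  assumes b: "0 < b1" "b1 < 1" "0 < b2" "b2 < 1" and rho: "0 \<le> \<rho>" "\<rho> \<le> 1"
begin

abbreviation "Z \<equiv> iid (Suc 0) (two_weights \<rho>)"

abbreviation "R \<equiv> row_noise b1 b2"

abbreviation "D \<equiv> Z \<Otimes>\<^sub>M R"

lemma weights: "prob_weights (Suc 0) (two_weights \<rho>)"
  using rho by (rule prob_weights_two)

sublocale Z: measure_preserving Z "translate 1" using weights by (rule measure_preserving_iid)

sublocale R: measure_preserving R shift_row by (rule measure_preserving_shift_row)

sublocale J: measure_preserving "D" "\<lambda>(\<eta>, w). (translate 1 \<eta>, shift_row w)"
  by (rule measure_preserving_pair) unfold_locales

sublocale ZR: pair_prob_space Z R ..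

definition bias :: "real \<Rightarrow> bool \<Rightarrow> real" where
  "bias c p = (if p then c else 1 - c)"

lemma space_Z: "space Z = {\<eta>. \<forall>x. \<eta> x \<le> 1}"
  using sets_eq_imp_space_eq[OF sets_iid, of "Suc 0" "two_weights \<rho>"] by (simp add: space_config_space)

text \<open>The bottom class and both bits at x are jointly independent of every event that ignores
  them: the noise is treated for fixed \<eta>, then \<eta> for fixed noise, by integrating
  sections.\<close>

lemma prob_Int_site:
  assumes A [measurable]: "A \<in> J.events" and a: "a \<le> 1"
    and upd_w: "\<And>\<eta> w i v. \<eta> \<in> space Z \<Longrightarrow> (\<eta>, fun_upd w (x, i) v) \<in> A \<longleftrightarrow> (\<eta>, w) \<in> A"
    and upd_\<eta>: "\<And>\<eta> w v. \<eta> \<in> space Z \<Longrightarrow> v \<le> 1 \<Longrightarrow> (fun_upd \<eta> x v, w) \<in> A \<longleftrightarrow> (\<eta>, w) \<in> A"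
  shows "J.prob (A \<inter> {(\<eta>, w). \<eta> x = a \<and> w (x, True) = p \<and> w (x, False) = q}) =
    J.prob A * (two_weights \<rho> a * bias b1 p * bias b2 q)"
proof -
  define W where "W = {w. w (x, True) = p \<and> w (x, False) = q}"
  have W [measurable]: "W \<in> sets R"
  proof -
    have "{w \<in> space R. w (x, True) = p \<and> w (x, False) = q} \<in> sets R" by measurable
    then show ?thesis by (simp add: W_def)
  qed
  define B where "B = A \<inter> (space Z \<times> W)"
  have [measurable]: "B \<in> J.events" unfolding B_def by measurable
  have b': "0 \<le> b1" "b1 \<le> 1" "0 \<le> b2" "b2 \<le> 1" using b by auto
  have "emeasure (D) B = (\<integral>\<^sup>+\<eta>. emeasure R (Pair \<eta> -` B) \<partial>Z)"
    by (rule R.emeasure_pair_measure_alt) measurable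
  also have "\<dots> = (\<integral>\<^sup>+\<eta>. emeasure R (Pair \<eta> -` A) * ennreal (bias b1 p * bias b2 q) \<partial>Z)"
  proof (rule nn_integral_cong)
    fix \<eta> assume \<eta>: "\<eta> \<in> space Z"
    have [measurable]: "Pair \<eta> -` A \<in> sets R" using A by (rule sets_Pair1)
    have "Pair \<eta> -` B = Pair \<eta> -` A \<inter> W" using \<eta> by (auto simp: B_def)
    moreover have "measure R (Pair \<eta> -` A \<inter> W) = measure R (Pair \<eta> -` A) * (bias b1 p * bias b2 q)"
      unfolding W_def using measure_row_noise_Int[OF b', of "Pair \<eta> -` A" x p q] upd_w[OF \<eta>] by (simp add: bias_def)
    ultimately show "emeasure R (Pair \<eta> -` B) = emeasure R (Pair \<eta> -` A) * ennreal (bias b1 p * bias b2 q)"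
      using b by (simp add: R.emeasure_eq_measure ennreal_mult[symmetric] bias_def)
  qed
  also have "\<dots> = emeasure (D) A * ennreal (bias b1 p * bias b2 q)"
    by (simp add: nn_integral_multc R.measurable_emeasure_Pair R.emeasure_pair_measure_alt)
  finally have 1: "J.prob B = J.prob A * (bias b1 p * bias b2 q)"
    using b by (simp add: J.emeasure_eq_measure ennreal_mult[symmetric] bias_def)
  define C where "C = B \<inter> ({\<eta> \<in> space Z. \<eta> x \<in> {a}} \<times> space R)"
  have E [measurable]: "{\<eta> \<in> space Z. \<eta> x \<in> {a}} \<in> sets Z" by measurable
  have [measurable]: "C \<in> J.events" unfolding C_def by measurable
  have "emeasure (D) C = (\<integral>\<^sup>+w. emeasure Z ((\<lambda>\<eta>. (\<eta>, w)) -` C) \<partial>R)"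
    by (rule ZR.emeasure_pair_measure_alt2) measurable
  also have "\<dots> = (\<integral>\<^sup>+w. emeasure Z ((\<lambda>\<eta>. (\<eta>, w)) -` B) * ennreal (two_weights \<rho> a) \<partial>R)"
  proof (rule nn_integral_cong)
    fix w
    have [measurable]: "(\<lambda>\<eta>. (\<eta>, w)) -` B \<in> sets Z" by (rule sets_Pair2) measurable
    have "(\<lambda>\<eta>. (\<eta>, w)) -` C = (\<lambda>\<eta>. (\<eta>, w)) -` B \<inter> {\<eta> \<in> space Z. \<eta> x \<in> {a}}"
      by (auto simp: C_def)
    moreover have "measure Z ((\<lambda>\<eta>. (\<eta>, w)) -` B \<inter> {\<eta> \<in> space Z. \<eta> x \<in> {a}}) =
      measure Z ((\<lambda>\<eta>. (\<eta>, w)) -` B) * measure (site (Suc 0) (two_weights \<rho>)) {a}"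
      unfolding iid_def
    proof (rule PiM_measure_Int_component)
      fix \<eta> :: "int \<Rightarrow> nat" and v assume "\<eta> \<in> space (\<Pi>\<^sub>M _\<in>UNIV. site (Suc 0) (two_weights \<rho>))" "v \<in> space (site (Suc 0) (two_weights \<rho>))"
      then have *: "\<eta> \<in> space Z" "v \<le> 1" by (auto simp: iid_def)
      then have "fun_upd \<eta> x v \<in> space Z" by (auto simp: space_Z)
      then show "fun_upd \<eta> x v \<in> (\<lambda>\<eta>. (\<eta>, w)) -` B \<longleftrightarrow> \<eta> \<in> (\<lambda>\<eta>. (\<eta>, w)) -` B"
        using * upd_\<eta>[OF *] by (auto simp: B_def)
    qed (use a weights in \<open>auto simp: prob_space_site iid_def[symmetric]\<close>)
    moreover have "measure (site (Suc 0) (two_weights \<rho>)) {a} = two_weights \<rho> a"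
      using measure_site[OF weights, of "{a}"] a by simp
    ultimately show "emeasure Z ((\<lambda>\<eta>. (\<eta>, w)) -` C) = emeasure Z ((\<lambda>\<eta>. (\<eta>, w)) -` B) * ennreal (two_weights \<rho> a)"
      using rho by (simp add: Z.emeasure_eq_measure ennreal_mult[symmetric] two_weights_def)
  qed
  also have "\<dots> = emeasure (D) B * ennreal (two_weights \<rho> a)"
    by (simp add: nn_integral_multc ZR.measurable_emeasure_Pair2 ZR.emeasure_pair_measure_alt2)
  finally have 2: "J.prob C = J.prob B * two_weights \<rho> a"
    using rho by (simp add: J.emeasure_eq_measure ennreal_mult[symmetric] two_weights_def)
  have "C = A \<inter> {(\<eta>, w). \<eta> x = a \<and> w (x, True) = p \<and> w (x, False) = q}"
    using sets.sets_into_space[OF A] by (auto simp: C_def B_def W_def space_pair_measure)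
  then show ?thesis using 1 2 by simp
qed

definition hor :: "int \<Rightarrow> (int \<Rightarrow> nat) \<times> (int \<times> bool \<Rightarrow> bool) \<Rightarrow> nat" where
  "hor x p = horiz (snd p) (fst p) x"

lemma measurable_hor [measurable]: "hor x \<in> D \<rightarrow>\<^sub>M count_space UNIV"
  unfolding hor_def by (rule measurable_horiz[where n = "Suc 0"]) measurable

lemma hor_le: "p \<in> space D \<Longrightarrow> hor x p \<le> 1"
  unfolding hor_def by (rule horiz_le) (auto simp: space_pair_measure space_Z)

lemma hor_upd:
  "hor x (\<eta>, fun_upd w (x, i) v) = hor x (\<eta>, w)" "hor x (fun_upd \<eta> x a, w) = hor x (\<eta>, w)"
  unfolding hor_def by (auto intro!: horiz_cong)

text \<open>The events determined by the columns strictly left of x, expressed by invariance under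
  all changes from x on.\<close>

definition before :: "int \<Rightarrow> ((int \<Rightarrow> nat) \<times> (int \<times> bool \<Rightarrow> bool)) set \<Rightarrow> bool" where
  "before x E \<longleftrightarrow> E \<in> J.events \<and>
     (\<forall>\<eta> \<eta>' w w'. \<eta> \<in> space Z \<longrightarrow> \<eta>' \<in> space Z \<longrightarrow> (\<forall>y<x. \<eta> y = \<eta>' y) \<longrightarrow> (\<forall>y<x. \<forall>i. w (y, i) = w' (y, i)) \<longrightarrow>
       ((\<eta>, w) \<in> E \<longleftrightarrow> (\<eta>', w') \<in> E))"

lemma beforeD:
  assumes "before x E" "\<eta> \<in> space Z" "\<eta>' \<in> space Z"
    "\<And>y. y < x \<Longrightarrow> \<eta> y = \<eta>' y" "\<And>y i. y < x \<Longrightarrow> w (y, i) = w' (y, i)"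
  shows "(\<eta>, w) \<in> E \<longleftrightarrow> (\<eta>', w') \<in> E"
  using assms unfolding before_def by blast

text \<open>Local inputs in the order left class, bottom class, \<chi>1, \<chi>2, selected by their
  output.\<close>

definition outcomes :: "nat set \<Rightarrow> nat \<Rightarrow> (nat \<times> nat \<times> bool \<times> bool) set" where
  "outcomes A d = {(c, a, p, q). c \<le> 1 \<and> a \<le> 1 \<and> fst (vertex_out p q a c) \<in> A \<and> snd (vertex_out p q a c) = d}"

lemma finite_outcomes: "finite (outcomes A d)"
  by (rule finite_subset[of _ "{..1} \<times> {..1} \<times> UNIV \<times> UNIV"]) (auto simp: outcomes_def)

lemma AE_good: "AE p in D. good_row (snd p)"
proof -
  have "AE w in R. good_row w" using b by (intro AE_good_row) auto
  then show ?thesis by (intro ZR.AE_pair_measure) auto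
qed

text \<open>The event is cut according to the local input at x. The left edge and E only involve
  columns before x, so the weight of the bottom class and of the bits factors out.\<close>

lemma prob_outcomes:
  assumes E: "before x E"
  shows "J.prob (E \<inter> {\<omega> \<in> space D. row (snd \<omega>) (fst \<omega>) x \<in> A \<and> hor (x + 1) \<omega> = d}) =
    (\<Sum>(c, a, p, q)\<in>outcomes A d. J.prob (E \<inter> {\<omega> \<in> space D. hor x \<omega> = c}) * (two_weights \<rho> a * bias b1 p * bias b2 q))"
proof -
  have [measurable]: "E \<in> J.events" using E by (simp add: before_def)
  define V where "V a p q = {(\<eta>, w). \<eta> x = a \<and> w (x, True) = p \<and> w (x, False) = q}" for a :: nat and p q :: bool
  define Ec where "Ec c = E \<inter> {\<omega> \<in> space D. hor x \<omega> = c}" for c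
  have [measurable]: "Ec c \<in> J.events" for c unfolding Ec_def by measurable
  have VE: "Ec c \<inter> V a p q \<in> J.events" for c a p q
  proof -
    have "Ec c \<inter> V a p q = Ec c \<inter> {\<omega> \<in> space D. fst \<omega> x = a \<and> snd \<omega> (x, True) = p \<and> snd \<omega> (x, False) = q}"
      by (auto simp: Ec_def V_def)
    also have "\<dots> \<in> J.events" by measurable
    finally show ?thesis .
  qed
  define F where "F = (\<lambda>(c, a, p, q). Ec c \<inter> V a p q)"
  have FE: "F s \<in> J.events" for s using VE by (cases s) (simp add: F_def)
  have disj: "disjoint_family_on F (outcomes A d)"
    unfolding disjoint_family_on_def
  proof (intro ballI impI)
    fix s s' :: "nat \<times> nat \<times> bool \<times> bool" assume "s \<noteq> s'"
    moreover obtain c a p q where s: "s = (c, a, p, q)" by (cases s)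
    moreover obtain c' a' p' q' where s': "s' = (c', a', p', q')" by (cases s')
    ultimately have "c \<noteq> c' \<or> a \<noteq> a' \<or> p \<noteq> p' \<or> q \<noteq> q'" by simp
    then show "F s \<inter> F s' = {}" unfolding F_def s s' Ec_def V_def by auto
  qed
  have "J.prob (E \<inter> {\<omega> \<in> space D. row (snd \<omega>) (fst \<omega>) x \<in> A \<and> hor (x + 1) \<omega> = d}) =
    J.prob (\<Union>s\<in>outcomes A d. F s)"
  proof (rule J.finite_measure_eq_AE)
    show "AE \<omega> in D. (\<omega> \<in> E \<inter> {\<omega> \<in> space D. row (snd \<omega>) (fst \<omega>) x \<in> A \<and> hor (x + 1) \<omega> = d}) =
      (\<omega> \<in> (\<Union>s\<in>outcomes A d. F s))"
      using AE_good AE_space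
    proof eventually_elim
      case (elim \<omega>)
      obtain \<eta> w where \<omega>: "\<omega> = (\<eta>, w)" by (cases \<omega>)
      have "\<eta> x \<le> 1" using elim by (auto simp: \<omega> space_pair_measure space_Z)
      moreover have "hor x \<omega> \<le> 1" using elim(2) by (rule hor_le)
      moreover have "vertex_out (w (x, True)) (w (x, False)) (\<eta> x) (hor x \<omega>) = (row w \<eta> x, hor (x + 1) \<omega>)"
        using vertex_row_horiz[of w x \<eta>] elim(1) by (simp add: vertex_def hor_def \<omega>)
      ultimately show ?case using elim(2) by (auto simp: outcomes_def F_def V_def Ec_def \<omega>)
    qed
    show "(\<Union>s\<in>outcomes A d. F s) \<in> J.events"
      using FE finite_outcomes by (intro sets.finite_UN) auto
    show "E \<inter> {\<omega> \<in> space D. row (snd \<omega>) (fst \<omega>) x \<in> A \<and> hor (x + 1) \<omega> = d} \<in> J.events"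
    proof -
      have [measurable]: "(\<lambda>\<omega>. row (snd \<omega>) (fst \<omega>)) \<in> D \<rightarrow>\<^sub>M config_space (Suc 0)" by measurable
      show ?thesis by measurable
    qed
  qed
  also have "\<dots> = (\<Sum>s\<in>outcomes A d. J.prob (F s))"
    using finite_outcomes FE disj by (intro J.finite_measure_finite_Union) auto
  also have "\<dots> = (\<Sum>(c, a, p, q)\<in>outcomes A d. J.prob (Ec c \<inter> V a p q))"
    by (simp add: F_def case_prod_beta')
  also have "\<dots> = (\<Sum>(c, a, p, q)\<in>outcomes A d. J.prob (Ec c) * (two_weights \<rho> a * bias b1 p * bias b2 q))"
  proof (intro sum.cong refl, clarify)
    fix c a p q assume "(c, a, p, q) \<in> outcomes A d"
    then have a: "a \<le> 1" by (simp add: outcomes_def)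
    show "J.prob (Ec c \<inter> V a p q) = J.prob (Ec c) * (two_weights \<rho> a * bias b1 p * bias b2 q)"
      unfolding V_def
    proof (rule prob_Int_site)
      fix \<eta> w i v assume \<eta>: "\<eta> \<in> space Z"
      have "(\<eta>, fun_upd w (x, i) v) \<in> E \<longleftrightarrow> (\<eta>, w) \<in> E"
        by (rule beforeD[OF E \<eta> \<eta>]) auto
      then show "(\<eta>, fun_upd w (x, i) v) \<in> Ec c \<longleftrightarrow> (\<eta>, w) \<in> Ec c"
        by (simp add: Ec_def hor_upd space_pair_measure)
    next
      fix \<eta> w v assume \<eta>: "\<eta> \<in> space Z" "v \<le> (1::nat)"
      then have "fun_upd \<eta> x v \<in> space Z" by (auto simp: space_Z)
      then have "(fun_upd \<eta> x v, w) \<in> E \<longleftrightarrow> (\<eta>, w) \<in> E"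
        by (rule beforeD[OF E _ \<eta>(1)]) auto
      then show "(fun_upd \<eta> x v, w) \<in> Ec c \<longleftrightarrow> (\<eta>, w) \<in> Ec c"
        using \<eta> \<open>fun_upd \<eta> x v \<in> space Z\<close> by (simp add: Ec_def hor_upd space_pair_measure)
    qed (use a in auto)
  qed
  finally show ?thesis unfolding Ec_def .
qed

end

context burke
begin

definition \<nu> :: "nat \<Rightarrow> real" where
  "\<nu> c = \<P>(\<omega> in D. hor 0 \<omega> = c)"

definition wt :: "nat set \<Rightarrow> real" where
  "wt A = (\<Sum>k\<in>A \<inter> {0..Suc 0}. two_weights \<rho> k)"

lemma prob_hor: "\<P>(\<omega> in D. hor x \<omega> = c) = \<nu> c"
proof -
  have 1: "\<P>(\<omega> in D. hor (x + 1) \<omega> = c) = \<P>(\<omega> in D. hor x \<omega> = c)" for x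
  proof -
    have "{\<omega> \<in> space D. hor (x + 1) \<omega> = c} =
      (\<lambda>(\<eta>, w). (translate 1 \<eta>, shift_row w)) -` {\<omega> \<in> space D. hor x \<omega> = c} \<inter> space D"
      using measurable_space[OF J.T_measurable] by (auto simp: hor_def horiz_shift)
    moreover have "{\<omega> \<in> space D. hor x \<omega> = c} \<in> J.events" by measurable
    ultimately show ?thesis using J.measure_vimage_funpow[of "{\<omega> \<in> space D. hor x \<omega> = c}" 1] by simp
  qed
  show ?thesis
  proof (induction x rule: int_induct[where k = 0])
    case (step2 i) then show ?case using 1[of "i - 1"] by simp
  qed (simp_all add: 1 \<nu>_def)
qed

lemma prob_split_hor:
  assumes [measurable]: "E \<in> J.events"
  shows "J.prob E = J.prob (E \<inter> {\<omega> \<in> space D. hor x \<omega> = 0}) + J.prob (E \<inter> {\<omega> \<in> space D. hor x \<omega> = Suc 0})"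
proof -
  have "hor x \<omega> = 0 \<or> hor x \<omega> = Suc 0" if "\<omega> \<in> E" for \<omega>
    using hor_le[of \<omega> x] sets.sets_into_space[OF assms] that by fastforce
  then have "E = (E \<inter> {\<omega> \<in> space D. hor x \<omega> = 0}) \<union> (E \<inter> {\<omega> \<in> space D. hor x \<omega> = Suc 0})"
    using sets.sets_into_space[OF assms] by auto
  then have "J.prob E = J.prob ((E \<inter> {\<omega> \<in> space D. hor x \<omega> = 0}) \<union> (E \<inter> {\<omega> \<in> space D. hor x \<omega> = Suc 0}))"
    by (rule arg_cong)
  also have "\<dots> = J.prob (E \<inter> {\<omega> \<in> space D. hor x \<omega> = 0}) + J.prob (E \<inter> {\<omega> \<in> space D. hor x \<omega> = Suc 0})"
    by (rule J.finite_measure_Union) (measurable, auto)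
  finally show ?thesis .
qed

lemma \<nu>_sum: "\<nu> (Suc 0) = 1 - \<nu> 0"
  using prob_split_hor[of "space D" 0] J.prob_space by (simp add: \<nu>_def Int_absorb1 subset_eq)

text \<open>Spells the sum out over all sixteen inputs, in a form that the simplifier can
  evaluate.\<close>

lemma sum_outcomes:
  fixes f :: "nat \<Rightarrow> nat \<Rightarrow> bool \<Rightarrow> bool \<Rightarrow> real"
  shows "(\<Sum>(c, a, p, q)\<in>outcomes A d. f c a p q) =
    (\<Sum>c\<in>{0, Suc 0}. \<Sum>a\<in>{0, Suc 0}. \<Sum>p\<in>{True, False}. \<Sum>q\<in>{True, False}.
      if fst (vertex_out p q a c) \<in> A \<and> snd (vertex_out p q a c) = d then f c a p q else 0)"
proof -
  define C where "C = {0, Suc 0} \<times> {0, Suc 0} \<times> {True, False} \<times> {True, False}"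
  have "outcomes A d = {s \<in> C. case s of (c, a, p, q) \<Rightarrow> fst (vertex_out p q a c) \<in> A \<and> snd (vertex_out p q a c) = d}"
  proof (rule set_eqI)
    fix s :: "nat \<times> nat \<times> bool \<times> bool"
    obtain c a p q where s: "s = (c, a, p, q)" by (cases s)
    have le: "(u \<le> 1) = (u \<in> {0, Suc 0})" for u :: nat by auto
    have "p \<in> {True, False}" "q \<in> {True, False}" by (cases p; simp) (cases q; simp)
    then show "s \<in> outcomes A d \<longleftrightarrow> s \<in> {s \<in> C. case s of (c, a, p, q) \<Rightarrow> fst (vertex_out p q a c) \<in> A \<and> snd (vertex_out p q a c) = d}"
      unfolding s outcomes_def C_def mem_Collect_eq prod.case mem_Sigma_iff le by blast
  qed
  moreover have "finite C" by (simp add: C_def)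
  ultimately have "(\<Sum>(c, a, p, q)\<in>outcomes A d. f c a p q) =
    (\<Sum>s\<in>C. if (case s of (c, a, p, q) \<Rightarrow> fst (vertex_out p q a c) \<in> A \<and> snd (vertex_out p q a c) = d)
      then (case s of (c, a, p, q) \<Rightarrow> f c a p q) else 0)"
    by (simp only: sum.inter_filter)
  also have "\<dots> = (\<Sum>(c, a, p, q)\<in>C.
      if fst (vertex_out p q a c) \<in> A \<and> snd (vertex_out p q a c) = d then f c a p q else 0)"
    by (intro sum.cong refl) (simp add: case_prod_beta')
  finally show ?thesis unfolding C_def by (simp only: sum.cartesian_product)
qed

text \<open>
  The balance equation that makes the product of the laws of the bottom and the left edge invariant
  under the vertex rule; it is forced by the translation invariance of the horizontal edges.
\<close>
lemma balance: "\<rho> * (1 - \<nu> 0) * (1 - b1) = (1 - \<rho>) * \<nu> 0 * (1 - b2)"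
proof -
  have "before 0 (space D)" 
    unfolding before_def by (intro conjI sets.top) (auto simp: space_pair_measure)
  \<comment> \<open>With no condition on the top, this computes the law of the right edge of 0 from
    that of its left edge; both are \<nu>. The value of \<nu> is never computed.\<close>
  from prob_outcomes[OF this, of UNIV 0] show ?thesis
    using prob_hor[of 1 0]
    by (simp add: sum_outcomes \<nu>_def[symmetric] \<nu>_sum Int_absorb1 subset_eq vertex_out_def two_weights_def bias_def algebra_simps)
qed

text \<open>The induction step of the Burke argument: product form with the left edge of x becomes
  product form with its right edge, and the top class contributes its own weight. Summing the
  assumption over c shows that \<alpha> is the probability of E.\<close>

lemma prob_transfer:
  assumes E: "before x E" and d: "d = 0 \<or> d = Suc 0"
    and hor: "\<And>c. c = 0 \<or> c = Suc 0 \<Longrightarrow> J.prob (E \<inter> {\<omega> \<in> space D. hor x \<omega> = c}) = \<alpha> * \<nu> c"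
  shows "J.prob (E \<inter> {\<omega> \<in> space D. row (snd \<omega>) (fst \<omega>) x \<in> A \<and> hor (x + 1) \<omega> = d}) = \<alpha> * wt A * \<nu> d"
proof -
  have set: "{0..Suc 0} = {0, Suc 0}" by auto
  have wt: "wt A = (if 0 \<in> A then \<rho> else 0) + (if Suc 0 \<in> A then 1 - \<rho> else 0)"
    by (auto simp: wt_def set Int_insert_right two_weights_def)
  \<comment> \<open>The balance equation expanded into monomials; after multiplication by \<alpha>
    these are atoms for linear arithmetic.\<close>
  have "\<rho> + (b2 * \<nu> 0 + \<rho> * (b1 * \<nu> 0)) = \<rho> * b1 + (\<nu> 0 + \<rho> * (b2 * \<nu> 0))"
    using balance by (simp add: algebra_simps)
  then have "\<alpha> * (\<rho> + (b2 * \<nu> 0 + \<rho> * (b1 * \<nu> 0))) = \<alpha> * (\<rho> * b1 + (\<nu> 0 + \<rho> * (b2 * \<nu> 0)))"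
    by (rule arg_cong)
  then have \<alpha>: "\<alpha> * \<rho> + (\<alpha> * (b2 * \<nu> 0) + \<alpha> * (\<rho> * (b1 * \<nu> 0))) =
    \<alpha> * (\<rho> * b1) + (\<alpha> * \<nu> 0 + \<alpha> * (\<rho> * (b2 * \<nu> 0)))"
    by (simp only: distrib_left)
  have *: "(\<Sum>(c, a, p, q)\<in>outcomes A d. J.prob (E \<inter> {\<omega> \<in> space D. hor x \<omega> = c}) * (two_weights \<rho> a * bias b1 p * bias b2 q))
    = \<alpha> * wt A * \<nu> d"
    unfolding sum_outcomes wt using d
    by (elim disjE) (simp_all add: hor vertex_out_def two_weights_def bias_def \<nu>_sum, simp_all add: algebra_simps,
      (intro impI, use \<alpha> in linarith)+)
  show ?thesis unfolding prob_outcomes[OF E] by (rule *)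
qed

definition rows :: "int \<Rightarrow> nat \<Rightarrow> (nat \<Rightarrow> nat set) \<Rightarrow> ((int \<Rightarrow> nat) \<times> (int \<times> bool \<Rightarrow> bool)) set" where
  "rows y m A = {\<omega> \<in> space D. \<forall>i<m. row (snd \<omega>) (fst \<omega>) (y + int i) \<in> A i}"

lemma measurable_rows [measurable]: "rows y m A \<in> J.events"
proof -
  have [measurable]: "(\<lambda>\<omega>. row (snd \<omega>) (fst \<omega>)) \<in> D \<rightarrow>\<^sub>M config_space (Suc 0)" by measurable
  show ?thesis unfolding rows_def by measurable
qed

lemma before_rows: "before (y + int m) (rows y m A)"
proof -
  have "(\<eta>, w) \<in> rows y m A \<longleftrightarrow> (\<eta>', w') \<in> rows y m A"
    if "\<eta> \<in> space Z" "\<eta>' \<in> space Z" "\<forall>z<y + int m. \<eta> z = \<eta>' z" "\<forall>z<y + int m. \<forall>i. w (z, i) = w' (z, i)" for \<eta> \<eta>' w w'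
  proof -
    have "row w \<eta> (y + int i) = row w' \<eta>' (y + int i)" if "i < m" for i
      using \<open>i < m\<close> \<open>\<forall>z<y + int m. \<eta> z = \<eta>' z\<close> \<open>\<forall>z<y + int m. \<forall>i. w (z, i) = w' (z, i)\<close> by (intro row_cong) auto
    then show ?thesis using that(1,2) by (auto simp: rows_def space_pair_measure)
  qed
  then show ?thesis unfolding before_def using measurable_rows by blast
qed

lemma prob_rows_hor:
  "d = 0 \<or> d = Suc 0 \<Longrightarrow>
    J.prob (rows y m A \<inter> {\<omega> \<in> space D. hor (y + int m) \<omega> = d}) = (\<Prod>i<m. wt (A i)) * \<nu> d"
proof (induction m arbitrary: d)
  case 0
  have "rows y 0 A \<inter> {\<omega> \<in> space D. hor y \<omega> = d} = {\<omega> \<in> space D. hor y \<omega> = d}"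
    by (auto simp: rows_def)
  then show ?case by (simp add: prob_hor)
next
  case (Suc m)
  have "rows y (Suc m) A \<inter> {\<omega> \<in> space D. hor (y + int (Suc m)) \<omega> = d} =
    rows y m A \<inter> {\<omega> \<in> space D. row (snd \<omega>) (fst \<omega>) (y + int m) \<in> A m \<and> hor (y + int m + 1) \<omega> = d}"
    by (auto simp: rows_def less_Suc_eq ac_simps)
  then show ?case using prob_transfer[OF before_rows Suc.prems Suc.IH] by simp
qed

lemma prob_rows: "J.prob (rows y m A) = (\<Prod>i<m. wt (A i))"
  using prob_split_hor[OF measurable_rows, of y m A "y + int m"] prob_rows_hor[of 0 y m A] prob_rows_hor[of "Suc 0" y m A]
  by (simp add: \<nu>_sum algebra_simps)

theorem step_iid: "step (Suc 0) b1 b2 Z = Z"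
proof (rule config_measure_eqI_intervals)
  fix y m and X :: "int \<Rightarrow> nat set"
  define K where "K = (\<lambda>i. y + int i) ` {..<m}"
  have K: "finite K" by (simp add: K_def)
  have [measurable]: "(\<lambda>(\<eta>, w). row w \<eta>) \<in> D \<rightarrow>\<^sub>M config_space (Suc 0)" by measurable
  have "(\<lambda>(\<eta>, w). row w \<eta>) -` cylinder (Suc 0) K X \<inter> space D = rows y m (\<lambda>i. X (y + int i))"
    using measurable_space[of "\<lambda>(\<eta>, w). row w \<eta>" "D" "config_space (Suc 0)"]
    by (fastforce simp: cylinder_def rows_def K_def)
  then have "measure (step (Suc 0) b1 b2 Z) (cylinder (Suc 0) K X) = (\<Prod>i<m. wt (X (y + int i)))"
    unfolding step_def using K by (subst measure_distr) (simp_all add: measurable_cylinder prob_rows)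
  also have "\<dots> = measure Z (cylinder (Suc 0) K X)"
    unfolding measure_iid_cylinder[OF weights K]
    unfolding K_def wt_def by (subst prod.reindex) (auto simp: inj_on_def)
  finally show "measure (step (Suc 0) b1 b2 Z) (cylinder (Suc 0) ((\<lambda>i. y + int i) ` {..<m}) X) = measure Z (cylinder (Suc 0) ((\<lambda>i. y + int i) ` {..<m}) X)"
    unfolding K_def .
qed (simp_all add: prob_space_step Z.prob_space_axioms sets_iid)

end

subsection \<open>Merging classes\<close>

definition merge :: "nat \<Rightarrow> (int \<Rightarrow> nat) \<Rightarrow> int \<Rightarrow> nat" where
  "merge k \<eta> x = thr k (\<eta> x)"

lemma measurable_merge [measurable (raw)]:
  "f \<in> M \<rightarrow>\<^sub>M config_space n \<Longrightarrow> (\<lambda>\<omega>. merge k (f \<omega>)) \<in> M \<rightarrow>\<^sub>M config_space (Suc 0)"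
proof (rule measurable_config_spaceI)
  assume [measurable]: "f \<in> M \<rightarrow>\<^sub>M config_space n"
  show "(\<lambda>\<omega>. merge k (f \<omega>) x) \<in> M \<rightarrow>\<^sub>M count_space UNIV" for x
    unfolding merge_def by (rule measurable_compose[where g = "thr k" and N = "count_space UNIV"]) measurable
qed (simp add: merge_def thr_def)

lemma row_merge: "row w (merge k \<eta>) = merge k (row w \<eta>)"
  unfolding merge_def[abs_def] by (rule row_map[OF mono_thr thr_0])

text \<open>The image of the chain under merging is again a chain of the same kind, with two
  classes, so the stationary Bernoulli measures describe each threshold separately.\<close>

lemma distr_merge_step:
  assumes "prob_space \<mu>" and [measurable_cong]: "sets \<mu> = sets (config_space n)"
  shows "distr (step n b1 b2 \<mu>) (config_space (Suc 0)) (merge k) =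
    step (Suc 0) b1 b2 (distr \<mu> (config_space (Suc 0)) (merge k))"
proof -
  have m: "merge k \<in> \<mu> \<rightarrow>\<^sub>M config_space (Suc 0)" "merge k \<in> config_space n \<rightarrow>\<^sub>M config_space (Suc 0)" by measurable
  have "distr (step n b1 b2 \<mu>) (config_space (Suc 0)) (merge k) =
    distr (\<mu> \<Otimes>\<^sub>M row_noise b1 b2) (config_space (Suc 0)) (\<lambda>(\<eta>, w). merge k (row w \<eta>))"
    unfolding step_def using m by (subst distr_distr) (auto simp: comp_def case_prod_beta')
  also have "\<dots> = step (Suc 0) b1 b2 (distr \<mu> (config_space (Suc 0)) (merge k))"
    by (subst step_distr[OF m(1)]) (simp add: row_merge)
  finally show ?thesis .
qed

lemma deviation_merge:
  assumes [measurable_cong]: "sets \<mu> = sets (config_space n)"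
  shows "deviation k \<rho> L \<mu> = deviation 0 \<rho> L (distr \<mu> (config_space (Suc 0)) (merge k))"
proof -
  have m: "merge k \<in> \<mu> \<rightarrow>\<^sub>M config_space (Suc 0)" by measurable
  have "count_upto k L \<eta> = count_upto 0 L (merge k \<eta>)" for \<eta>
    by (simp add: count_upto_def merge_def thr_def)
  then show ?thesis unfolding deviation_def using m by (subst integral_distr) simp_all
qed

lemma distr_merge_iid:
  assumes lam: "prob_weights n lam" and k: "k \<le> n"
  shows "distr (iid n lam) (config_space (Suc 0)) (merge k) = iid (Suc 0) (two_weights (\<Sum>j\<le>k. lam j))"
proof -
  define \<rho> where "\<rho> = (\<Sum>j\<le>k. lam j)"
  have split: "(\<Sum>j\<le>n. lam j) = \<rho> + (\<Sum>j\<in>{k<..n}. lam j)"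
    unfolding \<rho>_def using k by (subst sum.union_disjoint[symmetric]) (auto intro!: sum.cong)
  have r: "0 \<le> \<rho>" "0 \<le> (\<Sum>j\<in>{k<..n}. lam j)"
    using lam k unfolding \<rho>_def prob_weights_def by (auto intro!: sum_nonneg)
  then have \<rho>: "0 \<le> \<rho>" "\<rho> \<le> 1" using split lam by (auto simp: prob_weights_def)
  have sum2: "(\<Sum>j\<in>{k<..n}. lam j) = 1 - \<rho>" using split lam by (simp add: prob_weights_def)
  interpret I: prob_space "iid n lam" using lam by (rule prob_space_iid)
  have w2: "prob_weights (Suc 0) (two_weights \<rho>)" using prob_weights_two[OF \<rho>] by simp
  have m: "merge k \<in> iid n lam \<rightarrow>\<^sub>M config_space (Suc 0)" by measurable
  have "distr (iid n lam) (config_space (Suc 0)) (merge k) = iid (Suc 0) (two_weights \<rho>)"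
  proof (rule config_measure_eqI)
    fix J :: "int set" and X :: "int \<Rightarrow> nat set" assume J: "finite J"
    have "merge k -` cylinder (Suc 0) J X \<inter> space (iid n lam) = cylinder n J (\<lambda>x. thr k -` X x)"
      using sets_eq_imp_space_eq[OF sets_iid, of n lam]
      by (auto simp: cylinder_def space_config_space merge_def thr_def)
    then have "measure (distr (iid n lam) (config_space (Suc 0)) (merge k)) (cylinder (Suc 0) J X) =
      (\<Prod>x\<in>J. \<Sum>j\<in>(thr k -` X x) \<inter> {0..n}. lam j)"
      using m J by (simp add: measure_distr measurable_cylinder measure_iid_cylinder[OF lam])
    also have "\<dots> = (\<Prod>x\<in>J. \<Sum>j\<in>X x \<inter> {0..Suc 0}. two_weights \<rho> j)"
    proof (rule prod.cong[OF refl])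
      fix x
      have "(thr k -` X x) \<inter> {0..n} = (if 0 \<in> X x then {..k} else {}) \<union> (if Suc 0 \<in> X x then {k<..n} else {})"
        using k by (auto simp: thr_def split: if_splits)
      moreover have "X x \<inter> {0..Suc 0} = (if 0 \<in> X x then {0} else {}) \<union> (if Suc 0 \<in> X x then {Suc 0} else {})"
        by (auto simp: le_Suc_eq)
      moreover have "(\<Sum>j\<in>{..k} \<union> {k<..n}. lam j) = \<rho> + (1 - \<rho>)"
        by (subst sum.union_disjoint) (auto simp: \<rho>_def sum2[unfolded \<rho>_def])
      ultimately show "(\<Sum>j\<in>(thr k -` X x) \<inter> {0..n}. lam j) = (\<Sum>j\<in>X x \<inter> {0..Suc 0}. two_weights \<rho> j)"
        by (auto simp: two_weights_def sum2 \<rho>_def[symmetric])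
    qed
    also have "\<dots> = measure (iid (Suc 0) (two_weights \<rho>)) (cylinder (Suc 0) J X)"
      by (simp add: measure_iid_cylinder[OF w2 J])
    finally show "measure (distr (iid n lam) (config_space (Suc 0)) (merge k)) (cylinder (Suc 0) J X) =
      measure (iid (Suc 0) (two_weights \<rho>)) (cylinder (Suc 0) J X)" .
  qed (use m w2 in \<open>auto simp: sets_iid prob_space_iid intro: I.prob_space_distr\<close>)
  then show ?thesis by (simp add: \<rho>_def)
qed

section \<open>Space-time noise\<close>

text \<open>The ranges of f and g partition the index set, and h reassembles a family from its two
  restrictions. This serves to split a row off the noise, in either order of the factors, and to
  join the two Bernoulli families.\<close>

lemma distr_PiM_glue:
  fixes N :: "'k \<Rightarrow> 'a measure" and f :: "'i \<Rightarrow> 'k" and g :: "'l \<Rightarrow> 'k"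
  assumes N: "\<And>k. prob_space (N k)" and inj: "inj f" "inj g"
    and ranges: "range f \<inter> range g = {}" "range f \<union> range g = UNIV"
    and h: "\<And>u v i. h (u, v) (f i) = u i" "\<And>u v l. h (u, v) (g l) = v l"
  shows "h \<in> (\<Pi>\<^sub>M i\<in>UNIV. N (f i)) \<Otimes>\<^sub>M (\<Pi>\<^sub>M l\<in>UNIV. N (g l)) \<rightarrow>\<^sub>M PiM UNIV N"
    and "distr ((\<Pi>\<^sub>M i\<in>UNIV. N (f i)) \<Otimes>\<^sub>M (\<Pi>\<^sub>M l\<in>UNIV. N (g l))) (PiM UNIV N) h = PiM UNIV N"
proof -
  define A where "A = (\<Pi>\<^sub>M i\<in>UNIV. N (f i))"
  define B where "B = (\<Pi>\<^sub>M l\<in>UNIV. N (g l))"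
  interpret PP: product_prob_space N UNIV
    by (simp add: product_prob_space_def product_prob_space_axioms_def product_sigma_finite_def N prob_space_imp_sigma_finite)
  interpret A: product_prob_space "\<lambda>i. N (f i)" UNIV
    by (simp add: product_prob_space_def product_prob_space_axioms_def product_sigma_finite_def N prob_space_imp_sigma_finite)
  interpret B: product_prob_space "\<lambda>l. N (g l)" UNIV
    by (simp add: product_prob_space_def product_prob_space_axioms_def product_sigma_finite_def N prob_space_imp_sigma_finite)
  interpret B': prob_space B unfolding B_def by (rule B.prob_space_axioms)
  have cases: "(\<exists>i. k = f i) \<or> (\<exists>l. k = g l)" for k using ranges(2) by blast
  have hm: "h \<in> A \<Otimes>\<^sub>M B \<rightarrow>\<^sub>M PiM UNIV N"
  proof (rule measurable_PiM_single')
    fix k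
    show "(\<lambda>\<omega>. h \<omega> k) \<in> A \<Otimes>\<^sub>M B \<rightarrow>\<^sub>M N k"
      using cases[of k]
    proof (elim disjE exE)
      fix i assume k: "k = f i"
      have [measurable]: "(\<lambda>u. u i) \<in> A \<rightarrow>\<^sub>M N (f i)" unfolding A_def by (rule measurable_component_singleton) simp
      have "(\<lambda>\<omega>. h \<omega> k) = (\<lambda>\<omega>. fst \<omega> i)" by (auto simp: k h fun_eq_iff)
      then show ?thesis unfolding k by simp
    next
      fix l assume k: "k = g l"
      have [measurable]: "(\<lambda>u. u l) \<in> B \<rightarrow>\<^sub>M N (g l)" unfolding B_def by (rule measurable_component_singleton) simp
      have "(\<lambda>\<omega>. h \<omega> k) = (\<lambda>\<omega>. snd \<omega> l)" by (auto simp: k h fun_eq_iff)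
      then show ?thesis unfolding k by simp
    qed
  next
    show "h \<in> space (A \<Otimes>\<^sub>M B) \<rightarrow> (\<Pi>\<^sub>E i\<in>UNIV. space (N i))"
    proof
      fix \<omega> assume \<omega>: "\<omega> \<in> space (A \<Otimes>\<^sub>M B)"
      obtain u v where "\<omega> = (u, v)" by (cases \<omega>)
      with \<omega> have uv: "\<omega> = (u, v)" "\<And>i. u i \<in> space (N (f i))" "\<And>l. v l \<in> space (N (g l))"
        by (auto simp: space_pair_measure A_def B_def space_PiM)
      have "h \<omega> k \<in> space (N k)" for k using cases[of k] uv by (auto simp: h)
      then show "h \<omega> \<in> (\<Pi>\<^sub>E i\<in>UNIV. space (N i))" by auto
    qed
  qed
  then show "h \<in> (\<Pi>\<^sub>M i\<in>UNIV. N (f i)) \<Otimes>\<^sub>M (\<Pi>\<^sub>M l\<in>UNIV. N (g l)) \<rightarrow>\<^sub>M PiM UNIV N"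
    by (simp add: A_def B_def)
  have "distr (A \<Otimes>\<^sub>M B) (PiM UNIV N) h = PiM UNIV N"
  proof (rule PP.PiM_eq)
    fix J E assume J: "finite J" "J \<subseteq> UNIV" "\<And>j. j \<in> J \<Longrightarrow> E j \<in> sets (N j)"
    have fin: "finite (f -` J)" "finite (g -` J)" using J(1) inj by (auto intro: finite_vimageI)
    have E: "h -` PP.emb UNIV J (Pi\<^sub>E J E) \<inter> space (A \<Otimes>\<^sub>M B) =
      A.emb UNIV (f -` J) (\<Pi>\<^sub>E i\<in>f -` J. E (f i)) \<times> B.emb UNIV (g -` J) (\<Pi>\<^sub>E l\<in>g -` J. E (g l))"
      (is "?L = ?R1 \<times> ?R2")
    proof (rule set_eqI)
      fix \<omega> :: "('i \<Rightarrow> 'a) \<times> ('l \<Rightarrow> 'a)"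
      obtain u v where uv: "\<omega> = (u, v)" by (cases \<omega>)
      have 1: "h (u, v) \<in> space (PiM UNIV N)" if "(u, v) \<in> space (A \<Otimes>\<^sub>M B)"
        using measurable_space[OF hm that] .
      have "(\<forall>k\<in>J. h (u, v) k \<in> E k) \<longleftrightarrow> (\<forall>i\<in>f -` J. u i \<in> E (f i)) \<and> (\<forall>l\<in>g -` J. v l \<in> E (g l))"
      proof (intro iffI conjI ballI)
        fix k assume *: "(\<forall>i\<in>f -` J. u i \<in> E (f i)) \<and> (\<forall>l\<in>g -` J. v l \<in> E (g l))" and k: "k \<in> J"
        from cases[of k] show "h (u, v) k \<in> E k"
        proof (elim disjE exE)
          fix i assume "k = f i" then show ?thesis using * k by (simp add: h)
        next
          fix l assume "k = g l" then show ?thesis using * k by (simp add: h)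
        qed
      next
        fix i assume "\<forall>k\<in>J. h (u, v) k \<in> E k" "i \<in> f -` J"
        then have "h (u, v) (f i) \<in> E (f i)" by blast
        then show "u i \<in> E (f i)" by (simp add: h)
      next
        fix l assume "\<forall>k\<in>J. h (u, v) k \<in> E k" "l \<in> g -` J"
        then have "h (u, v) (g l) \<in> E (g l)" by blast
        then show "v l \<in> E (g l)" by (simp add: h)
      qed
      then show "\<omega> \<in> ?L \<longleftrightarrow> \<omega> \<in> ?R1 \<times> ?R2"
        using 1 by (auto simp: uv prod_emb_def A_def B_def space_pair_measure space_PiM)
    qed
    have "emeasure (distr (A \<Otimes>\<^sub>M B) (PiM UNIV N) h) (PP.emb UNIV J (Pi\<^sub>E J E)) = emeasure (A \<Otimes>\<^sub>M B) (?R1 \<times> ?R2)"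
      using J hm by (subst emeasure_distr) (auto simp: E intro!: sets_PiM_I)
    also have "\<dots> = emeasure A ?R1 * emeasure B ?R2"
      using J fin by (intro B'.emeasure_pair_measure_Times) (auto simp: A_def B_def intro!: sets_PiM_I)
    also have "emeasure A ?R1 = (\<Prod>i\<in>f -` J. emeasure (N (f i)) (E (f i)))"
      unfolding A_def using J fin by (intro A.emeasure_PiM_emb) auto
    also have "\<dots> = (\<Prod>k\<in>f ` (f -` J). emeasure (N k) (E k))"
      using inj by (subst prod.reindex) (auto intro: inj_on_subset)
    also have "emeasure B ?R2 = (\<Prod>l\<in>g -` J. emeasure (N (g l)) (E (g l)))"
      unfolding B_def using J fin by (intro B.emeasure_PiM_emb) auto
    also have "\<dots> = (\<Prod>k\<in>g ` (g -` J). emeasure (N k) (E k))"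
      using inj by (subst prod.reindex) (auto intro: inj_on_subset)
    also have "(\<Prod>k\<in>f ` (f -` J). emeasure (N k) (E k)) * \<dots> = (\<Prod>k\<in>f ` (f -` J) \<union> g ` (g -` J). emeasure (N k) (E k))"
      using J(1) ranges(1) by (intro prod.union_disjoint[symmetric]) auto
    also have "f ` (f -` J) \<union> g ` (g -` J) = J" using ranges(2) by (auto simp: image_vimage_eq)
    finally show "emeasure (distr (A \<Otimes>\<^sub>M B) (PiM UNIV N) h) (PP.emb UNIV J (Pi\<^sub>E J E)) = (\<Prod>j\<in>J. emeasure (N j) (E j))" .
  qed simp
  then show "distr ((\<Pi>\<^sub>M i\<in>UNIV. N (f i)) \<Otimes>\<^sub>M (\<Pi>\<^sub>M l\<in>UNIV. N (g l))) (PiM UNIV N) h = PiM UNIV N"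
    by (simp add: A_def B_def)
qed

lemma distr_pair_rearrange:
  assumes "prob_space A" "prob_space B" "prob_space C"
  shows "distr (A \<Otimes>\<^sub>M (B \<Otimes>\<^sub>M C)) ((A \<Otimes>\<^sub>M C) \<Otimes>\<^sub>M B) (\<lambda>(a, b, c). ((a, c), b)) = (A \<Otimes>\<^sub>M C) \<Otimes>\<^sub>M B"
proof (rule pair_measure_eqI[symmetric])
  interpret A: prob_space A by fact
  interpret B: prob_space B by fact
  interpret C: prob_space C by fact
  interpret AC: pair_prob_space A C ..
  interpret BC: pair_prob_space B C ..
  show "sigma_finite_measure (A \<Otimes>\<^sub>M C)" by (rule AC.sigma_finite_measure_axioms)
  show "sigma_finite_measure B" by (rule B.sigma_finite_measure_axioms)
  fix E F assume E [measurable]: "E \<in> sets (A \<Otimes>\<^sub>M C)" and F [measurable]: "F \<in> sets B"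
  have [measurable]: "E \<times> F \<in> sets ((A \<Otimes>\<^sub>M C) \<Otimes>\<^sub>M B)" by measurable
  have [measurable]: "(\<lambda>(a, b, c). ((a, c), b)) \<in> A \<Otimes>\<^sub>M (B \<Otimes>\<^sub>M C) \<rightarrow>\<^sub>M (A \<Otimes>\<^sub>M C) \<Otimes>\<^sub>M B" by measurable
  have "emeasure (distr (A \<Otimes>\<^sub>M (B \<Otimes>\<^sub>M C)) ((A \<Otimes>\<^sub>M C) \<Otimes>\<^sub>M B) (\<lambda>(a, b, c). ((a, c), b))) (E \<times> F) =
    emeasure (A \<Otimes>\<^sub>M (B \<Otimes>\<^sub>M C)) ((\<lambda>(a, b, c). ((a, c), b)) -` (E \<times> F) \<inter> space (A \<Otimes>\<^sub>M (B \<Otimes>\<^sub>M C)))"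
    by (rule emeasure_distr) measurable
  also have "\<dots> = (\<integral>\<^sup>+a. emeasure (B \<Otimes>\<^sub>M C) (Pair a -` ((\<lambda>(a, b, c). ((a, c), b)) -` (E \<times> F) \<inter> space (A \<Otimes>\<^sub>M (B \<Otimes>\<^sub>M C)))) \<partial>A)"
    by (rule BC.emeasure_pair_measure_alt) measurable
  also have "\<dots> = (\<integral>\<^sup>+a. emeasure C (Pair a -` E) * emeasure B F \<partial>A)"
  proof (rule nn_integral_cong)
    fix a assume a: "a \<in> space A"
    have "Pair a -` ((\<lambda>(a, b, c). ((a, c), b)) -` (E \<times> F) \<inter> space (A \<Otimes>\<^sub>M (B \<Otimes>\<^sub>M C))) = F \<times> (Pair a -` E)"
      using a sets.sets_into_space[OF E] sets.sets_into_space[OF F] by (auto simp: space_pair_measure)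
    then show "emeasure (B \<Otimes>\<^sub>M C) (Pair a -` ((\<lambda>(a, b, c). ((a, c), b)) -` (E \<times> F) \<inter> space (A \<Otimes>\<^sub>M (B \<Otimes>\<^sub>M C)))) =
      emeasure C (Pair a -` E) * emeasure B F"
      by (simp add: C.emeasure_pair_measure_Times sets_Pair1 mult.commute)
  qed
  also have "\<dots> = emeasure (A \<Otimes>\<^sub>M C) E * emeasure B F"
    by (simp add: nn_integral_multc C.measurable_emeasure_Pair C.emeasure_pair_measure_alt)
  finally show "emeasure (A \<Otimes>\<^sub>M C) E * emeasure B F =
    emeasure (distr (A \<Otimes>\<^sub>M (B \<Otimes>\<^sub>M C)) ((A \<Otimes>\<^sub>M C) \<Otimes>\<^sub>M B) (\<lambda>(a, b, c). ((a, c), b))) (E \<times> F)" by simp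
qed simp

section \<open>Splitting the noise into rows\<close>

definition noise :: "real \<Rightarrow> real \<Rightarrow> (nat \<times> int \<times> bool \<Rightarrow> bool) measure" where
  "noise b1 b2 = PiM UNIV (\<lambda>z. bern b1 b2 (snd (snd z)))"

text \<open>The row put in front has two readings: for \<open>past\<close>, where time counts
  backwards, it is the latest row, and for \<open>evol\<close> it is the first one.\<close>

definition cons_row :: "(int \<times> bool \<Rightarrow> bool) \<Rightarrow> (nat \<times> int \<times> bool \<Rightarrow> bool) \<Rightarrow> nat \<times> int \<times> bool \<Rightarrow> bool" where
  "cons_row r w = (\<lambda>(t, z). case t of 0 \<Rightarrow> r z | Suc t \<Rightarrow> w (t, z))"

definition slice :: "nat \<Rightarrow> (nat \<times> int \<times> bool \<Rightarrow> bool) \<Rightarrow> int \<times> bool \<Rightarrow> bool" where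
  "slice t w = (\<lambda>z. w (t, z))"

definition tail :: "(nat \<times> int \<times> bool \<Rightarrow> bool) \<Rightarrow> nat \<times> int \<times> bool \<Rightarrow> bool" where
  "tail w = (\<lambda>(t, z). w (Suc t, z))"

lemma slice_tail_cons [simp]: "slice 0 (cons_row r w) = r" "tail (cons_row r w) = w" "slice t (tail w) = slice (Suc t) w"
  by (auto simp: slice_def tail_def cons_row_def fun_eq_iff)

lemma prob_space_noise: "prob_space (noise b1 b2)"
  unfolding noise_def by (rule prob_space_PiM) (rule prob_space_bern)

lemma measurable_noise_component [measurable (raw)]:
  assumes "g \<in> M \<rightarrow>\<^sub>M noise b1 b2" shows "(\<lambda>\<omega>. g \<omega> z) \<in> M \<rightarrow>\<^sub>M count_space UNIV"
proof -
  have "(\<lambda>w. w z) \<in> noise b1 b2 \<rightarrow>\<^sub>M bern b1 b2 (snd (snd z))"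
    unfolding noise_def by (rule measurable_component_singleton) simp
  then have "(\<lambda>w. w z) \<in> noise b1 b2 \<rightarrow>\<^sub>M count_space UNIV"
    using measurable_cong_sets[OF refl sets_bern] by blast
  with assms show ?thesis by (rule measurable_compose)
qed

lemma measurable_row_noiseI:
  "(\<And>z. (\<lambda>\<omega>. f \<omega> z) \<in> M \<rightarrow>\<^sub>M count_space UNIV) \<Longrightarrow> f \<in> M \<rightarrow>\<^sub>M row_noise b1 b2"
  unfolding row_noise_def
  by (rule measurable_PiM_single') (auto simp: measurable_cong_sets[OF refl sets_bern])

lemma measurable_noiseI:
  "(\<And>z. (\<lambda>\<omega>. f \<omega> z) \<in> M \<rightarrow>\<^sub>M count_space UNIV) \<Longrightarrow> f \<in> M \<rightarrow>\<^sub>M noise b1 b2"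
  unfolding noise_def
  by (rule measurable_PiM_single') (auto simp: measurable_cong_sets[OF refl sets_bern])

lemma measurable_slice [measurable (raw)]:
  assumes [measurable]: "f \<in> M \<rightarrow>\<^sub>M noise b1 b2" shows "(\<lambda>\<omega>. slice t (f \<omega>)) \<in> M \<rightarrow>\<^sub>M row_noise b1 b2"
  unfolding slice_def by (rule measurable_row_noiseI) measurable

lemma measurable_tail [measurable (raw)]:
  assumes [measurable]: "f \<in> M \<rightarrow>\<^sub>M noise b1 b2" shows "(\<lambda>\<omega>. tail (f \<omega>)) \<in> M \<rightarrow>\<^sub>M noise b1 b2"
  unfolding tail_def by (rule measurable_noiseI) (simp add: case_prod_beta')

lemma range_row_indices:
  "inj (\<lambda>z :: int \<times> bool. (0 :: nat, z))" "inj (\<lambda>(t :: nat, z :: int \<times> bool). (Suc t, z))"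
  "range (\<lambda>z :: int \<times> bool. (0 :: nat, z)) \<inter> range (\<lambda>(t :: nat, z :: int \<times> bool). (Suc t, z)) = {}"
  "range (\<lambda>z :: int \<times> bool. (0 :: nat, z)) \<union> range (\<lambda>(t :: nat, z :: int \<times> bool). (Suc t, z)) = UNIV"
proof -
  show "range (\<lambda>z :: int \<times> bool. (0 :: nat, z)) \<union> range (\<lambda>(t :: nat, z :: int \<times> bool). (Suc t, z)) = UNIV"
  proof (rule set_eqI)
    fix s :: "nat \<times> int \<times> bool"
    obtain t z where s: "s = (t, z)" by (cases s)
    show "s \<in> range (\<lambda>z :: int \<times> bool. (0 :: nat, z)) \<union> range (\<lambda>(t :: nat, z :: int \<times> bool). (Suc t, z)) \<longleftrightarrow> s \<in> UNIV"
      unfolding s by (cases t) (auto intro: rev_image_eqI[of "(_, z)"])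
  qed
qed (auto simp: inj_on_def)

lemma cons_row_noise:
  "(\<lambda>(r, w). cons_row r w) \<in> row_noise b1 b2 \<Otimes>\<^sub>M noise b1 b2 \<rightarrow>\<^sub>M noise b1 b2"
  "distr (row_noise b1 b2 \<Otimes>\<^sub>M noise b1 b2) (noise b1 b2) (\<lambda>(r, w). cons_row r w) = noise b1 b2"
  and cons_row_noise':
  "(\<lambda>(w, r). cons_row r w) \<in> noise b1 b2 \<Otimes>\<^sub>M row_noise b1 b2 \<rightarrow>\<^sub>M noise b1 b2"
  "distr (noise b1 b2 \<Otimes>\<^sub>M row_noise b1 b2) (noise b1 b2) (\<lambda>(w, r). cons_row r w) = noise b1 b2"
proof -
  let ?f = "\<lambda>z :: int \<times> bool. (0 :: nat, z)" and ?g = "\<lambda>(t :: nat, z :: int \<times> bool). (Suc t, z)"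
  let ?N = "\<lambda>z :: nat \<times> int \<times> bool. bern b1 b2 (snd (snd z))"
  have N: "(\<Pi>\<^sub>M i\<in>UNIV. ?N (?f i)) = row_noise b1 b2" "(\<Pi>\<^sub>M l\<in>UNIV. ?N (?g l)) = noise b1 b2" "PiM UNIV ?N = noise b1 b2"
    by (simp_all add: row_noise_def noise_def case_prod_beta')
  have sw: "range ?g \<inter> range ?f = {}" "range ?g \<union> range ?f = UNIV"
    using range_row_indices(3,4) by (simp_all add: Int_commute Un_commute)
  have h: "(\<lambda>(r, w). cons_row r w) (u, v) (?f i) = u i" "(\<lambda>(r, w). cons_row r w) (u, v) (?g l) = v l" for u v i l
    by (simp_all add: cons_row_def case_prod_beta')
  have h': "(\<lambda>(w, r). cons_row r w) (v, u) (?g l) = v l" "(\<lambda>(w, r). cons_row r w) (v, u) (?f i) = u i" for u v i l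
    by (simp_all add: cons_row_def case_prod_beta')
  note G = distr_PiM_glue[of ?N ?f ?g "\<lambda>(r, w). cons_row r w", OF prob_space_bern range_row_indices(1,2,3,4) h, unfolded N]
  note G' = distr_PiM_glue[of ?N ?g ?f "\<lambda>(w, r). cons_row r w", OF prob_space_bern range_row_indices(2,1) sw h', unfolded N]
  show "(\<lambda>(r, w). cons_row r w) \<in> row_noise b1 b2 \<Otimes>\<^sub>M noise b1 b2 \<rightarrow>\<^sub>M noise b1 b2"
    "distr (row_noise b1 b2 \<Otimes>\<^sub>M noise b1 b2) (noise b1 b2) (\<lambda>(r, w). cons_row r w) = noise b1 b2"
    "(\<lambda>(w, r). cons_row r w) \<in> noise b1 b2 \<Otimes>\<^sub>M row_noise b1 b2 \<rightarrow>\<^sub>M noise b1 b2"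
    "distr (noise b1 b2 \<Otimes>\<^sub>M row_noise b1 b2) (noise b1 b2) (\<lambda>(w, r). cons_row r w) = noise b1 b2"
    using G G' by blast+
qed

lemma distr_pair_snd_distr:
  assumes A: "prob_space A" and B: "prob_space B" and g: "g \<in> B \<rightarrow>\<^sub>M C" "distr B C g = C"
  shows "A \<Otimes>\<^sub>M C = distr (A \<Otimes>\<^sub>M B) (A \<Otimes>\<^sub>M C) (\<lambda>(a, b). (a, g b))"
proof -
  have "prob_space C" using prob_space.prob_space_distr[OF B g(1)] g(2) by simp
  then have "distr A A (\<lambda>a. a) \<Otimes>\<^sub>M distr B C g = distr (A \<Otimes>\<^sub>M B) (A \<Otimes>\<^sub>M C) (\<lambda>(a, b). (a, g b))"
    using g by (intro pair_measure_distr) (auto intro: prob_space_imp_sigma_finite)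
  then show ?thesis by (simp add: distr_id g(2))
qed

text \<open>In the first form the row is kept apart from the initial data and the other rows, to be
  applied after them, as in \<open>step_distr\<close>. In the second it is grouped with the initial
  data, so that these can be replaced by their image after one step.\<close>

lemma distr_split_row:
  assumes M: "prob_space M" and F: "F \<in> M \<Otimes>\<^sub>M noise b1 b2 \<rightarrow>\<^sub>M K"
  shows "distr (M \<Otimes>\<^sub>M noise b1 b2) K F =
      distr ((M \<Otimes>\<^sub>M noise b1 b2) \<Otimes>\<^sub>M row_noise b1 b2) K (\<lambda>((a, w), r). F (a, cons_row r w))" (is "_ = ?past")
    and "distr (M \<Otimes>\<^sub>M noise b1 b2) K F =
      distr ((M \<Otimes>\<^sub>M row_noise b1 b2) \<Otimes>\<^sub>M noise b1 b2) K (\<lambda>((a, r), w). F (a, cons_row r w))" (is "_ = ?forth")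
proof -
  let ?R = "row_noise b1 b2" and ?N = "noise b1 b2"
  note pR = prob_space_row_noise[of b1 b2]
  note pN = prob_space_noise[of b1 b2]
  interpret R: prob_space ?R by (rule pR)
  interpret N: prob_space ?N by (rule pN)
  interpret RN: pair_prob_space ?R ?N ..
  interpret NR: pair_prob_space ?N ?R ..
  note [measurable] = F cons_row_noise(1) cons_row_noise'(1)
  have m1: "(\<lambda>((a, w), r). F (a, cons_row r w)) \<in> (M \<Otimes>\<^sub>M ?N) \<Otimes>\<^sub>M ?R \<rightarrow>\<^sub>M K"
    using measurable_compose[OF _ F, of "\<lambda>((a, w), r). (a, (\<lambda>(r, w). cons_row r w) (r, w))"] by (simp add: case_prod_beta')
  have m2: "(\<lambda>((a, r), w). F (a, cons_row r w)) \<in> (M \<Otimes>\<^sub>M ?R) \<Otimes>\<^sub>M ?N \<rightarrow>\<^sub>M K"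
    using measurable_compose[OF _ F, of "\<lambda>((a, r), w). (a, (\<lambda>(r, w). cons_row r w) (r, w))"] by (simp add: case_prod_beta')
  have "distr (M \<Otimes>\<^sub>M ?N) K F = distr (distr (M \<Otimes>\<^sub>M (?R \<Otimes>\<^sub>M ?N)) (M \<Otimes>\<^sub>M ?N) (\<lambda>(a, b). (a, (\<lambda>(r, w). cons_row r w) b))) K F"
    using distr_pair_snd_distr[OF M RN.prob_space_axioms cons_row_noise(1) cons_row_noise(2)] by simp
  also have "\<dots> = distr (M \<Otimes>\<^sub>M (?R \<Otimes>\<^sub>M ?N)) K (\<lambda>(a, r, w). F (a, cons_row r w))"
    by (subst distr_distr) (auto simp: comp_def case_prod_beta')
  also have "\<dots> = distr (distr (M \<Otimes>\<^sub>M (?R \<Otimes>\<^sub>M ?N)) ((M \<Otimes>\<^sub>M ?N) \<Otimes>\<^sub>M ?R) (\<lambda>(a, b, c). ((a, c), b))) K (\<lambda>((a, w), r). F (a, cons_row r w))"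
    using m1 by (subst distr_distr) (auto simp: comp_def case_prod_beta')
  also have "\<dots> = ?past" by (simp add: distr_pair_rearrange[OF M pR pN])
  finally show "distr (M \<Otimes>\<^sub>M ?N) K F = ?past" .
  have "distr (M \<Otimes>\<^sub>M ?N) K F = distr (distr (M \<Otimes>\<^sub>M (?N \<Otimes>\<^sub>M ?R)) (M \<Otimes>\<^sub>M ?N) (\<lambda>(a, b). (a, (\<lambda>(w, r). cons_row r w) b))) K F"
    using distr_pair_snd_distr[OF M NR.prob_space_axioms cons_row_noise'(1) cons_row_noise'(2)] by simp
  also have "\<dots> = distr (M \<Otimes>\<^sub>M (?N \<Otimes>\<^sub>M ?R)) K (\<lambda>(a, w, r). F (a, cons_row r w))"
    by (subst distr_distr) (auto simp: comp_def case_prod_beta')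
  also have "\<dots> = distr (distr (M \<Otimes>\<^sub>M (?N \<Otimes>\<^sub>M ?R)) ((M \<Otimes>\<^sub>M ?R) \<Otimes>\<^sub>M ?N) (\<lambda>(a, b, c). ((a, c), b))) K (\<lambda>((a, r), w). F (a, cons_row r w))"
    using m2 by (subst distr_distr) (auto simp: comp_def case_prod_beta')
  also have "\<dots> = ?forth" by (simp add: distr_pair_rearrange[OF M pN pR])
  finally show "distr (M \<Otimes>\<^sub>M ?N) K F = ?forth" .
qed

text \<open>
  Here \<open>past s \<zeta> w\<close> is the configuration at time \<open>0\<close> of the process started from \<open>\<zeta>\<close> at time \<open>-s\<close>,
  where \<open>slice t w\<close> is the noise between the times \<open>-t-1\<close> and \<open>-t\<close>.
\<close>
primrec past :: "nat \<Rightarrow> (int \<Rightarrow> nat) \<Rightarrow> (nat \<times> int \<times> bool \<Rightarrow> bool) \<Rightarrow> int \<Rightarrow> nat" where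
  "past 0 \<zeta> w = \<zeta>"
| "past (Suc s) \<zeta> w = row (slice 0 w) (past s \<zeta> (tail w))"

primrec evol :: "nat \<Rightarrow> (int \<Rightarrow> nat) \<Rightarrow> (nat \<times> int \<times> bool \<Rightarrow> bool) \<Rightarrow> int \<Rightarrow> nat" where
  "evol 0 \<eta> w = \<eta>"
| "evol (Suc t) \<eta> w = row (slice t w) (evol t \<eta> w)"

lemma evol_Suc_tail: "evol (Suc t) \<eta> w = evol t (row (slice 0 w) \<eta>) (tail w)"
  by (induction t) auto

lemma measurable_past [measurable (raw)]:
  "f \<in> M \<rightarrow>\<^sub>M config_space n \<Longrightarrow> g \<in> M \<rightarrow>\<^sub>M noise b1 b2 \<Longrightarrow> (\<lambda>\<omega>. past s (f \<omega>) (g \<omega>)) \<in> M \<rightarrow>\<^sub>M config_space n"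
proof (induction s arbitrary: g)
  case (Suc s)
  note [measurable] = Suc.prems
  have [measurable]: "(\<lambda>\<omega>. past s (f \<omega>) (tail (g \<omega>))) \<in> M \<rightarrow>\<^sub>M config_space n" by (intro Suc.IH) measurable
  show ?case unfolding past.simps by measurable
qed simp

lemma measurable_evol [measurable (raw)]:
  "f \<in> M \<rightarrow>\<^sub>M config_space n \<Longrightarrow> g \<in> M \<rightarrow>\<^sub>M noise b1 b2 \<Longrightarrow> (\<lambda>\<omega>. evol t (f \<omega>) (g \<omega>)) \<in> M \<rightarrow>\<^sub>M config_space n"
proof (induction t)
  case (Suc t)
  note [measurable] = Suc
  show ?case unfolding evol.simps by measurable
qed simp

lemma distr_evol:
  assumes "prob_space \<mu>" "sets \<mu> = sets (config_space n)"
  shows "distr (\<mu> \<Otimes>\<^sub>M noise b1 b2) (config_space n) (\<lambda>(\<eta>, w). evol t \<eta> w) = (step n b1 b2 ^^ t) \<mu>"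
  using assms
proof (induction t arbitrary: \<mu>)
  case 0
  interpret prob_space "noise b1 b2" by (rule prob_space_noise)
  have "distr (\<mu> \<Otimes>\<^sub>M noise b1 b2) (config_space n) fst = distr (\<mu> \<Otimes>\<^sub>M noise b1 b2) \<mu> fst"
    using 0 by (intro distr_cong) auto
  then show ?case by (simp add: case_prod_beta' distr_pair_fst)
next
  case (Suc t)
  note [measurable_cong] = Suc.prems(2)
  interpret \<mu>: prob_space \<mu> by (rule Suc.prems)
  interpret R: prob_space "row_noise b1 b2" by (rule prob_space_row_noise)
  interpret pair_prob_space \<mu> "row_noise b1 b2" ..
  have m: "(\<lambda>(\<eta>, r). row r \<eta>) \<in> \<mu> \<Otimes>\<^sub>M row_noise b1 b2 \<rightarrow>\<^sub>M config_space n" by measurable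
  interpret N: prob_space "noise b1 b2" by (rule prob_space_noise)
  have "distr (\<mu> \<Otimes>\<^sub>M noise b1 b2) (config_space n) (\<lambda>(\<eta>, w). evol (Suc t) \<eta> w) =
    distr ((\<mu> \<Otimes>\<^sub>M row_noise b1 b2) \<Otimes>\<^sub>M noise b1 b2) (config_space n) (\<lambda>((\<eta>, r), w). evol t (row r \<eta>) w)"
    by (subst distr_split_row(2)[OF Suc.prems(1)]) (measurable, simp add: evol_Suc_tail del: evol.simps)
  also have "\<dots> = distr (step n b1 b2 \<mu> \<Otimes>\<^sub>M noise b1 b2) (config_space n) (\<lambda>(\<eta>, w). evol t \<eta> w)"
    unfolding step_def distr_pair_map_fst[OF prob_space_noise m]
    using m by (subst distr_distr) (auto simp: comp_def case_prod_beta')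
  also have "\<dots> = (step n b1 b2 ^^ t) (step n b1 b2 \<mu>)"
    using Suc.prems by (intro Suc.IH prob_space_step) auto
  finally show ?case by (simp add: funpow_swap1)
qed

section \<open>Existence\<close>

definition shift_noise :: "(nat \<times> int \<times> bool \<Rightarrow> bool) \<Rightarrow> nat \<times> int \<times> bool \<Rightarrow> bool" where
  "shift_noise w = (\<lambda>(t, x, i). w (t, x + 1, i))"

text \<open>Only space is translated. Finite index sets have bounded space coordinates and are
  eventually separated, although their times do not move.\<close>

lemma measure_preserving_shift_noise: "measure_preserving (noise b1 b2) shift_noise"
  and mixing_shift_noise: "measure_preserving.mixing (noise b1 b2) shift_noise"
proof -
  define \<tau> where "\<tau> = (\<lambda>(t :: nat, x :: int, i :: bool). (t, x + 1, i))"
  have sh: "shift_noise = (\<lambda>w z. w (\<tau> z))" by (auto simp: shift_noise_def \<tau>_def fun_eq_iff)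
  have \<tau>: "inj \<tau>" "snd (snd (\<tau> z)) = snd (snd z)" for z by (auto simp: \<tau>_def inj_on_def case_prod_beta')
  have pow: "(\<tau> ^^ m) (t, x, i) = (t, x + int m, i)" for m t x i
    by (induction m) (auto simp: \<tau>_def)
  show "measure_preserving (noise b1 b2) shift_noise"
    unfolding noise_def sh by (rule measure_preserving_PiM) (simp_all add: prob_space_bern \<tau>)
  show "measure_preserving.mixing (noise b1 b2) shift_noise"
    unfolding noise_def sh
  proof (rule mixing_PiM)
    fix J K :: "(nat \<times> int \<times> bool) set" assume "finite J" "finite K"
    then have "finite ((\<lambda>z. fst (snd z)) ` J)" "finite ((\<lambda>z. fst (snd z)) ` K)" by auto
    then obtain a b where ab: "\<forall>x\<in>(\<lambda>z. fst (snd z)) ` J. x \<le> a" "\<forall>x\<in>(\<lambda>z. fst (snd z)) ` K. b \<le> x"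
      by (meson bdd_above.unfold bdd_above_finite bdd_below.unfold bdd_below_finite)
    have "J \<inter> (\<tau> ^^ m) ` K = {}" if "m \<ge> nat (a - b + 1)" for m
    proof -
      have "fst (snd ((\<tau> ^^ m) z)) > a" if "z \<in> K" for z
      proof -
        obtain t x i where z: "z = (t, x, i)" by (cases z)
        have "b \<le> x" using bspec[OF ab(2) imageI[OF that]] by (simp add: z)
        then show ?thesis using \<open>m \<ge> nat (a - b + 1)\<close> by (simp add: z pow)
      qed
      moreover have "fst (snd z) \<le> a" if "z \<in> J" for z using bspec[OF ab(1) imageI[OF that]] by simp
      ultimately show ?thesis by fastforce
    qed
    then show "\<forall>\<^sub>F m in sequentially. J \<inter> (\<tau> ^^ m) ` K = {}"
      by (auto simp: eventually_sequentially)
  qed (simp_all add: prob_space_bern \<tau>)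
qed

locale multi_species =
  fixes n :: nat and b1 b2 :: real and lam :: "nat \<Rightarrow> real"
  assumes b: "0 < b1" "b1 < 1" "0 < b2" "b2 < 1" and lam: "prob_weights n lam"
begin

abbreviation "Z \<equiv> iid n lam"
abbreviation "N \<equiv> noise b1 b2"
abbreviation "\<Omega> \<equiv> Z \<Otimes>\<^sub>M N"

definition \<theta> :: "(int \<Rightarrow> nat) \<times> (nat \<times> int \<times> bool \<Rightarrow> bool) \<Rightarrow> (int \<Rightarrow> nat) \<times> (nat \<times> int \<times> bool \<Rightarrow> bool)" where
  "\<theta> = (\<lambda>(\<zeta>, w). (translate 1 \<zeta>, shift_noise w))"

sublocale Z: measure_preserving Z "translate 1" using lam by (rule measure_preserving_iid)

sublocale N: measure_preserving N shift_noise by (rule measure_preserving_shift_noise)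

sublocale \<Omega>: measure_preserving \<Omega> \<theta>
  unfolding \<theta>_def by (rule measure_preserving_pair) unfold_locales

lemma ergodic_\<Omega>: "\<Omega>.ergodic"
proof (rule \<Omega>.mixing_imp_ergodic)
  show "\<Omega>.mixing" unfolding \<theta>_def
    by (rule mixing_pair[OF measure_preserving_iid[OF lam] mixing_iid[OF lam] measure_preserving_shift_noise mixing_shift_noise])
qed

text \<open>All starting times use the same \<zeta> and the same noise, so the whole sequence lives
  on one space and almost sure convergence makes sense.\<close>

definition X :: "nat \<Rightarrow> (int \<Rightarrow> nat) \<times> (nat \<times> int \<times> bool \<Rightarrow> bool) \<Rightarrow> int \<Rightarrow> nat" where
  "X s \<omega> = past s (fst \<omega>) (snd \<omega>)"

lemma measurable_X [measurable]: "X s \<in> \<Omega> \<rightarrow>\<^sub>M config_space n"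
  unfolding X_def by measurable

lemma X_shift: "X s (\<theta> \<omega>) = translate 1 (X s \<omega>)"
proof -
  have "past s (translate 1 \<zeta>) (shift_noise w) = translate 1 (past s \<zeta> w)" for \<zeta> w
  proof (induction s arbitrary: w)
    case (Suc s)
    have "slice 0 (shift_noise w) = shift_row (slice 0 w)" "tail (shift_noise w) = shift_noise (tail w)"
      by (auto simp: slice_def tail_def shift_noise_def shift_row_def fun_eq_iff)
    then show ?case by (simp add: Suc row_shift)
  qed simp
  then show ?thesis by (simp add: X_def \<theta>_def case_prod_beta')
qed

definition law :: "nat \<Rightarrow> (int \<Rightarrow> nat) measure" where
  "law s = distr \<Omega> (config_space n) (X s)"

lemma law_0: "law 0 = Z"
proof -
  have "law 0 = distr \<Omega> Z fst" unfolding law_def by (intro distr_cong) (auto simp: sets_iid X_def)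
  then show ?thesis by (simp add: N.distr_pair_fst)
qed

lemma law_Suc: "law (Suc s) = step n b1 b2 (law s)"
proof -
  have "law (Suc s) = distr (\<Omega> \<Otimes>\<^sub>M row_noise b1 b2) (config_space n) (\<lambda>((a, w), r). X (Suc s) (a, cons_row r w))"
    unfolding law_def by (rule distr_split_row(1)) (unfold_locales, measurable)
  also have "\<dots> = distr (\<Omega> \<Otimes>\<^sub>M row_noise b1 b2) (config_space n) (\<lambda>(\<omega>, r). row r (X s \<omega>))"
    by (simp add: X_def case_prod_beta')
  also have "\<dots> = step n b1 b2 (law s)"
    unfolding law_def by (rule step_distr[symmetric]) measurable
  finally show ?thesis .
qed

lemma sets_law [measurable_cong]: "sets (law s) = sets (config_space n)"
  by (simp add: law_def)

lemma prob_space_law: "prob_space (law s)"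
  unfolding law_def by (rule \<Omega>.prob_space_distr) measurable

definition joint_law :: "nat \<Rightarrow> nat \<Rightarrow> ((int \<Rightarrow> nat) \<times> (int \<Rightarrow> nat)) measure" where
  "joint_law s r = distr \<Omega> (pair_space n) (\<lambda>\<omega>. (X s \<omega>, X (s + r) \<omega>))"

lemma measurable_X_pair [measurable]: "(\<lambda>\<omega>. (X s \<omega>, X t \<omega>)) \<in> \<Omega> \<rightarrow>\<^sub>M pair_space n"
  unfolding pair_space_def by measurable

text \<open>Both processes use the same latest row. Hence r enters only through the initial coupling
  of \<zeta> with \<open>X r\<close>, and s counts the steps made after it.\<close>

lemma joint_law_Suc: "joint_law (Suc s) r = step_pair n b1 b2 (joint_law s r)"
proof -
  have "joint_law (Suc s) r = distr (\<Omega> \<Otimes>\<^sub>M row_noise b1 b2) (pair_space n)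
    (\<lambda>((a, w), c). (X (Suc s) (a, cons_row c w), X (Suc s + r) (a, cons_row c w)))"
    unfolding joint_law_def by (rule distr_split_row(1)) (unfold_locales, measurable)
  also have "\<dots> = distr (\<Omega> \<Otimes>\<^sub>M row_noise b1 b2) (pair_space n) (\<lambda>(\<omega>, c). row_pair c (X s \<omega>, X (s + r) \<omega>))"
    by (simp add: X_def case_prod_beta' row_pair_def)
  also have "\<dots> = step_pair n b1 b2 (joint_law s r)"
    unfolding joint_law_def by (rule step_pair_distr[symmetric]) measurable
  finally show ?thesis .
qed

lemma joint_law_eq: "joint_law s r = (step_pair n b1 b2 ^^ s) (joint_law 0 r)"
  by (induction s) (simp_all add: joint_law_Suc)

lemma measure_preserving_pair_law:
  assumes f [measurable]: "f \<in> \<Omega> \<rightarrow>\<^sub>M config_space n" and g [measurable]: "g \<in> \<Omega> \<rightarrow>\<^sub>M config_space n"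
    and eq: "\<And>\<omega>. f (\<theta> \<omega>) = translate 1 (f \<omega>)" "\<And>\<omega>. g (\<theta> \<omega>) = translate 1 (g \<omega>)"
  shows "measure_preserving (distr \<Omega> (pair_space n) (\<lambda>\<omega>. (f \<omega>, g \<omega>))) shift_pair"
proof (rule \<Omega>.measure_preserving_distr)
  show "(\<lambda>\<omega>. (f \<omega>, g \<omega>)) \<in> \<Omega> \<rightarrow>\<^sub>M pair_space n" unfolding pair_space_def by measurable
  show "shift_pair \<in> pair_space n \<rightarrow>\<^sub>M pair_space n" by measurable
qed (simp add: shift_pair_def eq)

definition \<rho> :: "nat \<Rightarrow> real" where
  "\<rho> k = (\<Sum>j\<le>k. lam j)"

lemma \<rho>_bounds: "k \<le> n \<Longrightarrow> 0 \<le> \<rho> k \<and> \<rho> k \<le> 1"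
proof -
  assume k: "k \<le> n"
  have "\<rho> k \<le> (\<Sum>j\<le>n. lam j)"
    unfolding \<rho>_def using lam k by (intro sum_mono2) (auto simp: prob_weights_def)
  moreover have "0 \<le> \<rho> k" unfolding \<rho>_def using lam k by (intro sum_nonneg) (auto simp: prob_weights_def)
  ultimately show ?thesis using lam by (simp add: prob_weights_def)
qed

text \<open>Thresholding commutes with the dynamics, and the thresholded initial law is a stationary
  Bernoulli measure.\<close>

lemma merge_law:
  assumes "k \<le> n"
  shows "distr (law s) (config_space (Suc 0)) (merge k) = iid (Suc 0) (two_weights (\<rho> k))"
proof (induction s)
  case 0 then show ?case using distr_merge_iid[OF lam assms] by (simp add: law_0 \<rho>_def)
next
  case (Suc s)
  have "burke b1 b2 (\<rho> k)" using b \<rho>_bounds[OF assms] by unfold_locales auto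
  then show ?case
    using Suc by (simp add: law_Suc distr_merge_step[OF prob_space_law sets_law] burke.step_iid)
qed

lemma prob_law_le:
  assumes k: "k \<le> n"
  shows "measure (law s) (cylinder n {x} (\<lambda>_. {..k})) = \<rho> k"
proof -
  have w: "prob_weights (Suc 0) (two_weights (\<rho> k))"
    using prob_weights_two \<rho>_bounds[OF k] by simp
  have m: "merge k \<in> law s \<rightarrow>\<^sub>M config_space (Suc 0)" by measurable
  have "merge k -` cylinder (Suc 0) {x} (\<lambda>_. {0}) \<inter> space (law s) = cylinder n {x} (\<lambda>_. {..k})"
    using sets_eq_imp_space_eq[OF sets_law, of s]
    by (auto simp: cylinder_def space_config_space merge_def thr_def split: if_splits)
  then have "measure (law s) (cylinder n {x} (\<lambda>_. {..k})) =
    measure (distr (law s) (config_space (Suc 0)) (merge k)) (cylinder (Suc 0) {x} (\<lambda>_. {0}))"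
    using m by (simp add: measure_distr measurable_cylinder)
  also have "\<dots> = \<rho> k"
    by (simp add: merge_law[OF k] measure_iid_cylinder[OF w] two_weights_def)
  finally show ?thesis .
qed

lemma deviation_law: "k \<le> n \<Longrightarrow> deviation k (\<rho> k) L (law s) = deviation 0 (\<rho> k) L (iid (Suc 0) (two_weights (\<rho> k)))"
  by (simp add: deviation_merge[OF sets_law] merge_law)

lemma deviation_iid_tendsto_0:
  assumes k: "k \<le> n"
  shows "(\<lambda>L. deviation 0 (\<rho> k) L (iid (Suc 0) (two_weights (\<rho> k)))) \<longlonglongrightarrow> 0"
proof -
  have w: "prob_weights (Suc 0) (two_weights (\<rho> k))"
    using prob_weights_two \<rho>_bounds[OF k] by simp
  interpret I: measure_preserving "iid (Suc 0) (two_weights (\<rho> k))" "translate 1" by (rule measure_preserving_iid[OF w])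
  have "{\<eta> \<in> space (iid (Suc 0) (two_weights (\<rho> k))). \<eta> 0 \<le> 0} = cylinder (Suc 0) {0} (\<lambda>_. {0})"
    using sets_eq_imp_space_eq[OF sets_iid, of "Suc 0" "two_weights (\<rho> k)"] by (auto simp: cylinder_def)
  then have "I.prob {\<eta> \<in> space (iid (Suc 0) (two_weights (\<rho> k))). \<eta> 0 \<le> 0} = \<rho> k"
    by (simp add: measure_iid_cylinder[OF w] two_weights_def)
  then show ?thesis
    using deviation_tendsto_0[OF I.measure_preserving_axioms I.mixing_imp_ergodic[OF mixing_iid[OF w]] sets_iid, of 0]
    by simp
qed

text \<open>Both marginals have, at all times, the particle fluctuations of the same Bernoulli
  measure. One bound e thus fits all r, and the uniform decay time can be used.\<close>

lemma prob_disc_joint_law: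
  assumes k: "k \<le> n" and \<epsilon>: "0 < \<epsilon>"
  shows "\<exists>S. \<forall>s\<ge>S. \<forall>r. prob_disc k (joint_law s r) \<le> \<epsilon>"
proof -
  define e where "e L = deviation 0 (\<rho> k) L (iid (Suc 0) (two_weights (\<rho> k)))" for L
  have e: "e \<longlonglongrightarrow> 0" unfolding e_def by (rule deviation_iid_tendsto_0[OF k])
  obtain S where S: "\<And>s Q. s \<ge> S \<Longrightarrow> measure_preserving Q shift_pair \<Longrightarrow> sets Q = sets (pair_space n) \<Longrightarrow>
    (\<forall>t L. deviation k (\<rho> k) L ((step n b1 b2 ^^ t) (distr Q (config_space n) fst)) \<le> e L \<and>
       deviation k (\<rho> k) L ((step n b1 b2 ^^ t) (distr Q (config_space n) snd)) \<le> e L) \<Longrightarrow>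
    prob_disc k ((step_pair n b1 b2 ^^ s) Q) \<le> \<epsilon>"
    using coupling_decay[OF b e \<epsilon>, of n k "\<rho> k"] by blast
  have "prob_disc k (joint_law s r) \<le> \<epsilon>" if "s \<ge> S" for s r
    unfolding joint_law_eq[of s]
  proof (rule S[OF that])
    show "measure_preserving (joint_law 0 r) shift_pair"
      unfolding joint_law_def by (rule measure_preserving_pair_law) (simp_all add: X_shift)
    show "sets (joint_law 0 r) = sets (pair_space n)" by (simp add: joint_law_def)
    have [measurable]: "fst \<in> pair_space n \<rightarrow>\<^sub>M config_space n" "snd \<in> pair_space n \<rightarrow>\<^sub>M config_space n" by measurable
    have "distr (joint_law 0 r) (config_space n) fst = law 0" "distr (joint_law 0 r) (config_space n) snd = law r"
      unfolding joint_law_def law_def by (subst distr_distr; simp add: comp_def)+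
    moreover have "(step n b1 b2 ^^ t) (law s) = law (t + s)" for t s by (induction t) (simp_all add: law_Suc)
    ultimately show "\<forall>t L. deviation k (\<rho> k) L ((step n b1 b2 ^^ t) (distr (joint_law 0 r) (config_space n) fst)) \<le> e L \<and>
       deviation k (\<rho> k) L ((step n b1 b2 ^^ t) (distr (joint_law 0 r) (config_space n) snd)) \<le> e L"
      by (simp add: deviation_law[OF k] e_def)
  qed
  then show ?thesis by blast
qed

lemma prob_pair_law:
  assumes f [measurable]: "f \<in> \<Omega> \<rightarrow>\<^sub>M config_space n" and g [measurable]: "g \<in> \<Omega> \<rightarrow>\<^sub>M config_space n"
    and P [measurable]: "Measurable.pred (pair_space n) P"
  shows "measure (distr \<Omega> (pair_space n) (\<lambda>\<omega>. (f \<omega>, g \<omega>)))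
      {p \<in> space (distr \<Omega> (pair_space n) (\<lambda>\<omega>. (f \<omega>, g \<omega>))). P p} = \<P>(\<omega> in \<Omega>. P (f \<omega>, g \<omega>))"
proof -
  have m: "(\<lambda>\<omega>. (f \<omega>, g \<omega>)) \<in> \<Omega> \<rightarrow>\<^sub>M pair_space n" unfolding pair_space_def by measurable
  have "(\<lambda>\<omega>. (f \<omega>, g \<omega>)) -` {p \<in> space (pair_space n). P p} \<inter> space \<Omega> = {\<omega> \<in> space \<Omega>. P (f \<omega>, g \<omega>)}"
    using measurable_space[OF m] by auto
  then show ?thesis using m by (simp add: measure_distr)
qed

lemma prob_X_neq:
  assumes \<epsilon>: "0 < \<epsilon>"
  shows "\<exists>S. \<forall>s\<ge>S. \<forall>r x. \<P>(\<omega> in \<Omega>. X s \<omega> x \<noteq> X (s + r) \<omega> x) \<le> \<epsilon>"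
proof -
  \<comment> \<open>The n thresholds share \<epsilon>; the denominator n + 1 stays positive.\<close>
  have "\<forall>k. \<exists>S. k < n \<longrightarrow> (\<forall>s\<ge>S. \<forall>r. prob_disc k (joint_law s r) \<le> \<epsilon> / (n + 1))"
    using prob_disc_joint_law[where \<epsilon> = "\<epsilon> / (n + 1)"] \<epsilon> by (simp add: less_imp_le)
  then obtain S where S: "\<And>k s r. k < n \<Longrightarrow> s \<ge> S k \<Longrightarrow> prob_disc k (joint_law s r) \<le> \<epsilon> / (n + 1)" by metis
  define S' where "S' = (\<Sum>k<n. S k)"
  have le: "S k \<le> S'" if "k < n" for k unfolding S'_def using that by (intro member_le_sum) auto
  have "\<P>(\<omega> in \<Omega>. X s \<omega> x \<noteq> X (s + r) \<omega> x) \<le> \<epsilon>" if "s \<ge> S'" for s r x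
  proof -
    have "\<P>(\<omega> in \<Omega>. X s \<omega> x \<noteq> X (s + r) \<omega> x) = measure (joint_law s r) {p \<in> space (joint_law s r). fst p x \<noteq> snd p x}"
      unfolding joint_law_def by (subst prob_pair_law) simp_all
    also have "\<dots> \<le> (\<Sum>k<n. prob_disc k (joint_law s r))"
      by (rule prob_neq_le)
        (simp_all add: joint_law_def measure_preserving_pair_law X_shift)
    also have "\<dots> \<le> (\<Sum>k<n. \<epsilon> / (n + 1))"
      using S le \<open>s \<ge> S'\<close> by (intro sum_mono) (meson lessThan_iff order_trans)
    also have "\<dots> \<le> \<epsilon>" using \<epsilon> by (simp add: field_simps)
    finally show ?thesis .
  qed
  then show ?thesis by blast
qed

section \<open>The almost sure limit of the processes started in the past\<close>

definition \<sigma> :: "nat \<Rightarrow> nat" where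
  "\<sigma> = (SOME \<sigma>. mono \<sigma> \<and> (\<forall>j s r x. s \<ge> \<sigma> j \<longrightarrow> \<P>(\<omega> in \<Omega>. X s \<omega> x \<noteq> X (s + r) \<omega> x) \<le> (1 / 2) ^ j))"

text \<open>The bounds are summable, as Borel-Cantelli requires. Monotonicity lets
  \<open>\<sigma> (Suc j)\<close> be written as \<sigma> j + r, and partial sums of arbitrary
  admissible times provide it.\<close>

lemma mono_\<sigma>: "mono \<sigma>"
  and \<sigma>: "s \<ge> \<sigma> j \<Longrightarrow> \<P>(\<omega> in \<Omega>. X s \<omega> x \<noteq> X (s + r) \<omega> x) \<le> (1 / 2) ^ j"
proof -
  have "\<forall>j. \<exists>S. \<forall>s\<ge>S. \<forall>r x. \<P>(\<omega> in \<Omega>. X s \<omega> x \<noteq> X (s + r) \<omega> x) \<le> (1 / 2) ^ j"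
    using prob_X_neq by simp
  from choice[OF this] obtain S where
    S: "\<forall>j. \<forall>s\<ge>S j. \<forall>r x. \<P>(\<omega> in \<Omega>. X s \<omega> x \<noteq> X (s + r) \<omega> x) \<le> (1 / 2) ^ j" by blast
  define S' where "S' j = (\<Sum>i\<le>j. S i)" for j
  have "mono S'" by (rule monoI) (simp add: S'_def sum_mono2)
  moreover have "S j \<le> S' j" for j unfolding S'_def by (intro member_le_sum) auto
  ultimately have "mono S' \<and> (\<forall>j s r x. s \<ge> S' j \<longrightarrow> \<P>(\<omega> in \<Omega>. X s \<omega> x \<noteq> X (s + r) \<omega> x) \<le> (1 / 2) ^ j)"
    using S by (meson order_trans)
  then have "\<exists>\<sigma>. mono \<sigma> \<and> (\<forall>j s r x. s \<ge> \<sigma> j \<longrightarrow> \<P>(\<omega> in \<Omega>. X s \<omega> x \<noteq> X (s + r) \<omega> x) \<le> (1 / 2) ^ j)"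
    by (rule exI[of _ S'])
  then have *: "mono \<sigma> \<and> (\<forall>j s r x. s \<ge> \<sigma> j \<longrightarrow> \<P>(\<omega> in \<Omega>. X s \<omega> x \<noteq> X (s + r) \<omega> x) \<le> (1 / 2) ^ j)"
    unfolding \<sigma>_def by (rule someI_ex)
  show "mono \<sigma>" using * by blast
  show "s \<ge> \<sigma> j \<Longrightarrow> \<P>(\<omega> in \<Omega>. X s \<omega> x \<noteq> X (s + r) \<omega> x) \<le> (1 / 2) ^ j" using * by blast
qed

text \<open>
  The eventual value of \<open>X (\<sigma> j) \<omega> x\<close>, which exists almost surely; on the exceptional set \<open>LEAST\<close>
  is an arbitrary number, which does not affect range, measurability and translation covariance.
\<close>
definition Xlim :: "(int \<Rightarrow> nat) \<times> (nat \<times> int \<times> bool \<Rightarrow> bool) \<Rightarrow> int \<Rightarrow> nat" where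
  "Xlim \<omega> x = X (\<sigma> (LEAST J. \<forall>j\<ge>J. X (\<sigma> j) \<omega> x = X (\<sigma> J) \<omega> x)) \<omega> x"

lemma measurable_Xlim [measurable]: "Xlim \<in> \<Omega> \<rightarrow>\<^sub>M config_space n"
proof (rule measurable_config_spaceI)
  fix x
  have [measurable]: "(\<lambda>\<omega>. LEAST J. \<forall>j\<ge>J. X (\<sigma> j) \<omega> x = X (\<sigma> J) \<omega> x) \<in> \<Omega> \<rightarrow>\<^sub>M count_space UNIV" by measurable
  show "(\<lambda>\<omega>. Xlim \<omega> x) \<in> \<Omega> \<rightarrow>\<^sub>M count_space UNIV"
    unfolding Xlim_def
    by (rule measurable_compose_countable[where g = "\<lambda>\<omega>. LEAST J. \<forall>j\<ge>J. X (\<sigma> j) \<omega> x = X (\<sigma> J) \<omega> x"]) measurable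
next
  fix \<omega> x assume "\<omega> \<in> space \<Omega>"
  then have "X s \<omega> \<in> space (config_space n)" for s by (rule measurable_space[OF measurable_X])
  then show "Xlim \<omega> x \<le> n" unfolding Xlim_def by (simp add: space_config_space)
qed

lemma Xlim_shift: "Xlim (\<theta> \<omega>) = translate 1 (Xlim \<omega>)"
  by (rule ext) (simp add: Xlim_def X_shift translate_def)

text \<open>By Borel-Cantelli only finitely many changes between consecutive j occur at x, so the
  sequence of classes is eventually constant.\<close>

lemma AE_Xlim: "AE \<omega> in \<Omega>. eventually (\<lambda>j. X (\<sigma> j) \<omega> x = Xlim \<omega> x) sequentially"
proof -
  define A where "A j = {\<omega> \<in> space \<Omega>. X (\<sigma> j) \<omega> x \<noteq> X (\<sigma> (Suc j)) \<omega> x}" for j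
  have [measurable]: "A j \<in> \<Omega>.events" for j unfolding A_def by measurable
  have A: "\<Omega>.prob (A j) \<le> (1 / 2) ^ j" for j
  proof -
    have "\<sigma> (Suc j) = \<sigma> j + (\<sigma> (Suc j) - \<sigma> j)" using monoD[OF mono_\<sigma>, of j "Suc j"] by simp
    then show ?thesis unfolding A_def using \<sigma>[of j "\<sigma> j" x "\<sigma> (Suc j) - \<sigma> j"] by simp
  qed
  have "AE \<omega> in \<Omega>. eventually (\<lambda>j. \<omega> \<in> space \<Omega> - A j) sequentially"
  proof (rule borel_cantelli_AE1)
    show "summable (\<lambda>j. measure \<Omega> (A j))"
      by (rule summable_comparison_test[of _ "\<lambda>j. (1 / 2 :: real) ^ j"]) (use A in \<open>auto simp: summable_geometric\<close>)
  qed (auto simp: less_top[symmetric])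
  then show ?thesis
  proof eventually_elim
    case (elim \<omega>)
    then obtain J0 where J0: "\<And>j. j \<ge> J0 \<Longrightarrow> \<omega> \<in> space \<Omega> - A j" by (auto simp: eventually_sequentially)
    have "X (\<sigma> j) \<omega> x = X (\<sigma> J0) \<omega> x" if "j \<ge> J0" for j
      using that
    proof (induction j rule: dec_induct)
      case (step j) then show ?case using J0[of j] by (auto simp: A_def)
    qed simp
    then have "\<exists>J. \<forall>j\<ge>J. X (\<sigma> j) \<omega> x = X (\<sigma> J) \<omega> x" by blast
    then have "\<forall>j\<ge>(LEAST J. \<forall>j\<ge>J. X (\<sigma> j) \<omega> x = X (\<sigma> J) \<omega> x). X (\<sigma> j) \<omega> x = Xlim \<omega> x"
      unfolding Xlim_def by (rule LeastI_ex)
    then show ?case unfolding eventually_sequentially by blast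
  qed
qed

lemma prob_Xlim_neq: "(\<lambda>j. \<P>(\<omega> in \<Omega>. Xlim \<omega> x \<noteq> X (\<sigma> j) \<omega> x)) \<longlonglongrightarrow> 0"
proof -
  define A where "A j = {\<omega> \<in> space \<Omega>. Xlim \<omega> x \<noteq> X (\<sigma> j) \<omega> x}" for j
  have [measurable]: "A j \<in> \<Omega>.events" for j unfolding A_def by measurable
  have "(\<lambda>j. \<Omega>.expectation (indicator (A j) :: _ \<Rightarrow> real)) \<longlonglongrightarrow> \<Omega>.expectation (\<lambda>_. 0)"
  proof (rule integral_dominated_convergence[where w = "\<lambda>_. 1"])
    show "AE \<omega> in \<Omega>. (\<lambda>j. indicator (A j) \<omega> :: real) \<longlonglongrightarrow> 0"
      using AE_Xlim[of x]
    proof eventually_elim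
      case (elim \<omega>)
      then have "eventually (\<lambda>j. (indicator (A j) \<omega> :: real) = 0) sequentially"
        by eventually_elim (simp add: A_def)
      then show ?case by (rule tendsto_eventually)
    qed
  qed (auto simp: indicator_def)
  then show ?thesis by (simp add: A_def)
qed

definition \<mu> :: "(int \<Rightarrow> nat) measure" where
  "\<mu> = distr \<Omega> (config_space n) Xlim"

lemma sets_\<mu> [measurable_cong]: "sets \<mu> = sets (config_space n)"
  by (simp add: \<mu>_def)

lemma measure_preserving_\<mu>: "measure_preserving \<mu> (translate 1)"
  unfolding \<mu>_def by (rule \<Omega>.measure_preserving_distr) (measurable, simp add: Xlim_shift)

lemma ergodic_\<mu>: "measure_preserving.ergodic \<mu> (translate 1)"
  unfolding \<mu>_def by (rule \<Omega>.ergodic_distr[OF ergodic_\<Omega>]) (measurable, simp add: Xlim_shift)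

lemma law_cylinder_tendsto:
  assumes J: "finite J"
  shows "(\<lambda>j. measure (law (\<sigma> j)) (cylinder n J Y)) \<longlonglongrightarrow> measure \<mu> (cylinder n J Y)"
proof -
  have "(\<lambda>j. \<Sum>x\<in>J. \<P>(\<omega> in \<Omega>. Xlim \<omega> x \<noteq> X (\<sigma> j) \<omega> x)) \<longlonglongrightarrow> (\<Sum>x\<in>J. 0)"
    by (intro tendsto_sum prob_Xlim_neq)
  then have lim0: "(\<lambda>j. \<Sum>x\<in>J. \<P>(\<omega> in \<Omega>. Xlim \<omega> x \<noteq> X (\<sigma> j) \<omega> x)) \<longlonglongrightarrow> 0"
    by simp
  have "norm (measure \<mu> (cylinder n J Y) - measure (law (\<sigma> j)) (cylinder n J Y)) \<le>
      (\<Sum>x\<in>J. \<P>(\<omega> in \<Omega>. Xlim \<omega> x \<noteq> X (\<sigma> j) \<omega> x))" for j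
    unfolding \<mu>_def law_def real_norm_def by (rule \<Omega>.coupling_cylinder[OF measurable_Xlim measurable_X J])
  then have "(\<lambda>j. measure \<mu> (cylinder n J Y) - measure (law (\<sigma> j)) (cylinder n J Y)) \<longlonglongrightarrow> 0"
    by (rule Lim_null_comparison[OF always_eventually[OF allI] lim0])
  from tendsto_diff[OF tendsto_const[of "measure \<mu> (cylinder n J Y)"] this] show ?thesis by simp
qed

lemma prob_\<mu>_le: "k \<le> n \<Longrightarrow> measure \<mu> (cylinder n {x} (\<lambda>_. {..k})) = \<rho> k"
  using law_cylinder_tendsto[of "{x}" "\<lambda>_. {..k}"] by (simp add: prob_law_le LIMSEQ_const_iff)

text \<open>A row reaches arbitrarily far to the left, so convergence on cylinders is not simply
  pushed through \<open>step\<close>. Instead \<open>Xlim\<close> and \<open>X (\<sigma> j)\<close>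
  make one step with common noise, which does not increase the density of discrepancies; the law
  after this step is close to \<open>law (\<sigma> j)\<close>, which converges to \<mu>.\<close>

lemma step_\<mu>: "step n b1 b2 \<mu> = \<mu>"
proof (rule config_measure_eqI)
  fix J :: "int set" and Y assume J: "finite J"
  define Q where "Q j = distr \<Omega> (pair_space n) (\<lambda>\<omega>. (Xlim \<omega>, X (\<sigma> j) \<omega>))" for j
  have mQ [measurable]: "(\<lambda>\<omega>. (Xlim \<omega>, X (\<sigma> j) \<omega>)) \<in> \<Omega> \<rightarrow>\<^sub>M pair_space n" for j
    unfolding pair_space_def by measurable
  have coup: "coupled_row (Q j) n b1 b2" for j
    using b by (simp add: coupled_row_def coupled_row_axioms_def Q_def measure_preserving_pair_law Xlim_shift X_shift)
  have margins: "distr (step_pair n b1 b2 (Q j)) (config_space n) fst = step n b1 b2 \<mu>"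
    "distr (step_pair n b1 b2 (Q j)) (config_space n) snd = law (Suc (\<sigma> j))" for j
  proof -
    have pQ: "prob_space (Q j)" "sets (Q j) = sets (pair_space n)"
      unfolding Q_def by (rule \<Omega>.prob_space_distr) (simp_all add: mQ)
    have [measurable]: "fst \<in> pair_space n \<rightarrow>\<^sub>M config_space n" "snd \<in> pair_space n \<rightarrow>\<^sub>M config_space n" by measurable
    have "distr (Q j) (config_space n) fst = \<mu>" "distr (Q j) (config_space n) snd = law (\<sigma> j)"
      unfolding Q_def \<mu>_def law_def by (subst distr_distr; simp add: comp_def)+
    then show "distr (step_pair n b1 b2 (Q j)) (config_space n) fst = step n b1 b2 \<mu>"
      "distr (step_pair n b1 b2 (Q j)) (config_space n) snd = law (Suc (\<sigma> j))"
      using distr_step_pair[OF pQ] by (simp_all add: law_Suc)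
  qed
  have lim1: "(\<lambda>j. measure (step n b1 b2 \<mu>) (cylinder n J Y) - measure (law (Suc (\<sigma> j))) (cylinder n J Y)) \<longlonglongrightarrow> 0"
  proof (rule Lim_null_comparison[of _ "\<lambda>j. \<Sum>x\<in>J. \<Sum>k<n. \<P>(\<omega> in \<Omega>. Xlim \<omega> 0 \<noteq> X (\<sigma> j) \<omega> 0)"])
    show "\<forall>\<^sub>F j in sequentially. norm (measure (step n b1 b2 \<mu>) (cylinder n J Y) - measure (law (Suc (\<sigma> j))) (cylinder n J Y))
      \<le> (\<Sum>x\<in>J. \<Sum>k<n. \<P>(\<omega> in \<Omega>. Xlim \<omega> 0 \<noteq> X (\<sigma> j) \<omega> 0))"
    proof (rule always_eventually, rule allI)
      fix j
      interpret S: coupled_row "step_pair n b1 b2 (Q j)" n b1 b2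
        by (rule coupled_row.coupled_row_step[OF coup])
      have "norm (measure (step n b1 b2 \<mu>) (cylinder n J Y) - measure (law (Suc (\<sigma> j))) (cylinder n J Y)) \<le>
        (\<Sum>x\<in>J. S.prob {p \<in> space (step_pair n b1 b2 (Q j)). fst p x \<noteq> snd p x})"
        unfolding margins[of j, symmetric] real_norm_def
        using J by (intro S.coupling_cylinder) (measurable; fail)+
      also have "\<dots> \<le> (\<Sum>x\<in>J. \<Sum>k<n. prob_disc k (step_pair n b1 b2 (Q j)))"
        by (intro sum_mono prob_neq_le S.measure_preserving_axioms S.sets_Q)
      also have "\<dots> \<le> (\<Sum>x\<in>J. \<Sum>k<n. \<P>(\<omega> in \<Omega>. Xlim \<omega> 0 \<noteq> X (\<sigma> j) \<omega> 0))"
      proof (intro sum_mono)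
        fix k
        have "prob_disc k (step_pair n b1 b2 (Q j)) \<le> prob_disc k (Q j)"
          unfolding prob_disc_def coupled_row.prob_step_disc[OF coup] by simp
        also have "\<dots> = \<P>(\<omega> in \<Omega>. disc k (Xlim \<omega> 0) (X (\<sigma> j) \<omega> 0))"
          unfolding prob_disc_def Q_def by (subst prob_pair_law) simp_all
        also have "\<dots> \<le> \<P>(\<omega> in \<Omega>. Xlim \<omega> 0 \<noteq> X (\<sigma> j) \<omega> 0)"
          by (rule \<Omega>.finite_measure_mono) (auto simp: disc_def)
        finally show "prob_disc k (step_pair n b1 b2 (Q j)) \<le> \<P>(\<omega> in \<Omega>. Xlim \<omega> 0 \<noteq> X (\<sigma> j) \<omega> 0)" .
      qed
      finally show "norm (measure (step n b1 b2 \<mu>) (cylinder n J Y) - measure (law (Suc (\<sigma> j))) (cylinder n J Y))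
        \<le> (\<Sum>x\<in>J. \<Sum>k<n. \<P>(\<omega> in \<Omega>. Xlim \<omega> 0 \<noteq> X (\<sigma> j) \<omega> 0))" .
    qed
    have "(\<lambda>j. \<Sum>x\<in>J. \<Sum>k<n. \<P>(\<omega> in \<Omega>. Xlim \<omega> 0 \<noteq> X (\<sigma> j) \<omega> 0)) \<longlonglongrightarrow> (\<Sum>x\<in>J. \<Sum>k<n. 0)"
      by (intro tendsto_sum prob_Xlim_neq)
    then show "(\<lambda>j. \<Sum>x\<in>J. \<Sum>k<n. \<P>(\<omega> in \<Omega>. Xlim \<omega> 0 \<noteq> X (\<sigma> j) \<omega> 0)) \<longlonglongrightarrow> 0" by simp
  qed
  \<comment> \<open>The defining bound of \<sigma> with r = 1: starting one unit of time earlier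
    hardly changes the state at time 0.\<close>
  have lim2: "(\<lambda>j. measure (law (\<sigma> j)) (cylinder n J Y) - measure (law (Suc (\<sigma> j))) (cylinder n J Y)) \<longlonglongrightarrow> 0"
  proof (rule Lim_null_comparison[of _ "\<lambda>j. real (card J) * (1 / 2) ^ j"])
    have "norm (measure (law (\<sigma> j)) (cylinder n J Y) - measure (law (Suc (\<sigma> j))) (cylinder n J Y)) \<le> real (card J) * (1 / 2) ^ j" for j
    proof -
      have "norm (measure (law (\<sigma> j)) (cylinder n J Y) - measure (law (Suc (\<sigma> j))) (cylinder n J Y)) \<le>
        (\<Sum>x\<in>J. \<P>(\<omega> in \<Omega>. X (\<sigma> j) \<omega> x \<noteq> X (Suc (\<sigma> j)) \<omega> x))"
        unfolding law_def real_norm_def by (rule \<Omega>.coupling_cylinder[OF measurable_X measurable_X J])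
      also have "\<dots> \<le> (\<Sum>x\<in>J. (1 / 2) ^ j)"
        by (intro sum_mono) (use \<sigma>[of j "\<sigma> j" _ 1] in simp)
      finally show ?thesis by simp
    qed
    then show "\<forall>\<^sub>F j in sequentially. norm (measure (law (\<sigma> j)) (cylinder n J Y) - measure (law (Suc (\<sigma> j))) (cylinder n J Y)) \<le> real (card J) * (1 / 2) ^ j"
      by simp
    have "(\<lambda>j. real (card J) * (1 / 2) ^ j) \<longlonglongrightarrow> real (card J) * 0"
      by (intro tendsto_intros LIMSEQ_power_zero) simp
    then show "(\<lambda>j. real (card J) * (1 / 2) ^ j) \<longlonglongrightarrow> 0" by simp
  qed
  have "(\<lambda>j. measure (step n b1 b2 \<mu>) (cylinder n J Y)) \<longlonglongrightarrow> 0 - 0 + measure \<mu> (cylinder n J Y)"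
    using tendsto_add[OF tendsto_diff[OF lim1 lim2] law_cylinder_tendsto[OF J, of Y]] by simp
  then show "measure (step n b1 b2 \<mu>) (cylinder n J Y) = measure \<mu> (cylinder n J Y)"
    by (simp add: LIMSEQ_const_iff)
qed (use measure_preserving_\<mu> in \<open>auto simp: sets_\<mu> measure_preserving_def intro: prob_space_step\<close>)

end

section \<open>The six-vertex process\<close>

definition merge_noise :: "(int \<times> nat \<Rightarrow> bool) \<Rightarrow> (int \<times> nat \<Rightarrow> bool) \<Rightarrow> nat \<times> int \<times> bool \<Rightarrow> bool" where
  "merge_noise \<chi>1 \<chi>2 = (\<lambda>(t, x, i). if i then \<chi>1 (x, t) else \<chi>2 (x, t))"

lemma distr_merge_noise:
  "(\<lambda>(\<chi>1, \<chi>2). merge_noise \<chi>1 \<chi>2) \<in> bernoulli_family b1 \<Otimes>\<^sub>M bernoulli_family b2 \<rightarrow>\<^sub>M noise b1 b2"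
  "distr (bernoulli_family b1 \<Otimes>\<^sub>M bernoulli_family b2) (noise b1 b2) (\<lambda>(\<chi>1, \<chi>2). merge_noise \<chi>1 \<chi>2) = noise b1 b2"
proof -
  let ?f = "\<lambda>(x :: int, t :: nat). (t, x, True)" and ?g = "\<lambda>(x :: int, t :: nat). (t, x, False)"
  let ?N = "\<lambda>z :: nat \<times> int \<times> bool. bern b1 b2 (snd (snd z))"
  have N: "(\<Pi>\<^sub>M i\<in>UNIV. ?N (?f i)) = bernoulli_family b1" "(\<Pi>\<^sub>M l\<in>UNIV. ?N (?g l)) = bernoulli_family b2" "PiM UNIV ?N = noise b1 b2"
    by (simp_all add: bernoulli_family_def noise_def bern_def case_prod_beta')
  have inj: "inj ?f" "inj ?g" and disj: "range ?f \<inter> range ?g = {}" by (auto simp: inj_on_def)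
  have un: "range ?f \<union> range ?g = UNIV"
  proof (rule set_eqI)
    fix s :: "nat \<times> int \<times> bool"
    obtain t x i where "s = (t, x, i)" by (cases s)
    then show "s \<in> range ?f \<union> range ?g \<longleftrightarrow> s \<in> UNIV"
      by (cases i) (auto intro: rev_image_eqI[of "(x, t)"])
  qed
  have h: "(\<lambda>(\<chi>1, \<chi>2). merge_noise \<chi>1 \<chi>2) (u, v) (?f i) = u i" "(\<lambda>(\<chi>1, \<chi>2). merge_noise \<chi>1 \<chi>2) (u, v) (?g i) = v i" for u v i
    by (simp_all add: merge_noise_def case_prod_beta')
  note G = distr_PiM_glue[of ?N ?f ?g "\<lambda>(\<chi>1, \<chi>2). merge_noise \<chi>1 \<chi>2", OF prob_space_bern inj disj un h, unfolded N]
  show "(\<lambda>(\<chi>1, \<chi>2). merge_noise \<chi>1 \<chi>2) \<in> bernoulli_family b1 \<Otimes>\<^sub>M bernoulli_family b2 \<rightarrow>\<^sub>M noise b1 b2"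
    by (rule G(1))
  show "distr (bernoulli_family b1 \<Otimes>\<^sub>M bernoulli_family b2) (noise b1 b2) (\<lambda>(\<chi>1, \<chi>2). merge_noise \<chi>1 \<chi>2) = noise b1 b2"
    by (rule G(2))
qed

lemma AE_good_slices:
  assumes b: "0 < b1" "b1 < 1" "0 < b2" "b2 < 1"
  shows "AE w in noise b1 b2. \<forall>t. good_row (slice t w)"
  unfolding AE_all_countable
proof
  fix t
  have "distr (noise b1 b2) (row_noise b1 b2) (slice t) = row_noise b1 b2"
    using distr_PiM_reindex[of UNIV "\<lambda>z :: nat \<times> int \<times> bool. bern b1 b2 (snd (snd z))" "Pair t" UNIV] prob_space_bern
    by (simp add: noise_def row_noise_def slice_def[abs_def] inj_on_def restrict_def)
  moreover have "AE w in row_noise b1 b2. good_row w" using b by (intro AE_good_row) auto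
  ultimately have "AE r in distr (noise b1 b2) (row_noise b1 b2) (slice t). good_row r" by (simp only:)
  moreover have "slice t \<in> noise b1 b2 \<rightarrow>\<^sub>M row_noise b1 b2" by measurable
  ultimately show "AE w in noise b1 b2. good_row (slice t w)" by (rule AE_distrD[rotated])
qed

lemma evol_le: "(\<And>x. \<eta> x \<le> n) \<Longrightarrow> evol t \<eta> w x \<le> n"
  by (induction t arbitrary: x) (simp_all add: row_le)

text \<open>The rows are solved upwards: the vertical classes of a row determine its horizontal ones
  by \<open>horiz_unique\<close>, and both determine the vertical classes of the next row.\<close>

lemma consistent_iff_evol:
  assumes good: "\<And>t. good_row (slice t (merge_noise \<chi>1 \<chi>2))" and \<eta>: "\<And>x. \<eta> x \<le> n"
  defines "w \<equiv> merge_noise \<chi>1 \<chi>2"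
  shows "consistent n \<chi>1 \<chi>2 \<eta> e \<longleftrightarrow>
    e = (\<lambda>(x, t). evol t \<eta> w x, \<lambda>(x, t). horiz (slice t w) (evol t \<eta> w) x)"
proof
  have vertex: "vertex (slice t w) x = vertex_out (\<chi>1 (x, t)) (\<chi>2 (x, t))" for t x
    by (simp add: vertex_def slice_def w_def merge_noise_def)
  have good': "good_row (slice t w)" for t using good by (simp add: w_def)
  show "consistent n \<chi>1 \<chi>2 \<eta> e" if e: "e = (\<lambda>(x, t). evol t \<eta> w x, \<lambda>(x, t). horiz (slice t w) (evol t \<eta> w) x)"
    using vertex_row_horiz[OF good'] evol_le[of \<eta> n, OF \<eta>] horiz_le[of _ n]
    by (auto simp: consistent_def e vertex[symmetric])
  assume "consistent n \<chi>1 \<chi>2 \<eta> e"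
  moreover obtain v h where e: "e = (v, h)" by (cases e)
  ultimately have v0: "\<And>x. v (x, 0) = \<eta> x"
    and step: "\<And>x t. (v (x, Suc t), h (x + 1, t)) = vertex (slice t w) x (v (x, t)) (h (x, t))"
    by (auto simp: consistent_def vertex)
  have h: "h (x, t) = horiz (slice t w) (\<lambda>x. v (x, t)) x" for x t
    by (rule horiz_unique[OF good', where h = "\<lambda>x. h (x, t)"]) (metis step snd_conv)
  have v: "(\<lambda>x. v (x, t)) = evol t \<eta> w" for t
  proof (induction t)
    case (Suc t)
    have "v (x, Suc t) = row (slice t w) (\<lambda>x. v (x, t)) x" for x
      using step[of x t] by (metis fst_conv h row_def)
    then show ?case by (simp add: Suc fun_eq_iff)
  qed (simp add: v0)
  show "e = (\<lambda>(x, t). evol t \<eta> w x, \<lambda>(x, t). horiz (slice t w) (evol t \<eta> w) x)"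
    using h v by (auto simp: e fun_eq_iff)
qed

lemma six_vertex_eq_evol:
  assumes "\<And>t. good_row (slice t (merge_noise \<chi>1 \<chi>2))" "\<And>x. \<eta> x \<le> n"
  shows "six_vertex n (\<eta>, \<chi>1, \<chi>2) t = evol t \<eta> (merge_noise \<chi>1 \<chi>2)"
proof -
  define E where "E = (\<lambda>(x, t). evol t \<eta> (merge_noise \<chi>1 \<chi>2) x,
    \<lambda>(x, t). horiz (slice t (merge_noise \<chi>1 \<chi>2)) (evol t \<eta> (merge_noise \<chi>1 \<chi>2)) x)"
  have "consistent n \<chi>1 \<chi>2 \<eta> = (\<lambda>e. e = E)"
    unfolding E_def by (intro ext consistent_iff_evol assms)
  then have ex: "\<exists>!e. consistent n \<chi>1 \<chi>2 \<eta> e" and the: "(THE e. consistent n \<chi>1 \<chi>2 \<eta> e) = E"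
    by (simp_all only: the_eq_trivial ex1_eq)
  have "six_vertex n (\<eta>, \<chi>1, \<chi>2) t x = fst (THE e. consistent n \<chi>1 \<chi>2 \<eta> e) (x, t)" for x
    using ex by (simp add: six_vertex_def)
  then show ?thesis unfolding the by (simp add: E_def fun_eq_iff)
qed

lemma six_vertex_le:
  assumes "\<And>x. \<eta> x \<le> n" shows "six_vertex n (\<eta>, \<chi>1, \<chi>2) t x \<le> n"
proof (cases "\<exists>!e. consistent n \<chi>1 \<chi>2 \<eta> e")
  case True
  from theI'[OF True] have "fst (THE e. consistent n \<chi>1 \<chi>2 \<eta> e) (x, t) \<in> {0..n}"
    by (auto simp: consistent_def case_prod_beta')
  then show ?thesis using True by (simp add: six_vertex_def)
qed (simp add: six_vertex_def assms)

section \<open>From the six-vertex process to iterates of \<open>step\<close>\<close>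

lemma distr_completion_cong_AE:
  assumes g: "g \<in> M \<rightarrow>\<^sub>M N" and eq: "AE x in M. f x = g x" and f: "\<And>x. x \<in> space M \<Longrightarrow> f x \<in> space N"
  shows "distr (completion M) N f = distr M N g"
proof -
  have g': "g \<in> completion M \<rightarrow>\<^sub>M N" using g by (rule measurable_completion)
  have eq': "AE x in completion M. f x = g x" using eq by (rule AE_completion)
  have "f \<in> completion M \<rightarrow>\<^sub>M N"
  proof (rule measurableI)
    fix A assume A: "A \<in> sets N"
    have "AE x in completion M. x \<in> g -` A \<inter> space (completion M) \<longleftrightarrow> x \<in> f -` A \<inter> space (completion M)"
      using eq' by eventually_elim auto
    then show "f -` A \<inter> space (completion M) \<in> sets (completion M)"
      using measurable_sets[OF g' A] by (rule completion.in_sets_AE) simp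
  qed (use f in simp)
  then have "distr (completion M) N f = distr (completion M) N g"
    using eq' g' by (intro distr_cong_AE) auto
  then show ?thesis using distr_completion[OF g] by simp
qed

text \<open>Almost surely all rows are good and \<open>six_vertex\<close> is the measurable map
  \<open>evol\<close>; the completion absorbs the exceptional null set, and the two Bernoulli
  families are joined into one noise field.\<close>

lemma six_vertex_law_eq:
  assumes b: "0 < b1" "b1 < 1" "0 < b2" "b2 < 1"
    and \<mu>: "prob_space \<mu>" and sets_\<mu> [measurable_cong]: "sets \<mu> = sets (config_space n)"
  shows "six_vertex_law n b1 b2 \<mu> t = (step n b1 b2 ^^ t) \<mu>"
proof -
  define B where "B = bernoulli_family b1 \<Otimes>\<^sub>M bernoulli_family b2"
  define \<psi> where "\<psi> = (\<lambda>(\<chi>1, \<chi>2). merge_noise \<chi>1 \<chi>2)"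
  interpret \<mu>: prob_space \<mu> by fact
  have pB: "prob_space (bernoulli_family b)" for b
    unfolding bernoulli_family_def by (rule prob_space_PiM) (simp add: prob_space_measure_pmf)
  interpret B1: prob_space "bernoulli_family b1" by (rule pB)
  interpret B2: prob_space "bernoulli_family b2" by (rule pB)
  interpret B12: pair_prob_space "bernoulli_family b1" "bernoulli_family b2" ..
  have prob_B: "prob_space B" unfolding B_def by (rule B12.prob_space_axioms)
  interpret B: prob_space B by (rule prob_B)
  interpret \<mu>B: pair_prob_space \<mu> B ..
  have \<psi> [measurable]: "\<psi> \<in> B \<rightarrow>\<^sub>M noise b1 b2" and D: "distr B (noise b1 b2) \<psi> = noise b1 b2"
    unfolding B_def \<psi>_def by (rule distr_merge_noise)+
  define g where "g = (\<lambda>(\<eta>, c). evol t \<eta> (\<psi> c))"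
  have g: "g \<in> \<mu> \<Otimes>\<^sub>M B \<rightarrow>\<^sub>M config_space n" unfolding g_def by measurable
  have space_\<mu>: "space \<mu> = {\<eta>. \<forall>x. \<eta> x \<le> n}"
    using sets_eq_imp_space_eq[OF sets_\<mu>] by (simp add: space_config_space)
  have "AE w in noise b1 b2. \<forall>t. good_row (slice t w)" using b by (rule AE_good_slices)
  then have "AE w in distr B (noise b1 b2) \<psi>. \<forall>t. good_row (slice t w)" by (simp only: D)
  then have good: "AE c in B. \<forall>t. good_row (slice t (\<psi> c))" by (rule AE_distrD[OF \<psi>])
  have "AE \<omega> in \<mu> \<Otimes>\<^sub>M B. \<forall>t. good_row (slice t (\<psi> (snd \<omega>)))"
    using good by (intro \<mu>B.AE_pair_measure) auto
  then have eq: "AE \<omega> in \<mu> \<Otimes>\<^sub>M B. six_vertex n \<omega> t = g \<omega>"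
    using AE_space
  proof eventually_elim
    case (elim \<omega>)
    obtain \<eta> \<chi>1 \<chi>2 where \<omega>: "\<omega> = (\<eta>, \<chi>1, \<chi>2)" by (cases \<omega>)
    then show ?case
      using elim six_vertex_eq_evol[of \<chi>1 \<chi>2 \<eta> n t]
      by (simp add: g_def \<psi>_def space_pair_measure space_\<mu>)
  qed
  have "six_vertex n \<omega> t \<in> space (config_space n)" if "\<omega> \<in> space (\<mu> \<Otimes>\<^sub>M B)" for \<omega>
    using that six_vertex_le by (cases \<omega>) (auto simp: space_pair_measure space_\<mu> space_config_space)
  then have "six_vertex_law n b1 b2 \<mu> t = distr (\<mu> \<Otimes>\<^sub>M B) (config_space n) g"
    unfolding six_vertex_law_def six_vertex_space_def B_def[symmetric]
    by (rule distr_completion_cong_AE[OF g eq])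
  also have "\<dots> = distr (\<mu> \<Otimes>\<^sub>M noise b1 b2) (config_space n) (\<lambda>(\<eta>, w). evol t \<eta> w)"
  proof -
    have "distr (\<mu> \<Otimes>\<^sub>M noise b1 b2) (config_space n) (\<lambda>(\<eta>, w). evol t \<eta> w) =
      distr (distr (\<mu> \<Otimes>\<^sub>M B) (\<mu> \<Otimes>\<^sub>M noise b1 b2) (\<lambda>(a, c). (a, \<psi> c))) (config_space n) (\<lambda>(\<eta>, w). evol t \<eta> w)"
      using distr_pair_snd_distr[OF \<mu> prob_B \<psi> D] by simp
    also have "\<dots> = distr (\<mu> \<Otimes>\<^sub>M B) (config_space n) g"
      by (subst distr_distr) (auto simp: comp_def case_prod_beta' g_def)
    finally show ?thesis by simp
  qed
  also have "\<dots> = (step n b1 b2 ^^ t) \<mu>" by (rule distr_evol[OF \<mu> sets_\<mu>])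
  finally show ?thesis .
qed

lemma six_vertex_stationary_iff:
  assumes "0 < b1" "b1 < 1" "0 < b2" "b2 < 1" "prob_space \<mu>" "sets \<mu> = sets (config_space n)"
  shows "six_vertex_stationary n b1 b2 \<mu> \<longleftrightarrow> step n b1 b2 \<mu> = \<mu>"
proof
  assume "six_vertex_stationary n b1 b2 \<mu>"
  then have "six_vertex_law n b1 b2 \<mu> 1 = \<mu>" by (simp add: six_vertex_stationary_def)
  then show "step n b1 b2 \<mu> = \<mu>" by (simp add: six_vertex_law_eq[OF assms])
next
  assume *: "step n b1 b2 \<mu> = \<mu>"
  have "(step n b1 b2 ^^ t) \<mu> = \<mu>" for t by (induction t) (simp_all add: *)
  then show "six_vertex_stationary n b1 b2 \<mu>"
    by (simp add: six_vertex_stationary_def six_vertex_law_eq[OF assms])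
qed

text \<open>All translations are generated by \<open>translate 1\<close> and its inverse, so
  invariance of sets and of the measure passes from the unit shift to every y by induction in both
  directions.\<close>

lemma translation_ergodic_iff:
  assumes p: "prob_space \<mu>" and sets_\<mu> [measurable_cong]: "sets \<mu> = sets (config_space n)"
  shows "translation_ergodic \<mu> \<longleftrightarrow> measure_preserving \<mu> (translate 1) \<and> measure_preserving.ergodic \<mu> (translate 1)"
proof
  interpret prob_space \<mu> by fact
  have m: "translate y \<in> \<mu> \<rightarrow>\<^sub>M \<mu>" for y
  proof -
    have "translate y \<in> \<mu> \<rightarrow>\<^sub>M config_space n" by measurable
    then show ?thesis using measurable_cong_sets[OF refl sets_\<mu>, of \<mu>] by simp
  qed
  have add: "translate a (translate b \<eta>) = translate (a + b) \<eta>" for a b \<eta>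
    by (simp add: translate_def fun_eq_iff algebra_simps)
  have tr0: "translate 0 = (\<lambda>\<eta>. \<eta>)" by (simp add: translate_def fun_eq_iff)
  {
    assume erg: "translation_ergodic \<mu>"
    then have "measure_preserving \<mu> (translate 1)"
      unfolding translation_ergodic_def translation_invariant_def
      by unfold_locales (use m in auto)
    then interpret T: measure_preserving \<mu> "translate 1" .
    have "prob A = 0 \<or> prob A = 1" if A: "A \<in> events" "translate 1 -` A \<inter> space \<mu> = A" for A
    proof -
      have 1: "translate 1 \<eta> \<in> A \<longleftrightarrow> \<eta> \<in> A" if "\<eta> \<in> space \<mu>" for \<eta> using A(2) that by blast
      have "\<forall>\<eta>\<in>space \<mu>. translate y \<eta> \<in> A \<longleftrightarrow> \<eta> \<in> A" for y
      proof (induction y rule: int_induct[where k = 0])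
        case base then show ?case by (simp add: tr0)
      next
        case (step1 i)
        show ?case
        proof
          fix \<eta> assume "\<eta> \<in> space \<mu>"
          then show "translate (i + 1) \<eta> \<in> A \<longleftrightarrow> \<eta> \<in> A"
            using bspec[OF step1(2), of \<eta>] 1[OF measurable_space[OF m, of \<eta> i]] add[of 1 i \<eta>]
              by (simp add: add.commute)
        qed
      next
        case (step2 i)
        show ?case
        proof
          fix \<eta> assume \<eta>: "\<eta> \<in> space \<mu>"
          then show "translate (i - 1) \<eta> \<in> A \<longleftrightarrow> \<eta> \<in> A"
            using bspec[OF step2(2) \<eta>] 1[OF measurable_space[OF m \<eta>], of "i - 1"] add[of 1 "i - 1" \<eta>] by simp
        qed
      qed
      then have "\<forall>y. translate y -` A \<inter> space \<mu> = A" using sets.sets_into_space[OF A(1)] by blast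
      then show ?thesis using erg A(1) unfolding translation_ergodic_def by blast
    qed
    then show "measure_preserving \<mu> (translate 1) \<and> measure_preserving.ergodic \<mu> (translate 1)"
      using T.measure_preserving_axioms unfolding T.ergodic_def by blast
  }
  assume "measure_preserving \<mu> (translate 1) \<and> measure_preserving.ergodic \<mu> (translate 1)"
  then interpret T: measure_preserving \<mu> "translate 1" by blast
  have erg: T.ergodic using \<open>measure_preserving \<mu> (translate 1) \<and> measure_preserving.ergodic \<mu> (translate 1)\<close> by blast
  have dd: "distr (distr \<mu> \<mu> (translate a)) \<mu> (translate b) = distr \<mu> \<mu> (translate (b + a))" for a b
    by (subst distr_distr[OF m m]) (simp add: comp_def add)
  have "distr \<mu> \<mu> (translate y) = \<mu>" for y
  proof (induction y rule: int_induct[where k = 0])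
    case base then show ?case by (simp add: tr0 distr_id)
  next
    case (step1 i)
    have "distr \<mu> \<mu> (translate (i + 1)) = distr (distr \<mu> \<mu> (translate 1)) \<mu> (translate i)"
      by (rule dd[symmetric])
    also have "\<dots> = distr \<mu> \<mu> (translate i)" by (simp only: T.distr_T)
    finally show ?case using step1(2) by (rule trans)
  next
    case (step2 i)
    \<comment> \<open>For a negative step \<mu> is first replaced by its image under
      \<open>translate 1\<close>, which makes up for the missing unit.\<close>
    have "distr \<mu> \<mu> (translate (i - 1)) = distr (distr \<mu> \<mu> (translate 1)) \<mu> (translate (i - 1))"
      by (simp only: T.distr_T)
    also have "\<dots> = distr \<mu> \<mu> (translate i)" using dd[of 1 "i - 1"] by simp
    finally show ?case using step2(2) by (rule trans)
  qed
  then have "translation_invariant \<mu>" by (simp add: translation_invariant_def)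
  moreover have "prob A = 0 \<or> prob A = 1" if "A \<in> events" "\<forall>y. translate y -` A \<inter> space \<mu> = A" for A
    using erg that(1) spec[OF that(2), of 1] unfolding T.ergodic_def by blast
  ultimately show "translation_ergodic \<mu>" unfolding translation_ergodic_def by blast
qed

lemma prob_le_eq_sum:
  assumes p: "prob_space \<mu>" and [measurable_cong]: "sets \<mu> = sets (config_space n)"
  shows "measure \<mu> {\<eta> \<in> space \<mu>. \<eta> x \<le> k} = (\<Sum>j\<le>k. measure \<mu> {\<eta> \<in> space \<mu>. \<eta> x = j})"
proof -
  interpret prob_space \<mu> by fact
  have "{\<eta> \<in> space \<mu>. \<eta> x \<le> k} = (\<Union>j\<in>{..k}. {\<eta> \<in> space \<mu>. \<eta> x = j})" by auto
  also have "prob \<dots> = (\<Sum>j\<in>{..k}. prob {\<eta> \<in> space \<mu>. \<eta> x = j})"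
  proof (rule finite_measure_finite_Union)
    show "(\<lambda>j. {\<eta> \<in> space \<mu>. \<eta> x = j}) ` {..k} \<subseteq> events"
    proof
      fix A assume "A \<in> (\<lambda>j. {\<eta> \<in> space \<mu>. \<eta> x = j}) ` {..k}"
      then obtain j where "A = {\<eta> \<in> space \<mu>. \<eta> x = j}" by blast
      then show "A \<in> events" by simp
    qed
  qed (auto simp: disjoint_family_on_def)
  finally show ?thesis by simp
qed

theorem proposition7p5:
  fixes b1 b2 :: real and n :: nat and lam :: "nat \<Rightarrow> real"
  assumes "0 < b1" and "b1 < b2" and "b2 < 1"
    and "n \<ge> 1"
    and "\<And>k. k \<in> {0..n} \<Longrightarrow> 0 < lam k \<and> lam k < 1"
    and "(\<Sum>k=0..n. lam k) = 1"
  shows "\<exists>!\<mu>. prob_space \<mu> \<and> sets \<mu> = sets (config_space n) \<and>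
           translation_ergodic \<mu> \<and>
           six_vertex_stationary n b1 b2 \<mu> \<and>
           (\<forall>x. \<forall>k\<in>{0..n}. measure \<mu> {\<eta> \<in> space \<mu>. \<eta> x = k} = lam k)"
proof -
  have b: "0 < b1" "b1 < 1" "0 < b2" "b2 < 1" using assms(1-3) by linarith+
  have lam: "prob_weights n lam"
    using assms(5,6) by (auto simp: prob_weights_def atMost_atLeast0 less_imp_le)
  interpret S: multi_species n b1 b2 lam using b lam by unfold_locales
  interpret \<mu>: measure_preserving S.\<mu> "translate 1" by (rule S.measure_preserving_\<mu>)
  have space_\<mu>: "space S.\<mu> = space (config_space n)" by (rule sets_eq_imp_space_eq[OF S.sets_\<mu>])
  have dens: "\<mu>.prob {\<eta> \<in> space S.\<mu>. \<eta> x = k} = lam k" if "k \<le> n" for x k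
  proof -
    \<comment> \<open>Only cumulative densities are known for the limit; those of single classes are
      their differences.\<close>
    have sum: "(\<Sum>j\<le>i. \<mu>.prob {\<eta> \<in> space S.\<mu>. \<eta> x = j}) = (\<Sum>j\<le>i. lam j)" if "i \<le> n" for i
    proof -
      have "cylinder n {x} (\<lambda>_. {..i}) = {\<eta> \<in> space S.\<mu>. \<eta> x \<le> i}" by (simp add: cylinder_def space_\<mu>)
      then show ?thesis
        using S.prob_\<mu>_le[OF that, of x] prob_le_eq_sum[OF \<mu>.prob_space_axioms S.sets_\<mu>, of x i] by (simp add: S.\<rho>_def)
    qed
    show ?thesis
    proof (cases k)
      case 0 then show ?thesis using sum[of 0] by simp
    next
      case (Suc i) then show ?thesis using sum[of i] sum[of k] that by simp
    qed
  qed
  show ?thesis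
  proof (rule ex1I[of _ S.\<mu>])
    show "prob_space S.\<mu> \<and> sets S.\<mu> = sets (config_space n) \<and> translation_ergodic S.\<mu> \<and>
      six_vertex_stationary n b1 b2 S.\<mu> \<and> (\<forall>x. \<forall>k\<in>{0..n}. measure S.\<mu> {\<eta> \<in> space S.\<mu>. \<eta> x = k} = lam k)"
      using dens
      by (simp add: \<mu>.prob_space_axioms S.sets_\<mu> S.step_\<mu> S.measure_preserving_\<mu> S.ergodic_\<mu>
          translation_ergodic_iff[OF \<mu>.prob_space_axioms S.sets_\<mu>]
          six_vertex_stationary_iff[OF b \<mu>.prob_space_axioms S.sets_\<mu>])
  next
    fix \<nu>
    assume \<nu>: "prob_space \<nu> \<and> sets \<nu> = sets (config_space n) \<and> translation_ergodic \<nu> \<and>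
      six_vertex_stationary n b1 b2 \<nu> \<and> (\<forall>x. \<forall>k\<in>{0..n}. measure \<nu> {\<eta> \<in> space \<nu>. \<eta> x = k} = lam k)"
    then have p\<nu>: "prob_space \<nu>" and s\<nu>: "sets \<nu> = sets (config_space n)" by auto
    have erg: "measure_preserving \<nu> (translate 1)" "measure_preserving.ergodic \<nu> (translate 1)"
      using \<nu> translation_ergodic_iff[OF p\<nu> s\<nu>] by auto
    have st: "step n b1 b2 \<nu> = \<nu>" using \<nu> six_vertex_stationary_iff[OF b p\<nu> s\<nu>] by auto
    have space_\<nu>: "space \<nu> = space (config_space n)" by (rule sets_eq_imp_space_eq[OF s\<nu>])
    have "measure \<nu> {\<eta> \<in> space \<nu>. \<eta> 0 = j} = measure S.\<mu> {\<eta> \<in> space S.\<mu>. \<eta> 0 = j}" for j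
    proof (cases "j \<le> n")
      case True then show ?thesis using \<nu> dens by simp
    next
      case False
      \<comment> \<open>Uniqueness asks for equal densities at every threshold k, so classes above n
        appear in the sums as well.\<close>
      then have E: "{\<eta> \<in> space (config_space n). \<eta> 0 = j} = {}" by (auto simp: space_config_space)
      show ?thesis by (simp only: space_\<nu> space_\<mu> E measure_empty)
    qed
    then have "measure \<nu> {\<eta> \<in> space \<nu>. \<eta> 0 \<le> k} = measure S.\<mu> {\<eta> \<in> space S.\<mu>. \<eta> 0 \<le> k}" for k
      by (simp add: prob_le_eq_sum[OF p\<nu> s\<nu>] prob_le_eq_sum[OF \<mu>.prob_space_axioms S.sets_\<mu>])
    then show "\<nu> = S.\<mu>"
      by (rule stationary_unique[OF b erg s\<nu> st S.measure_preserving_\<mu> S.ergodic_\<mu> S.sets_\<mu> S.step_\<mu>])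
  qed
qed

end
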